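(* Let $d,e,m\ge 0$ be integers. The Taylor variety $\mathcal{T}^1_{d,e,m}\subset\mathbb{P}^m$ is irreducible of dimension $\min\{d+e,m\}$. If $d+e<m$, then $\mathcal{T}^1_{d,e,m}=\{T\in\mathbb{P}^m : \operatorname{rank}(P_T)\le e\}$, and the homogeneous prime ideal of $\mathcal{T}^1_{d,e,m}$ in $\mathbb{C}[c_0,\dots,c_m]$ equals $I_{e+1}(P_T)$, the ideal generated by the $(e+1)\times(e+1)$ minors of $P_T$.
   Context: Work over $\mathbb{C}$ in one variable $x$. Let $\mathbb{P}^m$ be projective space with coordinates $(c_0:c_1:\cdots:c_m)$, whose points $T$ are identified with nonzero polynomials $T=c_0+c_1x+\cdots+c_mx^m$ up to scaling. The Taylor variety $\mathcal{T}^1_{d,e,m}\subseteq\mathbb{P}^m$ is the Zariski closure of the set of all order-$m$ Taylor polynomials at $0$ (i.e. the Taylor series truncated after the terms of degree $m$) of rational functions $P/Q$, where $P,Q\in\mathbb{C}[x]$ satisfy $\deg P\le d$, $\deg Q\le e$ and $P(0)=Q(0)=1$. For $d+e<m$, $P_T$ is the $(m-d)\times(e+1)$ Hankel matrix $$P_T=\begin{bmatrix} c_m & c_{m-1} & \cdots & c_{m-e}\\ c_{m-1} & c_{m-2} & \cdots & c_{m-e-1}\\ \vdots & \vdots & \ddots & \vdots\\ c_{d+2} & c_{d+1} & \cdots & c_{d-e+2}\\ c_{d+1} & c_d & \cdots & c_{d-e+1}\end{bmatrix},$$ where $c_i=0$ whenever $i<0$. When forming minors the $c_i$ are regarded as indeterminates;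 when speaking of the rank of $P_T$ at a point $T$ they are the coordinates of $T$. *)

theory Defs
  imports
    "HOL-Complex_Analysis.Complex_Analysis"
    "HOL-Algebra.Ideal"
    "HOL-Library.Poly_Mapping"
    "HOL-Library.Extended_Nat"
    "Jordan_Normal_Form.DL_Rank"
    "Jordan_Normal_Form.DL_Submatrix"
begin

section \<open>The polynomial ring \<open>\<complex>[c\<^sub>0, \<dots>, c\<^sub>m]\<close>\<close>

text \<open>An exponent vector is an element of \<open>nat \<Rightarrow>\<^sub>0 nat\<close>; a polynomial in \<open>c\<^sub>0, c\<^sub>1, \<dots>\<close> maps
  exponent vectors to coefficients, with the convolution product of \<open>Poly_Mapping\<close>.\<close>

type_synonym cpoly = "(nat \<Rightarrow>\<^sub>0 nat) \<Rightarrow>\<^sub>0 complex"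

definition indet :: "nat \<Rightarrow> cpoly" where
  "indet i = Poly_Mapping.single (Poly_Mapping.single i 1) 1"

definition cpoly_ring :: "nat \<Rightarrow> cpoly ring" where
  "cpoly_ring m = class_ring
     \<lparr>carrier := {f. \<forall>a\<in>Poly_Mapping.keys f. Poly_Mapping.keys a \<subseteq> {..m}}\<rparr>"

definition cpoly_eval :: "(nat \<Rightarrow> complex) \<Rightarrow> cpoly \<Rightarrow> complex" where
  "cpoly_eval c f = (\<Sum>a\<in>Poly_Mapping.keys f.
     Poly_Mapping.lookup f a * (\<Prod>i\<in>Poly_Mapping.keys a. c i ^ Poly_Mapping.lookup a i))"

definition total_degree :: "(nat \<Rightarrow>\<^sub>0 nat) \<Rightarrow> nat" where
  "total_degree a = (\<Sum>i\<in>Poly_Mapping.keys a. Poly_Mapping.lookup a i)"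

definition homogeneous_polys :: "nat \<Rightarrow> cpoly set" where
  "homogeneous_polys m =
     {f \<in> carrier (cpoly_ring m). \<exists>n. \<forall>a\<in>Poly_Mapping.keys f. total_degree a = n}"


section \<open>Projective space and its Zariski topology\<close>

text \<open>A point of \<open>\<P>\<^sup>m\<close> is the set of all nonzero multiples of a nonzero polynomial
  \<open>T = c\<^sub>0 + c\<^sub>1 x + \<dots> + c\<^sub>m x\<^sup>m\<close>; its homogeneous coordinates are the coefficients of \<open>T\<close>.\<close>

definition proj_point :: "complex poly \<Rightarrow> complex poly set" where
  "proj_point T = {Polynomial.smult a T | a. a \<noteq> 0}"

definition proj_space :: "nat \<Rightarrow> complex poly set set" where
  "proj_space m = {proj_point T | T. T \<noteq> 0 \<and> Polynomial.degree T \<le> m}"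

definition vanishes_at :: "cpoly \<Rightarrow> complex poly set \<Rightarrow> bool" where
  "vanishes_at f X \<longleftrightarrow> (\<forall>T\<in>X. cpoly_eval (Polynomial.coeff T) f = 0)"

definition zero_locus :: "nat \<Rightarrow> cpoly set \<Rightarrow> complex poly set set" where
  "zero_locus m S = {X \<in> proj_space m. \<forall>f\<in>S. vanishes_at f X}"

definition zariski :: "nat \<Rightarrow> complex poly set topology" where
  "zariski m = topology (\<lambda>U. \<exists>S \<subseteq> homogeneous_polys m. U = proj_space m - zero_locus m S)"

definition vanishing_ideal :: "nat \<Rightarrow> complex poly set set \<Rightarrow> cpoly set" where
  "vanishing_ideal m V =
     Idl\<^bsub>cpoly_ring m\<^esub> {f \<in> homogeneous_polys m. \<forall>X\<in>V. vanishes_at f X}"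


section \<open>Irreducibility and dimension of topological spaces\<close>

definition irreducible_space :: "'a topology \<Rightarrow> bool" where
  "irreducible_space Y \<longleftrightarrow> topspace Y \<noteq> {} \<and>
     (\<forall>A B. closedin Y A \<and> closedin Y B \<and> A \<union> B = topspace Y \<longrightarrow>
        A = topspace Y \<or> B = topspace Y)"

definition krull_dim :: "'a topology \<Rightarrow> enat" where
  "krull_dim Y = Sup {enat n | n. \<exists>Z :: nat \<Rightarrow> 'a set.
     (\<forall>i\<le>n. closedin Y (Z i) \<and> irreducible_space (subtopology Y (Z i))) \<and>
     (\<forall>i<n. Z i \<subset> Z (Suc i))}"


section \<open>Taylor varieties and their Hankel matrices\<close>

definition taylor_poly :: "nat \<Rightarrow> (complex \<Rightarrow> complex) \<Rightarrow> complex poly" where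
  "taylor_poly m f = truncate_fps (Suc m) (fps_expansion f 0)"

definition taylor_variety :: "nat \<Rightarrow> nat \<Rightarrow> nat \<Rightarrow> complex poly set set" where
  "taylor_variety d e m = zariski m closure_of
     {proj_point (taylor_poly m (\<lambda>x. poly P x / poly Q x)) | P Q.
        Polynomial.degree P \<le> d \<and> Polynomial.degree Q \<le> e \<and> poly P 0 = 1 \<and> poly Q 0 = 1}"

text \<open>The row with index \<open>i\<close> is \<open>c\<^sub>m\<^sub>-\<^sub>i, c\<^sub>m\<^sub>-\<^sub>i\<^sub>-\<^sub>1, \<dots>, c\<^sub>m\<^sub>-\<^sub>i\<^sub>-\<^sub>e\<close>; the case distinction implements
  \<open>c\<^sub>k = 0\<close> for \<open>k < 0\<close>.  The entries are either the indeterminates or the coordinates of a point.\<close>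

definition hankel_mat :: "nat \<Rightarrow> nat \<Rightarrow> nat \<Rightarrow> (nat \<Rightarrow> 'a::zero) \<Rightarrow> 'a mat" where
  "hankel_mat d e m c =
     mat (m - d) (e + 1) (\<lambda>(i, j). if i + j \<le> m then c (m - (i + j)) else 0)"

definition mat_rank :: "complex mat \<Rightarrow> nat" where
  "mat_rank A = vec_space.rank (dim_row A) A"

definition minors :: "nat \<Rightarrow> 'a::comm_ring_1 mat \<Rightarrow> 'a set" where
  "minors k A = {det (submatrix A I J) | I J.
     I \<subseteq> {..<dim_row A} \<and> J \<subseteq> {..<dim_col A} \<and> card I = k \<and> card J = k}"

definition minor_ideal :: "nat \<Rightarrow> nat \<Rightarrow> nat \<Rightarrow> cpoly set" where
  "minor_ideal d e m = Idl\<^bsub>cpoly_ring m\<^esub> (minors (e + 1) (hankel_mat d e m indet))"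


section \<open>Well-definedness\<close>

lemma carrier_cpoly_ring:
  "carrier (cpoly_ring m) = {f. \<forall>a\<in>Poly_Mapping.keys f. Poly_Mapping.keys a \<subseteq> {..m}}"
  by (simp add: cpoly_ring_def class_ring_simps)

lemma cpoly_ring_simps [simp]:
  "x \<otimes>\<^bsub>cpoly_ring m\<^esub> y = x * y" "x \<oplus>\<^bsub>cpoly_ring m\<^esub> y = x + y"
  "\<one>\<^bsub>cpoly_ring m\<^esub> = 1" "\<zero>\<^bsub>cpoly_ring m\<^esub> = 0"
  by (simp_all add: cpoly_ring_def class_ring_simps)

lemma carrier_mult:
  assumes "f \<in> carrier (cpoly_ring m)" "g \<in> carrier (cpoly_ring m)"
  shows "f * g \<in> carrier (cpoly_ring m)"
proof -
  { fix a assume "a \<in> Poly_Mapping.keys (f * g)"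
    then obtain b c where a: "a = b + c" "b \<in> Poly_Mapping.keys f" "c \<in> Poly_Mapping.keys g"
      using keys_mult[of f g] by blast
    have "Poly_Mapping.keys a \<subseteq> {..m}"
      using assms a keys_add[of b c] unfolding carrier_cpoly_ring by blast }
  thus ?thesis by (auto simp: carrier_cpoly_ring)
qed

lemma cring_cpoly_ring: "cring (cpoly_ring m)"
proof (rule cringI)
  show "abelian_group (cpoly_ring m)"
  proof (rule abelian_groupI)
    fix x y assume "x \<in> carrier (cpoly_ring m)" "y \<in> carrier (cpoly_ring m)"
    thus "x \<oplus>\<^bsub>cpoly_ring m\<^esub> y \<in> carrier (cpoly_ring m)"
      using keys_add[of x y] by (auto simp: carrier_cpoly_ring)
  next
    fix x assume "x \<in> carrier (cpoly_ring m)"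
    hence "-x \<in> carrier (cpoly_ring m)"
      by (auto simp: carrier_cpoly_ring in_keys_iff)
    thus "\<exists>y\<in>carrier (cpoly_ring m). y \<oplus>\<^bsub>cpoly_ring m\<^esub> x = \<zero>\<^bsub>cpoly_ring m\<^esub>"
      by (intro bexI[of _ "-x"]) auto
  qed (auto simp: carrier_cpoly_ring algebra_simps)
  show "Group.comm_monoid (cpoly_ring m)"
    by (rule comm_monoidI) (auto simp: carrier_mult algebra_simps, auto simp: carrier_cpoly_ring)
qed (auto simp: algebra_simps)

lemma cpoly_eval_add: "cpoly_eval c (f + g) = cpoly_eval c f + cpoly_eval c g"
  unfolding cpoly_eval_def
  by (rule setsum_keys_plus_distrib) (auto simp: algebra_simps)

lemma monomial_eval_add:
  fixes c :: "nat \<Rightarrow> complex"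
  shows "(\<Prod>i\<in>Poly_Mapping.keys (a + b). c i ^ Poly_Mapping.lookup (a + b) i) =
    (\<Prod>i\<in>Poly_Mapping.keys a. c i ^ Poly_Mapping.lookup a i) *
    (\<Prod>i\<in>Poly_Mapping.keys b. c i ^ Poly_Mapping.lookup b i)"
proof -
  let ?K = "Poly_Mapping.keys a \<union> Poly_Mapping.keys b"
  have *: "(\<Prod>i\<in>Poly_Mapping.keys k. c i ^ Poly_Mapping.lookup k i) =
      (\<Prod>i\<in>?K. c i ^ Poly_Mapping.lookup k i)" if "Poly_Mapping.keys k \<subseteq> ?K" for k
    using that by (intro prod.mono_neutral_left) (auto simp: in_keys_iff)
  show ?thesis
    using keys_add[of a b]
    by (subst (1 2 3) *) (auto simp: lookup_add power_add prod.distrib)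
qed

lemma total_degree_add: "total_degree (a + b) = total_degree a + total_degree b"
  unfolding total_degree_def by (rule setsum_keys_plus_distrib) auto

lemma cpoly_eval_single:
  "cpoly_eval c (Poly_Mapping.single a u) =
     u * (\<Prod>i\<in>Poly_Mapping.keys a. c i ^ Poly_Mapping.lookup a i)"
  by (auto simp: cpoly_eval_def)

lemma cpoly_update:
  "a \<notin> Poly_Mapping.keys f \<Longrightarrow> Poly_Mapping.update a b f = Poly_Mapping.single a b + (f :: cpoly)"
  by (rule poly_mapping_eqI) (auto simp: lookup_update lookup_add lookup_single in_keys_iff when_def)

lemma cpoly_eval_zero [simp]: "cpoly_eval c 0 = 0"
  by (simp add: cpoly_eval_def)

lemma cpoly_eval_mult: "cpoly_eval c (f * g) = cpoly_eval c f * cpoly_eval c g"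
proof (induction f rule: update_induct)
  case const
  show ?case by simp
next
  case (update f a u)
  have "cpoly_eval c (Poly_Mapping.single a u * g) =
      cpoly_eval c (Poly_Mapping.single a u) * cpoly_eval c g"
  proof (induction g rule: update_induct)
    case const
    show ?case by simp
  next
    case (update g b v)
    thus ?case
      by (simp add: cpoly_update distrib_left cpoly_eval_add mult_single cpoly_eval_single
          monomial_eval_add)
  qed
  thus ?case
    using update by (simp add: cpoly_update distrib_right cpoly_eval_add)
qed

lemma homogeneous_mult:
  assumes "f \<in> homogeneous_polys m" "g \<in> homogeneous_polys m"
  shows "f * g \<in> homogeneous_polys m"
proof -
  obtain n k where "\<forall>a\<in>Poly_Mapping.keys f. total_degree a = n"
      "\<forall>a\<in>Poly_Mapping.keys g. total_degree a = k"
    using assms by (auto simp: homogeneous_polys_def)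
  hence "\<forall>a\<in>Poly_Mapping.keys (f * g). total_degree a = n + k"
    using keys_mult[of f g] by (fastforce simp: total_degree_add)
  thus ?thesis
    using assms by (auto simp: homogeneous_polys_def carrier_mult)
qed

lemma homogeneous_eval_scale:
  assumes "f \<in> homogeneous_polys m"
  shows "\<exists>n. \<forall>u c. cpoly_eval (\<lambda>i. u * c i) f = u ^ n * cpoly_eval c f"
proof -
  obtain n where n: "\<forall>a\<in>Poly_Mapping.keys f. total_degree a = n"
    using assms by (auto simp: homogeneous_polys_def)
  have "cpoly_eval (\<lambda>i. u * c i) f = u ^ n * cpoly_eval c f" for u c
    unfolding cpoly_eval_def sum_distrib_left using n
    by (intro sum.cong)
       (auto simp: power_mult_distrib prod.distrib total_degree_def power_sum[symmetric])
  thus ?thesis by blast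
qed

lemma vanishes_at_proj_point:
  assumes "f \<in> homogeneous_polys m"
  shows "vanishes_at f (proj_point T) \<longleftrightarrow> cpoly_eval (Polynomial.coeff T) f = 0"
proof -
  obtain n where "\<And>u c. cpoly_eval (\<lambda>i. u * c i) f = u ^ n * cpoly_eval c f"
    using homogeneous_eval_scale[OF assms] by blast
  hence "cpoly_eval (Polynomial.coeff (Polynomial.smult u T)) f = u ^ n * cpoly_eval (Polynomial.coeff T) f" for u
    by (simp add: coeff_smult[abs_def])
  thus ?thesis
    by (auto simp: vanishes_at_def proj_point_def intro: exI[of _ 1])
qed

lemma istopology_zariski:
  "istopology (\<lambda>U. \<exists>S \<subseteq> homogeneous_polys m. U = proj_space m - zero_locus m S)"
proof -
  let ?L = "\<lambda>U. \<exists>S \<subseteq> homogeneous_polys m. U = proj_space m - zero_locus m S"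
  have "?L (U \<inter> W)" if UW: "?L U" "?L W" for U W
  proof -
    obtain S R where S: "S \<subseteq> homogeneous_polys m" "U = proj_space m - zero_locus m S"
      and R: "R \<subseteq> homogeneous_polys m" "W = proj_space m - zero_locus m R"
      using UW by blast
    let ?Q = "{f * g | f g. f \<in> S \<and> g \<in> R}"
    have "vanishes_at (f * g) X \<longleftrightarrow> vanishes_at f X \<or> vanishes_at g X"
      if "f \<in> S" "g \<in> R" "X \<in> proj_space m" for f g X
    proof -
      have "f \<in> homogeneous_polys m" "g \<in> homogeneous_polys m" "f * g \<in> homogeneous_polys m"
        using that S R homogeneous_mult by blast+
      thus ?thesis
        using that(3) by (auto simp: proj_space_def vanishes_at_proj_point cpoly_eval_mult)
    qed
    hence "U \<inter> W = proj_space m - zero_locus m ?Q"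
      unfolding S R zero_locus_def by blast
    moreover have "?Q \<subseteq> homogeneous_polys m"
      using S R homogeneous_mult by blast
    ultimately show ?thesis by blast
  qed
  moreover have "?L (\<Union>K)" if K: "\<forall>U\<in>K. ?L U" for K
  proof -
    obtain S where S: "\<forall>U\<in>K. S U \<subseteq> homogeneous_polys m \<and> U = proj_space m - zero_locus m (S U)"
      using K by metis
    have "\<Union>K = proj_space m - zero_locus m (\<Union>U\<in>K. S U)"
      using S unfolding zero_locus_def by fastforce
    thus ?thesis using S by (intro exI[of _ "\<Union>U\<in>K. S U"]) auto
  qed
  ultimately show ?thesis
    unfolding istopology_def by simp
qed

lemma openin_zariski:
  "openin (zariski m) U \<longleftrightarrow> (\<exists>S \<subseteq> homogeneous_polys m. U = proj_space m - zero_locus m S)"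
  unfolding zariski_def by (simp add: istopology_zariski)

lemma topspace_zariski: "topspace (zariski m) = proj_space m"
proof -
  have "1 \<in> homogeneous_polys m"
    by (auto simp: homogeneous_polys_def carrier_cpoly_ring)
  moreover from this have "zero_locus m {1} = {}"
    by (auto simp: zero_locus_def proj_space_def vanishes_at_proj_point) (simp add: cpoly_eval_def)
  ultimately have "openin (zariski m) (proj_space m)"
    unfolding openin_zariski by (metis Diff_empty empty_subsetI insert_subset)
  thus ?thesis
    unfolding topspace_def openin_zariski by blast
qed

lemma closedin_zariski:
  "closedin (zariski m) V \<longleftrightarrow> (\<exists>S \<subseteq> homogeneous_polys m. V = zero_locus m S)"
proof -
  have "zero_locus m S \<subseteq> proj_space m" for S
    by (auto simp: zero_locus_def)
  thus ?thesis
    unfolding closedin_def topspace_zariski openin_zariski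
    by (metis Diff_Diff_Int inf.absorb_iff2 Diff_subset)
qed

end

theory Submission
  imports Defs "Jordan_Normal_Form.DL_Rank_Submatrix"
begin

text \<open>Let \<open>d + e < m\<close>. Weigh \<open>c\<^sub>m\<^sub>-\<^sub>i\<close> by \<open>m\<^sup>2 - i\<^sup>2\<close>. The leading monomial of a maximal minor of the Hankel matrix is
  the product along its antidiagonal, and these products are exactly the monomials of degree \<open>e + 1\<close> in
  \<open>c\<^sub>d\<^sub>+\<^sub>1, \<dots>, c\<^sub>m\<^sub>-\<^sub>e\<close>; in particular none of them is lost when entries with negative index are replaced by
  zero. Relations between the minors, obtained by expanding a determinant with a doubled column, lift the
  syzygies of these monomials, so every nonzero element of the ideal \<open>I\<close> of minors has only multiples of
  such monomials in its part of highest weight. The pivot \<open>\<Delta> = det (c\<^sub>d\<^sub>+\<^sub>i\<^sub>-\<^sub>j)\<close>, of size \<open>e\<close>, has leading monomial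
  \<open>c\<^sub>d\<^sup>e\<close> and is therefore not a zero divisor modulo \<open>I\<close>. Expanding suitable minors, a power of \<open>\<Delta>\<close> moves any
  polynomial modulo \<open>I\<close> into \<open>\<complex>[c\<^sub>0, \<dots>, c\<^sub>d\<^sub>+\<^sub>e]\<close>. Where \<open>c\<^sub>0 \<Delta>\<close> is nonzero, \<open>c\<^sub>0, \<dots>, c\<^sub>d\<^sub>+\<^sub>e\<close> can be prescribed
  freely on the cone over the Taylor polynomials, so a polynomial vanishing on that cone lies in \<open>I\<close>.
  The parametrization by \<open>P\<close> and \<open>Q\<close> shows that this ideal is prime.

  For the dimension, a chain of \<open>n + 1\<close> irreducible closed subsets yields, for some \<open>a > 0\<close> and every \<open>k\<close>, at least
  \<open>(k + n choose n)\<close> forms of degree \<open>a k\<close> that are independent on the largest member, while the parametrization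
  bounds the number of such forms by a polynomial of degree \<open>d + e\<close> in \<open>k\<close>.\<close>

section \<open>Polynomials and their evaluation\<close>

text \<open>Summed over a product of entries, only the cross terms \<open>2 r p\<close> in
  \<open>m^2 - (r - p)^2\<close> depend on how columns \<open>p\<close> are matched with rows
  \<open>r\<close>, so the rearrangement inequality makes one product strictly dominate each minor.
  But many monomials share a weight, so the top layer of a polynomial is treated as a whole: each
  monomial in it gets a fixed multiple of a minor, and any two candidates differ by multiples of
  minors of lower weight. All monomials of degree \<open>e + 1\<close> occur because subtracting
  \<open>k\<close> from the k-th of the increasing rows turns row sets into arbitrary multisets. In
  the dimension count, a form that vanishes on one member of a chain but not on the next gives an
  inequality of Hilbert functions shaped like Pascal's rule, and a binomial of degree above
  \<open>d + e\<close> outgrows the bound. A chain of full length consists of Taylor varieties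
  themselves, with \<open>d\<close> and \<open>e\<close> raised one unit at a time; a Toeplitz
  determinant separates neighbours.\<close>

lemma cpoly_eval_single_0 [simp]: "cpoly_eval c (Poly_Mapping.single 0 u) = u"
  by (simp add: cpoly_eval_single)

lemma cpoly_eval_one [simp]: "cpoly_eval c 1 = 1"
  using cpoly_eval_single_0[of c 1] by simp

lemma comm_ring_hom_cpoly_eval: "comm_ring_hom (cpoly_eval c)"
  by unfold_locales (auto simp: cpoly_eval_add cpoly_eval_mult)

lemma cpoly_eval_uminus: "cpoly_eval c (- f) = - cpoly_eval c f"
proof -
  interpret comm_ring_hom "cpoly_eval c" by (rule comm_ring_hom_cpoly_eval)
  show ?thesis by (rule hom_uminus)
qed

lemma cpoly_eval_diff: "cpoly_eval c (f - g) = cpoly_eval c f - cpoly_eval c g"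
  using cpoly_eval_add[of c f "- g"] by (simp add: cpoly_eval_uminus)

lemma cpoly_eval_sum: "cpoly_eval c (sum F A) = (\<Sum>i\<in>A. cpoly_eval c (F i))"
  by (induction A rule: infinite_finite_induct) (auto simp: cpoly_eval_add)

lemma cpoly_eval_prod: "cpoly_eval c (prod F A) = (\<Prod>i\<in>A. cpoly_eval c (F i))"
  by (induction A rule: infinite_finite_induct) (auto simp: cpoly_eval_mult)

lemma cpoly_eval_power: "cpoly_eval c (f ^ n) = cpoly_eval c f ^ n"
  by (induction n) (auto simp: cpoly_eval_mult)

lemma cpoly_eval_indet [simp]: "cpoly_eval c (indet i) = c i"
  by (simp add: indet_def cpoly_eval_single)

lemma cpoly_eval_det:
  "cpoly_eval c (det A) = det (map_mat (cpoly_eval c) A)"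
proof -
  interpret comm_ring_hom "cpoly_eval c" by (rule comm_ring_hom_cpoly_eval)
  show ?thesis by simp
qed

text \<open>Induction on the number of variables: for fixed values of the others, the sum is a
  univariate polynomial in the last variable that vanishes everywhere, so each of its coefficients
  does. The exponents form a family \<open>ex\<close> over \<open>A\<close> so that the induction
  can pass to the terms with a given last exponent.\<close>

lemma sum_monomials_eq_0D:
  fixes l :: "'b \<Rightarrow> complex" and ex :: "'b \<Rightarrow> nat \<Rightarrow> nat"
  assumes "finite A"
    and "\<And>a b. a \<in> A \<Longrightarrow> b \<in> A \<Longrightarrow> (\<And>i. i < n \<Longrightarrow> ex a i = ex b i) \<Longrightarrow> a = b"
    and "\<And>c. (\<Sum>a\<in>A. l a * (\<Prod>i<n. c i ^ ex a i)) = 0"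
  shows "\<forall>a\<in>A. l a = 0"
  using assms
proof (induction n arbitrary: A)
  case 0
  show ?case
  proof
    fix a assume a: "a \<in> A"
    hence "A = {a}" using 0(2) by blast
    thus "l a = 0" using 0(3)[of undefined] by simp
  qed
next
  case (Suc n)
  show ?case
  proof
    fix b assume b: "b \<in> A"
    define Ak where "Ak k = {a \<in> A. ex a n = k}" for k
    have "(\<Sum>a\<in>Ak (ex b n). l a * (\<Prod>i<n. c i ^ ex a i)) = 0" for c
    proof -
      define p where "p = (\<Sum>a\<in>A. Polynomial.monom (l a * (\<Prod>i<n. c i ^ ex a i)) (ex a n))"
      have "poly p x = 0" for x
      proof -
        have "poly p x = (\<Sum>a\<in>A. l a * (\<Prod>i<Suc n. (c(n := x)) i ^ ex a i))"
          unfolding p_def poly_sum by (intro sum.cong) (auto simp: poly_monom)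
        thus ?thesis using Suc.prems(3)[of "c(n := x)"] by simp
      qed
      hence "p = 0" using poly_all_0_iff_0 by blast
      hence "Polynomial.coeff p (ex b n) = 0" by simp
      also have "Polynomial.coeff p (ex b n) =
          (\<Sum>a\<in>A. if ex a n = ex b n then l a * (\<Prod>i<n. c i ^ ex a i) else 0)"
        unfolding p_def coeff_sum by (intro sum.cong) (auto simp: coeff_monom)
      also have "\<dots> = (\<Sum>a\<in>Ak (ex b n). l a * (\<Prod>i<n. c i ^ ex a i))"
        unfolding Ak_def using Suc.prems(1) by (simp add: sum.inter_filter)
      finally show ?thesis .
    qed
    moreover have "a = a'" if "a \<in> Ak (ex b n)" "a' \<in> Ak (ex b n)" "\<And>i. i < n \<Longrightarrow> ex a i = ex a' i" for a a'
      by (rule Suc.prems(2)) (use that in \<open>auto simp: Ak_def less_Suc_eq\<close>)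
    ultimately have "\<forall>a\<in>Ak (ex b n). l a = 0"
      using Suc.prems(1) by (intro Suc.IH) (auto simp: Ak_def)
    thus "l b = 0" using b by (auto simp: Ak_def)
  qed
qed

lemma cpoly_eqI_eval:
  assumes "\<And>c. cpoly_eval c f = 0"
  shows "f = 0"
proof -
  define K where "K = (\<Union>a\<in>Poly_Mapping.keys f. Poly_Mapping.keys a)"
  have "finite K" by (auto simp: K_def)
  then obtain n where n: "K \<subseteq> {..<n}"
    using finite_nat_set_iff_bounded by auto
  have "(\<Sum>a\<in>Poly_Mapping.keys f. Poly_Mapping.lookup f a *
     (\<Prod>i<n. c i ^ Poly_Mapping.lookup a i)) = 0" for c
  proof -
    have "(\<Sum>a\<in>Poly_Mapping.keys f. Poly_Mapping.lookup f a *
     (\<Prod>i<n. c i ^ Poly_Mapping.lookup a i)) = cpoly_eval c f"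
      unfolding cpoly_eval_def
    proof (intro sum.cong refl arg_cong[where f = "\<lambda>x. _ * x"] prod.mono_neutral_right)
      fix a assume "a \<in> Poly_Mapping.keys f"
      thus "Poly_Mapping.keys a \<subseteq> {..<n}" using n by (auto simp: K_def)
    qed (auto simp: in_keys_iff)
    thus ?thesis using assms by simp
  qed
  hence "\<forall>a\<in>Poly_Mapping.keys f. Poly_Mapping.lookup f a = 0"
  proof (intro sum_monomials_eq_0D[where n = n and ex = Poly_Mapping.lookup])
    fix a b assume ab: "a \<in> Poly_Mapping.keys f" "b \<in> Poly_Mapping.keys f"
      "\<And>i. i < n \<Longrightarrow> Poly_Mapping.lookup a i = Poly_Mapping.lookup b i"
    show "a = b"
    proof (rule poly_mapping_eqI)
      fix i
      show "Poly_Mapping.lookup a i = Poly_Mapping.lookup b i"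
      proof (cases "i < n")
        case False
        hence "i \<notin> Poly_Mapping.keys a" "i \<notin> Poly_Mapping.keys b"
          using ab n by (auto simp: K_def)
        thus ?thesis by (simp add: in_keys_iff)
      qed (use ab in auto)
    qed
  qed auto
  thus ?thesis by (intro poly_mapping_eqI) (auto simp: in_keys_iff)
qed

lemma cpoly_eval_cong:
  assumes "f \<in> carrier (cpoly_ring m)" "\<And>i. i \<le> m \<Longrightarrow> c i = c' i"
  shows "cpoly_eval c f = cpoly_eval c' f"
  unfolding cpoly_eval_def
proof (intro sum.cong refl arg_cong[where f = "\<lambda>x. _ * x"] prod.cong)
  fix a i assume "a \<in> Poly_Mapping.keys f" "i \<in> Poly_Mapping.keys a"
  hence "i \<le> m" using assms(1) by (auto simp: carrier_cpoly_ring)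
  thus "c i ^ Poly_Mapping.lookup a i = c' i ^ Poly_Mapping.lookup a i" using assms(2) by simp
qed

lemma carrier_zero [simp]: "0 \<in> carrier (cpoly_ring m)"
  and carrier_one [simp]: "1 \<in> carrier (cpoly_ring m)"
  by (auto simp: carrier_cpoly_ring)

lemma carrier_single: "Poly_Mapping.keys a \<subseteq> {..m} \<Longrightarrow> Poly_Mapping.single a u \<in> carrier (cpoly_ring m)"
  by (auto simp: carrier_cpoly_ring)

lemma carrier_indet [simp]: "i \<le> m \<Longrightarrow> indet i \<in> carrier (cpoly_ring m)"
  by (auto simp: indet_def intro!: carrier_single)

lemma carrier_add:
  "f \<in> carrier (cpoly_ring m) \<Longrightarrow> g \<in> carrier (cpoly_ring m) \<Longrightarrow> f + g \<in> carrier (cpoly_ring m)"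
  using keys_add[of f g] by (auto simp: carrier_cpoly_ring)

lemma carrier_uminus: "f \<in> carrier (cpoly_ring m) \<Longrightarrow> - f \<in> carrier (cpoly_ring m)"
  by (auto simp: carrier_cpoly_ring in_keys_iff)

lemma carrier_sum: "(\<And>i. i \<in> A \<Longrightarrow> F i \<in> carrier (cpoly_ring m)) \<Longrightarrow> sum F A \<in> carrier (cpoly_ring m)"
  by (induction A rule: infinite_finite_induct) (auto intro: carrier_add)

lemma carrier_prod: "(\<And>i. i \<in> A \<Longrightarrow> F i \<in> carrier (cpoly_ring m)) \<Longrightarrow> prod F A \<in> carrier (cpoly_ring m)"
  by (induction A rule: infinite_finite_induct) (auto intro: carrier_mult)

lemma carrier_power: "f \<in> carrier (cpoly_ring m) \<Longrightarrow> f ^ n \<in> carrier (cpoly_ring m)"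
  by (induction n) (auto intro: carrier_mult)

lemma carrier_mono: "m \<le> m' \<Longrightarrow> carrier (cpoly_ring m) \<subseteq> carrier (cpoly_ring m')"
  by (fastforce simp: carrier_cpoly_ring)

lemma signof_cases: "signof p = (1 :: 'a :: comm_ring_1) \<or> signof p = (-1 :: 'a)"
  by (simp add: sign_def)

lemma carrier_det:
  assumes "A \<in> carrier_mat n n"
    and "\<And>i j. i < n \<Longrightarrow> j < n \<Longrightarrow> A $$ (i, j) \<in> carrier (cpoly_ring m)"
  shows "det A \<in> carrier (cpoly_ring m)"
  unfolding det_def'[OF assms(1)]
proof (intro carrier_sum carrier_mult carrier_prod)
  fix p :: "nat \<Rightarrow> nat"
  show "(signof p :: cpoly) \<in> carrier (cpoly_ring m)"
    using signof_cases[of p, where 'a = cpoly] by (elim disjE ssubst) (simp_all add: carrier_uminus)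
qed (use assms permutes_in_image[of _ "{0..<n}"] in auto)

text \<open>Keeps the degree explicit, which \<open>homogeneous_polys\<close> hides behind a
  quantifier: adding forms and counting them need a common degree.\<close>

definition homog :: "nat \<Rightarrow> nat \<Rightarrow> cpoly \<Rightarrow> bool" where
  "homog m k f \<longleftrightarrow> f \<in> carrier (cpoly_ring m) \<and> (\<forall>a\<in>Poly_Mapping.keys f. total_degree a = k)"

lemma homogeneous_polys_iff: "f \<in> homogeneous_polys m \<longleftrightarrow> (\<exists>k. homog m k f)"
  by (auto simp: homogeneous_polys_def homog_def)

lemma homog_carrier: "homog m k f \<Longrightarrow> f \<in> carrier (cpoly_ring m)"
  by (simp add: homog_def)

lemma homog_zero [simp]: "homog m k 0"
  by (simp add: homog_def)

lemma homog_one [simp]: "homog m 0 1"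
  by (simp add: homog_def total_degree_def)

lemma homog_add: "homog m k f \<Longrightarrow> homog m k g \<Longrightarrow> homog m k (f + g)"
  using keys_add[of f g] by (auto simp: homog_def intro: carrier_add)

lemma homog_uminus: "homog m k f \<Longrightarrow> homog m k (- f)"
  by (auto simp: homog_def carrier_uminus in_keys_iff)

lemma homog_mult: "homog m k f \<Longrightarrow> homog m l g \<Longrightarrow> homog m (k + l) (f * g)"
  using keys_mult[of f g] by (fastforce simp: homog_def carrier_mult total_degree_add)

lemma homog_sum: "(\<And>i. i \<in> A \<Longrightarrow> homog m k (F i)) \<Longrightarrow> homog m k (sum F A)"
  by (induction A rule: infinite_finite_induct) (auto intro: homog_add)

lemma homog_prod: "finite A \<Longrightarrow> (\<And>i. i \<in> A \<Longrightarrow> homog m (k i) (F i)) \<Longrightarrow> homog m (sum k A) (prod F A)"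
  by (induction A rule: finite_induct) (auto intro: homog_mult)

lemma homog_power: "homog m k f \<Longrightarrow> homog m (n * k) (f ^ n)"
  by (induction n) (auto intro: homog_mult)

lemma homog_const: "homog m 0 (Poly_Mapping.single 0 u)"
  by (auto simp: homog_def total_degree_def intro!: carrier_single)

lemma homog_indet: "i \<le> m \<Longrightarrow> homog m 1 (indet i)"
  by (auto simp: homog_def indet_def total_degree_def intro!: carrier_single)

lemma homog_det:
  assumes "A \<in> carrier_mat n n"
    and "\<And>i j. i < n \<Longrightarrow> j < n \<Longrightarrow> homog m 1 (A $$ (i, j))"
  shows "homog m n (det A)"
  unfolding det_def'[OF assms(1)]
proof (intro homog_sum)
  fix p :: "nat \<Rightarrow> nat" assume p: "p \<in> {p. p permutes {0..<n}}"
  have "homog m (\<Sum>i = 0..<n. 1) (\<Prod>i = 0..<n. A $$ (i, p i))"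
    by (intro homog_prod) (use p assms permutes_in_image[of _ "{0..<n}"] in auto)
  moreover have "homog m 0 (signof p :: cpoly)"
    using signof_cases[of p, where 'a = cpoly] by (elim disjE ssubst) (simp_all add: homog_uminus)
  ultimately show "homog m n (signof p * (\<Prod>i = 0..<n. A $$ (i, p i)))"
    using homog_mult by fastforce
qed

lemma homog_scale_eval:
  assumes "homog m k f"
  shows "cpoly_eval (\<lambda>i. u * c i) f = u ^ k * cpoly_eval c f"
  unfolding cpoly_eval_def sum_distrib_left using assms
  by (intro sum.cong)
     (auto simp: homog_def power_mult_distrib prod.distrib total_degree_def power_sum[symmetric])


section \<open>Leading monomials of Hankel minors\<close>

text \<open>The strict rearrangement inequality. If \<open>p\<close> moves the last index, swapping
  it into place gains \<open>(r N - r j) * (N - p N)\<close>, which is positive; induction treats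
  the rest.\<close>

lemma sum_permuted_less:
  fixes r :: "nat \<Rightarrow> int"
  assumes "p permutes {..<N}" "\<And>i j. i < j \<Longrightarrow> j < N \<Longrightarrow> r i < r j"
  shows "(\<Sum>k<N. r k * int (p k)) \<le> (\<Sum>k<N. r k * int k) \<and>
    (p \<noteq> id \<longrightarrow> (\<Sum>k<N. r k * int (p k)) < (\<Sum>k<N. r k * int k))"
  using assms
proof (induction N arbitrary: p)
  case 0
  thus ?case by simp
next
  case (Suc N)
  have fixN: "q permutes {..<N}" if "q permutes {..<Suc N}" "q N = N" for q
    by (rule permutes_superset[OF that(1)]) (use that in \<open>auto simp: less_Suc_eq\<close>)
  show ?case
  proof (cases "p N = N")
    case True
    show ?thesis using Suc.IH[OF fixN[OF Suc.prems(1) True]] Suc.prems(2) True by auto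
  next
    case False
    obtain j where j: "j \<in> {..<Suc N}" "p j = N"
      using permutes_image[OF Suc.prems(1)] by (metis imageE lessI lessThan_iff)
    have jN: "j < N" using j False by (cases "j = N") auto
    have pN: "p N < N"
      using permutes_in_image[OF Suc.prems(1), of N] False by auto
    define q where "q = p \<circ> Transposition.transpose j N"
    have q: "q permutes {..<Suc N}"
      unfolding q_def by (rule permutes_compose[OF permutes_swap_id Suc.prems(1)]) (use jN in auto)
    have qN: "q N = N" using j by (simp add: q_def)
    have qj: "q j = p N" by (simp add: q_def)
    have qo: "q k = p k" if "k \<noteq> j" "k \<noteq> N" for k using that by (simp add: q_def Transposition.transpose_def)
    have "(\<Sum>k<N. r k * int (q k)) = r j * int (p N) + (\<Sum>k\<in>{..<N} - {j}. r k * int (p k))"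
      by (subst sum.remove[of _ j]) (use jN in \<open>auto simp: qj intro!: sum.cong simp: qo\<close>)
    moreover have "(\<Sum>k<N. r k * int (p k)) = r j * int N + (\<Sum>k\<in>{..<N} - {j}. r k * int (p k))"
      by (subst sum.remove[of _ j]) (use jN j in auto)
    moreover have "(\<Sum>k<N. r k * int (q k)) \<le> (\<Sum>k<N. r k * int k)"
      using Suc.IH[OF fixN[OF q qN]] Suc.prems(2) by auto
    moreover have "(r N - r j) * (int N - int (p N)) > 0"
      using Suc.prems(2)[OF jN] pN by (intro mult_pos_pos) auto
    ultimately have "(\<Sum>k<Suc N. r k * int (p k)) < (\<Sum>k<Suc N. r k * int k)"
      by (simp add: algebra_simps)
    thus ?thesis by auto
  qed
qed

text \<open>The increasing enumeration of all naturals except \<open>k\<close>; composing a row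
  choice with it deletes row \<open>k\<close>.\<close>

definition skip :: "nat \<Rightarrow> nat \<Rightarrow> nat" where
  "skip k i = (if i < k then i else Suc i)"

lemma skip_image: "k \<le> N \<Longrightarrow> skip k ` {..<N} = {..N} - {k}"
proof (intro equalityI subsetI)
  fix x assume "k \<le> N" "x \<in> {..N} - {k}"
  thus "x \<in> skip k ` {..<N}"
    by (intro image_eqI[of _ _ "if x < k then x else x - 1"]) (auto simp: skip_def)
qed (auto simp: skip_def)

lemma inj_skip: "inj_on (skip k) A"
  by (auto simp: inj_on_def skip_def split: if_splits)

lemma sum_skip:
  fixes f :: "nat \<Rightarrow> 'a :: comm_monoid_add"
  assumes "k \<le> N"
  shows "(\<Sum>i\<le>N. f i) = f k + (\<Sum>i<N. f (skip k i))"
proof -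
  have "(\<Sum>i\<le>N. f i) = f k + sum f ({..N} - {k})"
    using assms by (intro sum.remove) auto
  also have "sum f ({..N} - {k}) = (\<Sum>i<N. f (skip k i))"
    unfolding skip_image[OF assms, symmetric] by (simp add: sum.reindex[OF inj_skip])
  finally show ?thesis .
qed

text \<open>The columns are in reverse order compared with \<^const>\<open>hankel_mat\<close>, which puts the leading monomial on the
  diagonal.\<close>

definition hdet :: "(nat \<Rightarrow> 'a) \<Rightarrow> nat \<Rightarrow> (nat \<Rightarrow> nat) \<Rightarrow> 'a :: comm_ring_1" where
  "hdet h N r = det (mat N N (\<lambda>(k, j). h (r k - j)))"

lemma hdet_cong: "(\<And>k. k < N \<Longrightarrow> r k = r' k) \<Longrightarrow> hdet h N r = hdet h N r'"
  unfolding hdet_def by (intro arg_cong[where f = det] eq_matI) auto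

text \<open>A Pluecker relation: put a copy of column \<open>p\<close> in front of the
  \<open>N\<close> columns and expand the vanishing determinant along this copy. \<open>R\<close>
  lists \<open>N + 1\<close> rows, and each term omits one of them.\<close>

lemma hdet_plucker:
  assumes "p < N"
  shows "(\<Sum>k\<le>N. (-1) ^ k * h (R k - p) * hdet h N (\<lambda>i. R (skip k i))) = 0"
proof -
  define A where "A = mat (Suc N) (Suc N) (\<lambda>(i, j). h (R i - (case j of 0 \<Rightarrow> p | Suc j' \<Rightarrow> j')))"
  have A: "A \<in> carrier_mat (Suc N) (Suc N)" by (simp add: A_def)
  have "det A = 0"
    by (rule det_identical_columns[OF A, of 0 "Suc p"]) (use assms in \<open>auto simp: A_def\<close>)
  moreover have "det A = (\<Sum>i<Suc N. A $$ (i, 0) * cofactor A i 0)"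
    by (rule laplace_expansion_column[OF A]) simp
  moreover have "A $$ (i, 0) * cofactor A i 0 = (-1) ^ i * h (R i - p) * hdet h N (\<lambda>k. R (skip i k))"
    if "i < Suc N" for i
  proof -
    have "mat_delete A i 0 = mat N N (\<lambda>(k, j). h (R (skip i k) - j))"
      unfolding mat_delete_def by (rule eq_matI) (use that in \<open>auto simp: A_def skip_def\<close>)
    thus ?thesis using that by (simp add: cofactor_def hdet_def A_def)
  qed
  ultimately show ?thesis by (simp add: lessThan_Suc_atMost)
qed

lemma keys_signof_mult: "Poly_Mapping.keys (signof p * f :: cpoly) = Poly_Mapping.keys f"
  using signof_cases[of p, where 'a = cpoly] by (elim disjE ssubst) (simp_all)

lemma lookup_single_mult:
  fixes f :: cpoly
  shows "Poly_Mapping.lookup (Poly_Mapping.single s 1 * f) (s + a) = Poly_Mapping.lookup f a"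
proof (induction f rule: update_induct)
  case (update f b v)
  thus ?case
    by (simp add: cpoly_update distrib_left lookup_add mult_single lookup_single when_def)
qed simp

lemma cpoly_eq_sum_singles:
  fixes f :: cpoly
  shows "f = (\<Sum>a\<in>Poly_Mapping.keys f. Poly_Mapping.single a (Poly_Mapping.lookup f a))"
  by (rule poly_mapping_eqI) (auto simp: lookup_sum lookup_single when_def in_keys_iff sum.If_cases)

locale hankel =
  fixes d e m :: nat
  assumes dem: "d + e < m"
begin

definition nrows :: nat where "nrows = m - d"

text \<open>Indices count down from c_m, so the entry in row \<open>i\<close> and column
  \<open>j\<close> of the Hankel matrix is \<open>hvar (i + j)\<close>; the value 0 stands for the
  c_k with negative index.\<close>

definition hvar :: "nat \<Rightarrow> cpoly" where
  "hvar i = (if i \<le> m then indet (m - i) else 0)"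

text \<open>For an index \<open>c = m - i\<close> the factor \<open>c * (2 * m - c)\<close> equals
  \<open>m^2 - i^2\<close>.\<close>

definition wt :: "(nat \<Rightarrow>\<^sub>0 nat) \<Rightarrow> nat" where
  "wt a = (\<Sum>c\<in>Poly_Mapping.keys a. Poly_Mapping.lookup a c * (c * (2 * m - c)))"

lemma wt_add: "wt (a + b) = wt a + wt b"
  unfolding wt_def by (rule setsum_keys_plus_distrib) (auto simp: add_mult_distrib)

lemma wt_zero [simp]: "wt 0 = 0"
  by (simp add: wt_def)

lemma wt_sum: "wt (sum f A) = (\<Sum>i\<in>A. wt (f i))"
  by (induction A rule: infinite_finite_induct) (auto simp: wt_add)

lemma wt_single_hvar: "i \<le> m \<Longrightarrow> int (wt (Poly_Mapping.single (m - i) 1)) = int m ^ 2 - int i ^ 2"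
  by (auto simp: wt_def algebra_simps power2_eq_square dest!: le_Suc_ex)

definition wt_less :: "nat \<Rightarrow> cpoly \<Rightarrow> bool" where
  "wt_less w f \<longleftrightarrow> (\<forall>a\<in>Poly_Mapping.keys f. wt a < w)"

lemma wt_less_zero [simp]: "wt_less w 0"
  by (simp add: wt_less_def)

lemma wt_less_add: "wt_less w f \<Longrightarrow> wt_less w g \<Longrightarrow> wt_less w (f + g)"
  using keys_add[of f g] by (auto simp: wt_less_def)

lemma wt_less_uminus: "wt_less w (- f) \<longleftrightarrow> wt_less w f"
  by (auto simp: wt_less_def)

lemma wt_less_diff: "wt_less w f \<Longrightarrow> wt_less w g \<Longrightarrow> wt_less w (f - g)"
  using wt_less_add[of w f "- g"] by (simp add: wt_less_uminus)

lemma wt_less_sum: "(\<And>i. i \<in> A \<Longrightarrow> wt_less w (F i)) \<Longrightarrow> wt_less w (sum F A)"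
  by (induction A rule: infinite_finite_induct) (auto intro: wt_less_add)

lemma wt_less_mult: "wt_less w f \<Longrightarrow> wt_less (Suc v) g \<Longrightarrow> wt_less (w + v) (f * g)"
  using keys_mult[of f g] by (fastforce simp: wt_less_def wt_add)

lemma wt_less_mono: "wt_less w f \<Longrightarrow> w \<le> v \<Longrightarrow> wt_less v f"
  by (fastforce simp: wt_less_def)

lemma prod_hvar:
  assumes "finite A" "\<And>k. k \<in> A \<Longrightarrow> f k \<le> m"
  shows "(\<Prod>k\<in>A. hvar (f k)) = Poly_Mapping.single (\<Sum>k\<in>A. Poly_Mapping.single (m - f k) 1) 1"
  using assms by (induction A rule: finite_induct) (auto simp: hvar_def indet_def mult_single)

lemma wt_sum_hvar:
  assumes "\<And>k. k \<in> A \<Longrightarrow> f k \<le> m"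
  shows "int (wt (\<Sum>k\<in>A. Poly_Mapping.single (m - f k) 1)) = (\<Sum>k\<in>A. int m ^ 2 - int (f k) ^ 2)"
  unfolding wt_sum of_nat_sum using assms by (intro sum.cong refl wt_single_hvar) auto

text \<open>In the Leibniz formula the weight of the term of \<open>p\<close> is constant up to
  twice the sum of the \<open>r k * p k\<close>, since \<open>p\<close> only permutes the squares of
  the column indices; the rearrangement inequality makes the identity the strict maximum.
  \<open>large\<close> prevents truncated subtraction, \<open>small\<close> keeps the diagonal
  product nonzero, while any other product may vanish.\<close>

lemma hdet_lead:
  assumes incr: "\<And>i j. i < j \<Longrightarrow> j < N \<Longrightarrow> r i < r j"
    and large: "\<And>k. k < N \<Longrightarrow> N \<le> Suc (r k)" and small: "\<And>k. k < N \<Longrightarrow> r k - k \<le> m"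
  defines "l \<equiv> (\<Sum>k<N. Poly_Mapping.single (m - (r k - k)) 1)"
  shows "wt_less (wt l) (hdet hvar N r - Poly_Mapping.single l 1)"
proof -
  let ?P = "{p. p permutes {0..<N}}"
  have "hdet hvar N r = (\<Sum>p\<in>?P. signof p * (\<Prod>i=0..<N. hvar (r i - p i)))"
    unfolding hdet_def det_def'[OF mat_carrier]
    by (intro sum.cong refl arg_cong2[where f = "(*)"] prod.cong)
       (auto simp: permutes_in_image[of _ "{0..<N}"])
  also have "\<dots> = (\<Prod>i=0..<N. hvar (r i - i)) +
     (\<Sum>p\<in>?P - {id}. signof p * (\<Prod>i=0..<N. hvar (r i - p i)))"
    by (subst sum.remove[of _ id]) (auto simp: finite_permutations permutes_id)
  also have "(\<Prod>i=0..<N. hvar (r i - i)) = Poly_Mapping.single l 1"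
    unfolding l_def atLeast0LessThan by (rule prod_hvar) (use small in auto)
  finally have "hdet hvar N r - Poly_Mapping.single l 1 =
     (\<Sum>p\<in>?P - {id}. signof p * (\<Prod>i=0..<N. hvar (r i - p i)))" by (simp add: id_def)
  moreover have "wt_less (wt l) (signof p * (\<Prod>i=0..<N. hvar (r i - p i)))" if p: "p \<in> ?P - {id}" for p
  proof (cases "\<forall>i<N. r i - p i \<le> m")
    case True
    have pN: "p permutes {..<N}" using p by (simp add: atLeast0LessThan)
    have pl: "p i \<le> r i" if "i < N" for i
      using permutes_in_image[OF pN, of i] that large[of i] by auto
    have il: "i \<le> r i" if "i < N" for i
      using that large[of i] by auto
    let ?l = "\<Sum>i=0..<N. Poly_Mapping.single (m - (r i - p i)) (1::nat)"
    have "int (wt ?l) = (\<Sum>k=0..<N. int m ^ 2 - int (r k - p k) ^ 2)"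
      by (rule wt_sum_hvar) (use True in auto)
    also have "\<dots> = (\<Sum>k<N. int m ^ 2 - int (r k) ^ 2) - (\<Sum>k<N. int (p k) ^ 2) + 2 * (\<Sum>k<N. int (r k) * int (p k))"
      unfolding atLeast0LessThan sum_subtractf[symmetric] sum_distrib_left sum.distrib[symmetric]
      by (intro sum.cong) (auto simp: of_nat_diff pl power2_eq_square algebra_simps)
    also have "(\<Sum>k<N. int (p k) ^ 2) = (\<Sum>k<N. int k ^ 2)"
      using sum.permute[OF pN, of "\<lambda>k. int k ^ 2"] by (simp add: comp_def)
    also have "(\<Sum>k<N. int (r k) * int (p k)) < (\<Sum>k<N. int (r k) * int k)"
      using sum_permuted_less[OF pN, of "\<lambda>k. int (r k)"] incr p by auto
    also have "(\<Sum>k<N. int m ^ 2 - int (r k) ^ 2) - (\<Sum>k<N. int k ^ 2) + 2 * (\<Sum>k<N. int (r k) * int k)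
       = (\<Sum>k<N. int m ^ 2 - int (r k - k) ^ 2)"
      unfolding sum_subtractf[symmetric] sum_distrib_left sum.distrib[symmetric]
      by (intro sum.cong) (auto simp: of_nat_diff il power2_eq_square algebra_simps)
    also have "\<dots> = int (wt l)"
      unfolding l_def by (rule wt_sum_hvar[symmetric]) (use small in auto)
    finally have "wt ?l < wt l" by simp
    moreover have "(\<Prod>i=0..<N. hvar (r i - p i)) = Poly_Mapping.single ?l 1"
      by (rule prod_hvar) (use True in auto)
    ultimately show ?thesis by (simp only: wt_less_def keys_signof_mult) simp
  next
    case False
    then obtain i where "i < N" "\<not> r i - p i \<le> m" by auto
    hence "(\<Prod>i=0..<N. hvar (r i - p i)) = 0"
      by (intro prod_zero) (auto intro!: bexI[of _ i] simp: hvar_def)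
    thus ?thesis by (simp only: mult_zero_right wt_less_zero)
  qed
  ultimately show ?thesis by (auto intro: wt_less_sum)
qed

end


section \<open>Straightening\<close>

text \<open>Deleting row \<open>k\<close> from the rows \<open>R\<close> and multiplying by the entry of row \<open>k\<close> in the doubled
  column \<open>p\<close> has leading weight \<open>\<Sum>\<^sub>i (m\<^sup>2 - (R i - col i)\<^sup>2)\<close>; it is largest for \<open>k = p\<close> and \<open>k = p + 1\<close>.\<close>

lemma sum_doubled_column:
  fixes R :: "nat \<Rightarrow> int"
  assumes "\<And>i. i < N \<Longrightarrow> R i < R (Suc i)" "p < N" "k \<le> N"
  defines "Q \<equiv> \<lambda>k. R k * int p + (\<Sum>i<N. R (skip k i) * int i)"
  shows "Q (Suc p) = Q p" "k \<noteq> p \<Longrightarrow> k \<noteq> Suc p \<Longrightarrow> Q k < Q p"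
proof -
  \<comment> \<open>The factor \<open>p - k\<close> decides the sign: \<open>Q\<close> rises up to
    \<open>p\<close>, is level from \<open>p\<close> to \<open>p + 1\<close>, and falls
    afterwards.\<close>
  have st: "Q (Suc k) - Q k = (int p - int k) * (R (Suc k) - R k)" if "k < N" for k
  proof -
    have "(\<Sum>i<N. R (skip (Suc k) i) * int i) = R k * int k + (\<Sum>i\<in>{..<N} - {k}. R (skip k i) * int i)"
    proof -
      have "skip (Suc k) i = skip k i" if "i \<noteq> k" for i
        using that by (auto simp: skip_def)
      thus ?thesis
        by (subst sum.remove[of _ k]) (use \<open>k < N\<close> in \<open>auto simp: skip_def[of _ k]\<close>)
    qed
    moreover have "(\<Sum>i<N. R (skip k i) * int i) = R (Suc k) * int k + (\<Sum>i\<in>{..<N} - {k}. R (skip k i) * int i)"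
      by (subst sum.remove[of _ k]) (use that in \<open>auto simp: skip_def\<close>)
    ultimately show ?thesis by (simp add: Q_def algebra_simps)
  qed
  show eq: "Q (Suc p) = Q p" using st[OF assms(2)] by simp
  have inc: "Q (p - j) \<le> Q p - int j" if "j \<le> p" for j
    using that
  proof (induction j)
    case (Suc j)
    have "(int p - int (p - Suc j)) * (R (Suc (p - Suc j)) - R (p - Suc j)) \<ge> 1 * 1"
    proof (rule mult_mono)
      have "p - Suc j < N" using assms(2) by simp
      from assms(1)[OF this] show "1 \<le> R (Suc (p - Suc j)) - R (p - Suc j)" by simp
    qed (use Suc.prems in auto)
    hence "Q (Suc (p - Suc j)) - Q (p - Suc j) \<ge> 1"
      using st[of "p - Suc j"] assms(2) by simp
    moreover have "Suc (p - Suc j) = p - j" using Suc.prems by simp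
    ultimately show ?case using Suc by simp
  qed simp
  have dec: "Q (Suc p + j) \<le> Q p - int j" if "Suc p + j \<le> N" for j
    using that
  proof (induction j)
    case (Suc j)
    have "(int (Suc p + j) - int p) * (R (Suc (Suc p + j)) - R (Suc p + j)) \<ge> 1 * 1"
      using Suc.prems assms(1)[of "Suc p + j"] by (intro mult_mono) auto
    hence "(int p - int (Suc p + j)) * (R (Suc (Suc p + j)) - R (Suc p + j)) \<le> -1"
      by (simp add: algebra_simps)
    hence "Q (Suc (Suc p + j)) - Q (Suc p + j) \<le> -1"
      using st[of "Suc p + j"] Suc.prems by simp
    thus ?case using Suc by simp
  qed (use eq in simp)
  show "Q k < Q p" if "k \<noteq> p" "k \<noteq> Suc p"
  proof (cases "k < p")
    case True
    thus ?thesis using inc[of "p - k"] by simp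
  next
    case False
    thus ?thesis using dec[of "k - Suc p"] that assms(3) by simp
  qed
qed


lemma image_mset_skip:
  assumes "k \<le> N"
  shows "image_mset f (mset_set {..N}) = add_mset (f k) (image_mset (\<lambda>i. f (skip k i)) (mset_set {..<N}))"
proof -
  have "{..N} = insert k (skip k ` {..<N})"
    using assms by (auto simp: skip_image)
  moreover have "k \<notin> skip k ` {..<N}"
    using assms by (auto simp: skip_image)
  ultimately have "mset_set {..N} = add_mset k (mset_set (skip k ` {..<N}))"
    by (simp add: mset_set.insert)
  also have "mset_set (skip k ` {..<N}) = image_mset (skip k) (mset_set {..<N})"
    by (rule image_mset_mset_set[symmetric]) (rule inj_skip)
  finally show ?thesis by (simp add: image_mset.compositionality comp_def)
qed


lemma single_split:
  assumes "0 < Poly_Mapping.lookup (u :: nat \<Rightarrow>\<^sub>0 nat) i"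
  obtains u' where "u = u' + Poly_Mapping.single i 1"
    "Poly_Mapping.keys u' \<subseteq> Poly_Mapping.keys u"
proof
  show "u = (u - Poly_Mapping.single i 1) + Poly_Mapping.single i 1"
    using assms by (intro poly_mapping_eqI) (auto simp: lookup_add lookup_minus lookup_single when_def)
  show "Poly_Mapping.keys (u - Poly_Mapping.single i 1) \<subseteq> Poly_Mapping.keys u"
    by (auto simp: in_keys_iff lookup_minus)
qed


context hankel begin

definition expo :: "nat multiset \<Rightarrow> (nat \<Rightarrow>\<^sub>0 nat)" where
  "expo \<alpha> = (\<Sum>i\<in>#\<alpha>. Poly_Mapping.single (m - i) 1)"

lemma expo_add [simp]: "expo (\<alpha> + \<beta>) = expo \<alpha> + expo \<beta>"
  by (simp add: expo_def)

lemma expo_add_mset [simp]: "expo (add_mset i \<alpha>) = Poly_Mapping.single (m - i) 1 + expo \<alpha>"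
  by (simp add: expo_def)

lemma expo_empty [simp]: "expo {#} = 0"
  by (simp add: expo_def)

text \<open>The index range \<open>{e..<nrows}\<close> is that of the variables c_(d+1), ...,
  c_(m-e), since \<open>m - nrows = d\<close>.\<close>

definition admissible :: "nat \<Rightarrow> nat multiset \<Rightarrow> bool" where
  "admissible n \<alpha> \<longleftrightarrow> size \<alpha> = n \<and> set_mset \<alpha> \<subseteq> {e..<nrows}"

lemma nrows_le: "nrows \<le> m" and e_less_nrows: "e < nrows"
  using dem by (auto simp: nrows_def)

lemma lookup_expo: "set_mset \<alpha> \<subseteq> {..m} \<Longrightarrow> i \<le> m \<Longrightarrow> Poly_Mapping.lookup (expo \<alpha>) (m - i) = count \<alpha> i"
  by (induction \<alpha>) (auto simp: lookup_add lookup_single when_def)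

text \<open>The minor whose leading monomial is the product of the \<open>hvar i\<close> over \<open>i \<in># \<alpha>\<close>.\<close>

definition hminor :: "nat multiset \<Rightarrow> cpoly" where
  "hminor \<alpha> = hdet hvar (size \<alpha>) (\<lambda>k. sorted_list_of_multiset \<alpha> ! k + k)"

text \<open>Strictly increasing rows \<open>r\<close> correspond to the weakly increasing sequence
  \<open>r k - k\<close> of diagonal indices, and sorting the multiset recovers this
  sequence.\<close>

lemma hminor_mset:
  assumes "\<And>i j. i < j \<Longrightarrow> j < N \<Longrightarrow> r i < r j" "\<And>k. k < N \<Longrightarrow> k \<le> r k"
  shows "hminor (image_mset (\<lambda>k. r k - k) (mset_set {..<N})) = hdet hvar N r"
proof -
  have "sorted (map (\<lambda>k. r k - k) [0..<N])"
    unfolding sorted_iff_nth_mono_less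
  proof safe
    fix i j assume ij: "i < j" "j < length (map (\<lambda>k. r k - k) [0..<N])"
    hence j: "j < N" by simp
    have "k < N \<Longrightarrow> i \<le> k \<Longrightarrow> r i + (k - i) \<le> r k" for k
    proof (induction k)
      case (Suc k)
      thus ?case using assms(1)[of k "Suc k"] by (cases "i = Suc k") auto
    qed auto
    from this[of j] show "map (\<lambda>k. r k - k) [0..<N] ! i \<le> map (\<lambda>k. r k - k) [0..<N] ! j"
      using ij j by simp
  qed
  moreover have "mset (map (\<lambda>k. r k - k) [0..<N]) = image_mset (\<lambda>k. r k - k) (mset_set {..<N})"
    by (simp add: atLeast0LessThan)
  ultimately have "sorted_list_of_multiset (image_mset (\<lambda>k. r k - k) (mset_set {..<N})) =
      map (\<lambda>k. r k - k) [0..<N]"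
    by (metis mset_sorted_list_of_multiset properties_for_sort sorted_list_of_multiset_mset)
  thus ?thesis
    unfolding hminor_def using assms(2) by (auto intro!: hdet_cong)
qed

lemma expo_image_mset: "expo (image_mset f (mset_set A)) = (\<Sum>k\<in>A. Poly_Mapping.single (m - f k) 1)"
  by (simp add: expo_def sum_unfold_sum_mset image_mset.compositionality comp_def)

lemma hminor_lead:
  assumes "set_mset \<alpha> \<subseteq> {..m}" "\<And>i. i \<in># \<alpha> \<Longrightarrow> size \<alpha> \<le> Suc i"
  shows "wt_less (wt (expo \<alpha>)) (hminor \<alpha> - Poly_Mapping.single (expo \<alpha>) 1)"
proof -
  define L where "L = sorted_list_of_multiset \<alpha>"
  have L: "mset L = \<alpha>" "sorted L" by (auto simp: L_def)
  have len: "length L = size \<alpha>" using L by (metis size_mset)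
  have Lk: "L ! k \<in># \<alpha>" if "k < size \<alpha>" for k
    using that L(1) len by (metis nth_mem set_mset_mset)
  have "expo \<alpha> = (\<Sum>k<size \<alpha>. Poly_Mapping.single (m - L ! k) 1)"
  proof -
    have "\<alpha> = image_mset ((!) L) (mset_set {..<size \<alpha>})"
      using L(1) len by (metis map_nth mset_map mset_upt atLeast0LessThan)
    thus ?thesis by (metis expo_image_mset)
  qed
  moreover have "wt_less (wt (\<Sum>k<size \<alpha>. Poly_Mapping.single (m - (L ! k + k - k)) 1))
     (hdet hvar (size \<alpha>) (\<lambda>k. L ! k + k) -
      Poly_Mapping.single (\<Sum>k<size \<alpha>. Poly_Mapping.single (m - (L ! k + k - k)) 1) 1)"
  proof (rule hdet_lead)
    fix i j assume "i < j" "j < size \<alpha>"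
    thus "L ! i + i < L ! j + j" using L(2) len sorted_nth_mono[of L i j] by auto
  next
    fix k assume "k < size \<alpha>"
    thus "size \<alpha> \<le> Suc (L ! k + k)" "L ! k + k - k \<le> m"
      using assms Lk[of k] by fastforce+
  qed
  ultimately show ?thesis by (simp add: hminor_def L_def)
qed

lemma admissible_D:
  assumes "admissible n \<alpha>"
  shows "size \<alpha> = n" "set_mset \<alpha> \<subseteq> {..m}" "n \<le> Suc e \<Longrightarrow> i \<in># \<alpha> \<Longrightarrow> size \<alpha> \<le> Suc i"
  using assms nrows_le by (auto simp: admissible_def subset_iff)

text \<open>The ideal of minors filtered by weight: the bound \<open>w\<close> applies to the
  leading monomial of every summand and not just to the sum, so no leading terms cancel at weight
  \<open>w\<close> or above. That a sum of small weight can be rewritten with small summands is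
  \<open>straight_descend\<close>.\<close>

inductive_set straight :: "nat \<Rightarrow> cpoly set" for w where
  zero: "0 \<in> straight w"
| step: "F \<in> straight w \<Longrightarrow> Poly_Mapping.keys u \<subseteq> {..m} \<Longrightarrow> admissible (Suc e) \<alpha> \<Longrightarrow>
    wt (u + expo \<alpha>) < w \<Longrightarrow> F + Poly_Mapping.single u c * hminor \<alpha> \<in> straight w"

lemma straight_add: "F \<in> straight w \<Longrightarrow> G \<in> straight w \<Longrightarrow> F + G \<in> straight w"
  by (induction F rule: straight.induct)
     (auto simp: add.commute[of _ G] add.assoc[symmetric] intro: straight.step)

lemma straight_sum: "(\<And>i. i \<in> A \<Longrightarrow> F i \<in> straight w) \<Longrightarrow> sum F A \<in> straight w"
  by (induction A rule: infinite_finite_induct) (auto intro: straight_add straight.zero)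

lemma straight_mult_single:
  assumes "F \<in> straight w" "Poly_Mapping.keys v \<subseteq> {..m}"
  shows "Poly_Mapping.single v c * F \<in> straight (w + wt v)"
  using assms(1)
proof (induction F rule: straight.induct)
  case (step F u \<alpha> c')
  have "Poly_Mapping.single v c * F + Poly_Mapping.single (v + u) (c * c') * hminor \<alpha> \<in> straight (w + wt v)"
    by (rule straight.step) (use step assms(2) keys_add[of v u] in \<open>auto simp: wt_add\<close>)
  thus ?case by (simp add: distrib_left mult.assoc[symmetric] mult_single)
qed (auto intro: straight.zero)

lemma straight_scale: "F \<in> straight w \<Longrightarrow> Poly_Mapping.single 0 c * F \<in> straight w"
  using straight_mult_single[of F w 0 c] by simp

lemma straight_uminus: "F \<in> straight w \<Longrightarrow> - F \<in> straight w"
  using straight_scale[of F w "-1"] by (simp add: single_uminus)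

lemma straight_diff: "F \<in> straight w \<Longrightarrow> G \<in> straight w \<Longrightarrow> F - G \<in> straight w"
  using straight_add[of F w "- G"] straight_uminus[of G w] by simp

lemma straight_mono: "F \<in> straight w \<Longrightarrow> w \<le> v \<Longrightarrow> F \<in> straight v"
  by (induction F rule: straight.induct) (auto intro: straight.intros)

lemma straight_generator:
  "Poly_Mapping.keys u \<subseteq> {..m} \<Longrightarrow> admissible (Suc e) \<alpha> \<Longrightarrow> wt (u + expo \<alpha>) < w \<Longrightarrow>
    Poly_Mapping.single u c * hminor \<alpha> \<in> straight w"
  using straight.step[OF straight.zero, of u \<alpha> w c] by simp

lemma straight_neg_one_power: "F \<in> straight w \<Longrightarrow> (- 1) ^ k * F \<in> straight w"
  by (cases "even k") (auto intro: straight_uminus)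

text \<open>Both products have the leading monomial \<open>expo (mset L)\<close>. They are
  neighbouring terms of the Pluecker relation with column \<open>p\<close> doubled, whose other
  terms have smaller weight or a zero factor. All minors in this relation are admissible, so the
  error stays within the filtration.\<close>

lemma straight_adjacent:
  assumes "sorted L" "length L = Suc (Suc e)" "set L \<subseteq> {e..<nrows}" "p \<le> e"
  shows "hvar (L ! p) * hminor (mset L - {#L ! p#}) - hvar (L ! Suc p) * hminor (mset L - {#L ! Suc p#})
    \<in> straight (wt (expo (mset L)))"
proof (cases "L ! p = L ! Suc p")
  case True
  thus ?thesis by (simp add: straight.zero)
next
  case False
  \<comment> \<open>The shift by \<open>i\<close> pauses after \<open>p\<close> because rows
    \<open>p\<close> and \<open>p + 1\<close> both meet column \<open>p\<close>:
    \<open>R p - p\<close> and \<open>R (Suc p) - p\<close> are \<open>L ! p\<close> and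
    \<open>L ! Suc p\<close>. That \<open>R\<close> increases strictly at this place is the
    inequality \<open>L ! p < L ! Suc p\<close>.\<close>
  define R where "R i = L ! i + (if i \<le> p then i else i - 1)" for i
  have L_mono: "L ! i \<le> L ! j" if "i \<le> j" "j \<le> Suc e" for i j
    using assms(1,2) that by (intro sorted_nth_mono) auto
  have L_range: "e \<le> L ! i" "L ! i < nrows" if "i \<le> Suc e" for i
  proof -
    have "L ! i \<in> set L" using assms(2) that by (intro nth_mem) simp
    thus "e \<le> L ! i" "L ! i < nrows" using assms(3) by auto
  qed
  have Lp: "L ! p < L ! Suc p" using False L_mono[of p "Suc p"] assms(4) by simp
  have R_Suc: "R i < R (Suc i)" if "i < Suc e" for i
    using L_mono[of i "Suc i"] that Lp by (cases "i = p") (auto simp: R_def)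
  have R_mono: "R i < R j" if "i < j" "j \<le> Suc e" for i j
    using that
  proof (induction j)
    case (Suc j)
    thus ?case using R_Suc[of j] by (cases "i = j") auto
  qed simp
  have R_ge: "e + i \<le> R i" if "i \<le> Suc e" for i
    using L_range[of i] L_range[of p] L_mono[of "Suc p" i] Lp that assms(4) by (auto simp: R_def)
  have R_less: "R (Suc i) < nrows + i" if "i \<le> e" for i
    using L_range[of "Suc i"] L_range[of "Suc p"] L_mono[of "Suc i" p] Lp that assms(4)
    by (auto simp: R_def)
  have skip_mono: "skip k i < skip k j" if "i < j" for k i j
    using that by (auto simp: skip_def)
  have skip_le: "skip k i \<le> Suc e" if "i < Suc e" for k i
    using that by (auto simp: skip_def)
  have Rs_ge: "e + i \<le> R (skip k i)" if "i < Suc e" for k i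
    using R_ge[OF skip_le[OF that, of k]] by (auto simp: skip_def split: if_splits)
  have Rs_less: "R (skip k i) < nrows + i" if "i < Suc e" for k i
  proof (cases "skip k i")
    case 0
    thus ?thesis using L_range[of 0] by (simp add: R_def)
  next
    case (Suc j)
    thus ?thesis using R_less[of j] that by (auto simp: skip_def split: if_splits)
  qed
  define A where "A k = image_mset (\<lambda>i. R (skip k i) - i) (mset_set {..<Suc e})" for k
  define T where "T k = hvar (R k - p) * hminor (A k)" for k
  have hdet_A: "hdet hvar (Suc e) (\<lambda>i. R (skip k i)) = hminor (A k)" for k
    unfolding A_def
  proof (rule hminor_mset[symmetric])
    show "R (skip k i) < R (skip k j)" if "i < j" "j < Suc e" for i j
      using that skip_mono skip_le R_mono by blast
    show "i \<le> R (skip k i)" if "i < Suc e" for i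
      using Rs_ge[OF that, of k] by simp
  qed
  have A_adm: "admissible (Suc e) (A k)" for k
    using Rs_ge[of _ k] Rs_less[of _ k] by (fastforce simp: admissible_def A_def)
  define Q where "Q k = int (R k) * int p + (\<Sum>i<Suc e. int (R (skip k i)) * int i)" for k
  \<comment> \<open>The part of the weight that does not depend on the omitted row: every term uses
    each row once, and each column once except for the doubled column \<open>p\<close>.\<close>
  define C where "C = int (Suc (Suc e)) * int m ^ 2 - (\<Sum>i\<le>Suc e. int (R i) ^ 2) -
      int p ^ 2 - (\<Sum>i<Suc e. int i ^ 2)"
  have weight: "int (wt (Poly_Mapping.single (m - (R k - p)) 1 + expo (A k))) = C + 2 * Q k"
    if "R k - p \<le> m" "k \<le> Suc e" for k
  proof -
    have pR: "p \<le> R k" using R_ge[OF that(2)] assms(4) by simp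
    have "int (wt (expo (A k))) = (\<Sum>i<Suc e. int m ^ 2 - int (R (skip k i) - i) ^ 2)"
      unfolding A_def expo_image_mset by (rule wt_sum_hvar)
        (use Rs_less[of _ k] nrows_le in \<open>fastforce\<close>)
    also have "\<dots> = (\<Sum>i<Suc e. int m ^ 2 - int (R (skip k i)) ^ 2 - int i ^ 2 + 2 * (int (R (skip k i)) * int i))"
    proof (intro sum.cong refl)
      fix i assume "i \<in> {..<Suc e}"
      hence "i \<le> R (skip k i)" using Rs_ge[of i k] by simp
      thus "int m ^ 2 - int (R (skip k i) - i) ^ 2 =
          int m ^ 2 - int (R (skip k i)) ^ 2 - int i ^ 2 + 2 * (int (R (skip k i)) * int i)"
        by (simp add: of_nat_diff power2_eq_square algebra_simps)
    qed
    also have "\<dots> = int (Suc e) * int m ^ 2 - (\<Sum>i<Suc e. int (R (skip k i)) ^ 2) - (\<Sum>i<Suc e. int i ^ 2) +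
        2 * (\<Sum>i<Suc e. int (R (skip k i)) * int i)"
      by (simp only: sum.distrib sum_subtractf sum_distrib_left sum_constant card_lessThan)
    finally have *: "int (wt (expo (A k))) = \<dots>" .
    have **: "int (wt (Poly_Mapping.single (m - (R k - p)) 1)) =
        int m ^ 2 - int (R k) ^ 2 - int p ^ 2 + 2 * (int (R k) * int p)"
      unfolding wt_single_hvar[OF that(1)] using pR
      by (simp add: of_nat_diff power2_eq_square algebra_simps)
    show ?thesis
      unfolding wt_add of_nat_add * ** C_def Q_def sum_skip[OF that(2), of "\<lambda>i. int (R i) ^ 2"]
      by (simp only: of_nat_Suc) (simp add: algebra_simps)
  qed
  have L_image: "mset L = image_mset ((!) L) (mset_set {..Suc e})"
    using assms(2) by (metis map_nth mset_map mset_upt atLeast0LessThan lessThan_Suc_atMost)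
  have A_eq: "mset L - {#L ! k#} = A k" and R_eq: "R k - p = L ! k" if "k = p \<or> k = Suc p" for k
  proof -
    have "A k = image_mset (\<lambda>i. L ! skip k i) (mset_set {..<Suc e})"
      unfolding A_def by (intro image_mset_cong) (use that in \<open>auto simp: R_def skip_def\<close>)
    thus "mset L - {#L ! k#} = A k"
      unfolding L_image by (subst image_mset_skip[of k]) (use that assms(4) in auto)
    show "R k - p = L ! k" using that by (auto simp: R_def)
  qed
  have wL: "int (wt (expo (mset L))) = C + 2 * Q p"
  proof -
    have "mset L = add_mset (L ! p) (A p)"
      using A_eq[of p] assms(2,4) by (metis insert_DiffM le_imp_less_Suc less_SucI nth_mem set_mset_mset)
    hence "expo (mset L) = Poly_Mapping.single (m - (R p - p)) 1 + expo (A p)"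
      using R_eq[of p] by simp
    moreover have "R p - p \<le> m" using R_eq[of p] L_range[of p] assms(4) nrows_le by simp
    ultimately show ?thesis using weight[of p] assms(4) by simp
  qed
  have T_small: "T k \<in> straight (wt (expo (mset L)))" if "k \<le> Suc e" "k \<noteq> p" "k \<noteq> Suc p" for k
  proof (cases "R k - p \<le> m")
    case True
    have "Q k < Q p"
      unfolding Q_def
      by (rule sum_doubled_column(2)[of "Suc e" "\<lambda>i. int (R i)"]) (use R_Suc assms(4) that in auto)
    hence "wt (Poly_Mapping.single (m - (R k - p)) 1 + expo (A k)) < wt (expo (mset L))"
      using weight[OF True that(1)] wL by linarith
    moreover have "hvar (R k - p) = Poly_Mapping.single (Poly_Mapping.single (m - (R k - p)) 1) 1"
      using True by (simp add: hvar_def indet_def)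
    ultimately show ?thesis
      unfolding T_def by (auto intro!: straight_generator A_adm)
  next
    case False
    thus ?thesis by (simp add: T_def hvar_def straight.zero)
  qed
  have "0 = (\<Sum>k\<le>Suc e. (-1) ^ k * T k)"
    using hdet_plucker[of p "Suc e" hvar R] assms(4) by (simp add: hdet_A T_def mult.assoc del: sum.atMost_Suc)
  also have "\<dots> = (-1) ^ p * T p + ((-1) ^ Suc p * T (Suc p) + (\<Sum>k\<in>{..Suc e} - {p} - {Suc p}. (-1) ^ k * T k))"
    using assms(4) by (subst sum.remove[of _ p], simp, simp, subst sum.remove[of _ "Suc p"]) auto
  finally have "(-1) ^ p * (T p - T (Suc p)) = - (\<Sum>k\<in>{..Suc e} - {p} - {Suc p}. (-1) ^ k * T k)"
    by (simp add: algebra_simps eq_neg_iff_add_eq_0)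
  moreover have "- (\<Sum>k\<in>{..Suc e} - {p} - {Suc p}. (-1) ^ k * T k) \<in> straight (wt (expo (mset L)))"
    by (intro straight_uminus straight_sum straight_neg_one_power T_small) auto
  ultimately have "(-1) ^ p * ((-1) ^ p * (T p - T (Suc p))) \<in> straight (wt (expo (mset L)))"
    by (metis straight_neg_one_power)
  hence "T p - T (Suc p) \<in> straight (wt (expo (mset L)))"
    by (simp add: mult.assoc[symmetric] power_add[symmetric])
  thus ?thesis
    unfolding T_def by (simp add: A_eq R_eq)
qed

lemma straight_exchange:
  assumes "admissible (Suc (Suc e)) M" "a \<in># M" "b \<in># M"
  shows "hvar a * hminor (M - {#a#}) - hvar b * hminor (M - {#b#}) \<in> straight (wt (expo M))"
proof -
  define L where "L = sorted_list_of_multiset M"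
  have L: "mset L = M" "sorted L" by (auto simp: L_def)
  have len: "length L = Suc (Suc e)" and ran: "set L \<subseteq> {e..<nrows}"
    using assms(1) L by (auto simp: admissible_def simp flip: set_mset_mset size_mset)
  define T where "T k = hvar (L ! k) * hminor (M - {#L ! k#})" for k
  have T0: "T k - T 0 \<in> straight (wt (expo M))" if "k < Suc (Suc e)" for k
    using that
  proof (induction k)
    case (Suc k)
    have "(T k - T 0) - (T k - T (Suc k)) \<in> straight (wt (expo M))"
    proof (rule straight_diff)
      show "T k - T (Suc k) \<in> straight (wt (expo M))"
        using straight_adjacent[OF L(2) len ran, of k] Suc.prems by (simp add: T_def L(1))
    qed (use Suc in simp)
    thus ?case by simp
  qed (simp add: straight.zero)
  obtain i j where "i < length L" "L ! i = a" "j < length L" "L ! j = b"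
    using assms(2,3) L(1) by (metis in_set_conv_nth set_mset_mset)
  thus ?thesis
    using straight_diff[OF T0[of i] T0[of j]] len by (simp add: T_def)
qed


lemma hminor_admissible_lead:
  "admissible (Suc e) \<alpha> \<Longrightarrow> wt_less (wt (expo \<alpha>)) (hminor \<alpha> - Poly_Mapping.single (expo \<alpha>) 1)"
  by (rule hminor_lead) (auto dest: admissible_D)

lemma straight_exchange_minor:
  assumes "admissible (Suc e) \<alpha>" "admissible (Suc e) \<beta>" "a \<in># \<alpha> - \<beta>" "b \<in># \<beta> - \<alpha>"
  defines "\<gamma> \<equiv> add_mset b (\<alpha> - {#a#})"
  shows "admissible (Suc e) \<gamma>"
    and "hvar b * hminor \<alpha> - hvar a * hminor \<gamma> \<in> straight (wt (expo (add_mset b \<alpha>)))"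
    and "add_mset a \<gamma> = add_mset b \<alpha>"
proof -
  have a: "a \<in># \<alpha>" and b: "b \<in># \<beta>" using assms(3,4) by (auto dest: in_diffD)
  show \<gamma>: "admissible (Suc e) \<gamma>"
    using assms(1,2) a b unfolding admissible_def \<gamma>_def
    by (auto simp: size_Diff_singleton dest: in_diffD)
  show eq: "add_mset a \<gamma> = add_mset b \<alpha>" using a by (simp add: \<gamma>_def)
  have "admissible (Suc (Suc e)) (add_mset b \<alpha>)"
    using assms(1,2) b by (auto simp: admissible_def)
  hence "hvar b * hminor (add_mset b \<alpha> - {#b#}) - hvar a * hminor (add_mset b \<alpha> - {#a#})
     \<in> straight (wt (expo (add_mset b \<alpha>)))"
    by (rule straight_exchange) (use a in auto)
  moreover have "add_mset b \<alpha> - {#a#} = \<gamma>" using eq by (metis add_mset_remove_trivial)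
  ultimately show "hvar b * hminor \<alpha> - hvar a * hminor \<gamma> \<in> straight (wt (expo (add_mset b \<alpha>)))"
    by simp
qed

text \<open>Exchange the elements of \<open>\<alpha>\<close> for those of \<open>\<beta>\<close> one at a time.\<close>

lemma straight_equiv:
  assumes "admissible (Suc e) \<alpha>" "admissible (Suc e) \<beta>"
    and "Poly_Mapping.keys u \<subseteq> {..m}" "u + expo \<alpha> = v + expo \<beta>"
  shows "Poly_Mapping.single u 1 * hminor \<alpha> - Poly_Mapping.single v 1 * hminor \<beta>
    \<in> straight (wt (u + expo \<alpha>))"
  using assms
proof (induction "size (\<alpha> - \<beta>)" arbitrary: \<alpha> u rule: less_induct)
  case less
  show ?case
  proof (cases "\<alpha> - \<beta> = {#}")
    case True
    hence "\<alpha> \<subseteq># \<beta>" by (simp add: Diff_eq_empty_iff_mset)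
    hence "\<alpha> = \<beta>"
      using less.prems(1,2) by (auto simp: admissible_def dest: mset_subset_size simp: subset_mset.le_less)
    thus ?thesis using less.prems(4) by (simp add: straight.zero)
  next
    case False
    then obtain a where a: "a \<in># \<alpha> - \<beta>" by blast
    have "\<beta> - \<alpha> \<noteq> {#}"
    proof
      assume "\<beta> - \<alpha> = {#}"
      hence "\<beta> \<subseteq># \<alpha>" by (simp add: Diff_eq_empty_iff_mset)
      hence "\<beta> = \<alpha>"
        using less.prems(1,2) by (auto simp: admissible_def dest: mset_subset_size simp: subset_mset.le_less)
      thus False using False by simp
    qed
    then obtain b where b: "b \<in># \<beta> - \<alpha>" by blast
    define \<gamma> where "\<gamma> = add_mset b (\<alpha> - {#a#})"
    note ex = straight_exchange_minor[OF less.prems(1,2) a b, folded \<gamma>_def]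
    have bm: "b \<le> m" and am: "a \<le> m"
      using less.prems(1,2) a b by (auto dest!: in_diffD admissible_D(2))
    \<comment> \<open>The total exponents agree, but \<open>\<beta>\<close> contains
      \<open>b\<close> more often than \<open>\<alpha>\<close>; so the cofactor \<open>u\<close>
      contains the variable of \<open>b\<close> and can pay for the exchange.\<close>
    have "count \<alpha> b < count \<beta> b" using b by (simp add: in_diff_count)
    moreover have "Poly_Mapping.lookup u (m - b) + count \<alpha> b = Poly_Mapping.lookup v (m - b) + count \<beta> b"
      using arg_cong[OF less.prems(4), of "\<lambda>x. Poly_Mapping.lookup x (m - b)"] bm less.prems(1,2)
      by (simp add: lookup_add lookup_expo admissible_D(2))
    ultimately have "0 < Poly_Mapping.lookup u (m - b)" by simp
    then obtain u' where u': "u = u' + Poly_Mapping.single (m - b) 1"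
      "Poly_Mapping.keys u' \<subseteq> Poly_Mapping.keys u"
      by (rule single_split)
    define w where "w = u' + Poly_Mapping.single (m - a) 1"
    have w_eq: "w + expo \<gamma> = u + expo \<alpha>"
    proof -
      have "Poly_Mapping.single (m - a) 1 + expo \<gamma> = Poly_Mapping.single (m - b) 1 + expo \<alpha>"
        using arg_cong[OF ex(3), of expo] by simp
      thus ?thesis by (simp add: w_def u'(1) add.assoc)
    qed
    have w_keys: "Poly_Mapping.keys w \<subseteq> {..m}"
    proof -
      have "Poly_Mapping.keys w \<subseteq> Poly_Mapping.keys u' \<union> {m - a}"
        unfolding w_def using keys_add[of u' "Poly_Mapping.single (m - a) 1"] by simp
      also have "\<dots> \<subseteq> {..m}" using u'(2) less.prems(3) by auto
      finally show ?thesis .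
    qed
    have "size (\<gamma> - \<beta>) < size (\<alpha> - \<beta>)"
    proof -
      have eq: "\<gamma> - \<beta> = \<alpha> - \<beta> - {#a#}"
        using a b by (intro multiset_eqI) (auto simp: \<gamma>_def in_diff_count)
      show ?thesis unfolding eq by (rule size_Diff1_less[OF a])
    qed
    hence "Poly_Mapping.single w 1 * hminor \<gamma> - Poly_Mapping.single v 1 * hminor \<beta> \<in> straight (wt (w + expo \<gamma>))"
      by (rule less.hyps[OF _ ex(1) less.prems(2) w_keys]) (simp add: w_eq less.prems(4))
    moreover have "Poly_Mapping.single u' 1 * (hvar b * hminor \<alpha> - hvar a * hminor \<gamma>)
        \<in> straight (wt (expo (add_mset b \<alpha>)) + wt u')"
      by (rule straight_mult_single[OF ex(2)]) (use u'(2) less.prems(3) in auto)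
    moreover have "wt (expo (add_mset b \<alpha>)) + wt u' = wt (u + expo \<alpha>)"
      by (simp add: u'(1) wt_add)
    moreover have "Poly_Mapping.single u' 1 * (hvar b * hminor \<alpha> - hvar a * hminor \<gamma>) =
        Poly_Mapping.single u 1 * hminor \<alpha> - Poly_Mapping.single w 1 * hminor \<gamma>"
      using am bm by (simp add: hvar_def indet_def right_diff_distrib mult.assoc[symmetric] mult_single
          u'(1) w_def)
    ultimately show ?thesis
      unfolding w_eq using straight_add by fastforce
  qed
qed

section \<open>Normal forms for the layer of highest weight\<close>

definition divisible :: "(nat \<Rightarrow>\<^sub>0 nat) \<Rightarrow> bool" where
  "divisible a \<longleftrightarrow> (\<exists>u \<alpha>. admissible (Suc e) \<alpha> \<and> Poly_Mapping.keys u \<subseteq> {..m} \<and> a = u + expo \<alpha>)"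

text \<open>One multiple of a minor with leading monomial \<open>a\<close>, fixed arbitrarily; by
  \<open>straight_equiv\<close> another choice differs only by an element of
  \<open>straight (wt a)\<close>.\<close>

definition rep :: "(nat \<Rightarrow>\<^sub>0 nat) \<Rightarrow> cpoly" where
  "rep a = (SOME g. \<exists>u \<alpha>. admissible (Suc e) \<alpha> \<and> Poly_Mapping.keys u \<subseteq> {..m} \<and> a = u + expo \<alpha> \<and>
     g = Poly_Mapping.single u 1 * hminor \<alpha>)"

lemma repE:
  assumes "divisible a"
  obtains u \<alpha> where "admissible (Suc e) \<alpha>" "Poly_Mapping.keys u \<subseteq> {..m}" "a = u + expo \<alpha>"
    "rep a = Poly_Mapping.single u 1 * hminor \<alpha>"
proof -
  have "\<exists>u \<alpha>. admissible (Suc e) \<alpha> \<and> Poly_Mapping.keys u \<subseteq> {..m} \<and> a = u + expo \<alpha> \<and>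
     rep a = Poly_Mapping.single u 1 * hminor \<alpha>"
    unfolding rep_def by (rule someI_ex) (use assms in \<open>auto simp: divisible_def\<close>)
  thus ?thesis using that by blast
qed

lemma single_hminor_lead:
  assumes "admissible (Suc e) \<alpha>"
  shows "wt_less (wt (u + expo \<alpha>)) (Poly_Mapping.single u c * hminor \<alpha> - Poly_Mapping.single (u + expo \<alpha>) c)"
proof -
  have "wt_less (wt (expo \<alpha>) + wt u) ((hminor \<alpha> - Poly_Mapping.single (expo \<alpha>) 1) * Poly_Mapping.single u c)"
    by (rule wt_less_mult[OF hminor_admissible_lead[OF assms]]) (auto simp: wt_less_def)
  moreover have "(hminor \<alpha> - Poly_Mapping.single (expo \<alpha>) 1) * Poly_Mapping.single u c =
      Poly_Mapping.single u c * hminor \<alpha> - Poly_Mapping.single (u + expo \<alpha>) c"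
    by (simp add: left_diff_distrib mult_single add.commute[of u])
  ultimately show ?thesis by (simp add: wt_add add.commute)
qed

lemma rep_lead:
  assumes "divisible a"
  shows "wt_less (wt a) (rep a - Poly_Mapping.single a 1)"
  using assms by (elim repE) (use single_hminor_lead in auto)

lemma rep_straight:
  assumes "divisible a" "wt a < w"
  shows "rep a \<in> straight w"
  using assms(1) by (elim repE) (use assms(2) in \<open>auto intro: straight_generator\<close>)

text \<open>Reads the layer of weight \<open>w\<close> off \<open>F\<close> itself and not off a
  representation of \<open>F\<close> by minors. It is additive in \<open>F\<close> and vanishes as
  soon as this layer cancels.\<close>

definition top_rep :: "nat \<Rightarrow> cpoly \<Rightarrow> cpoly" where
  "top_rep w F = (\<Sum>a\<in>Poly_Mapping.keys F. if wt a = w then Poly_Mapping.single 0 (Poly_Mapping.lookup F a) * rep a else 0)"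

lemma top_rep_add: "top_rep w (F + G) = top_rep w F + top_rep w G"
  unfolding top_rep_def by (rule setsum_keys_plus_distrib) (auto simp: single_add distrib_right)

lemma top_rep_single: "top_rep w (Poly_Mapping.single a c) = (if wt a = w then Poly_Mapping.single 0 c * rep a else 0)"
  by (auto simp: top_rep_def)

lemma top_rep_small: "wt_less w F \<Longrightarrow> top_rep w F = 0"
  by (auto simp: top_rep_def wt_less_def intro!: sum.neutral)

text \<open>A summand of weight \<open>w\<close> differs from the representative of its leading
  monomial by an element of \<open>straight w\<close>, due to \<open>straight_equiv\<close>; its
  other monomials have smaller weight and do not enter \<open>top_rep w\<close>. Summands of smaller
  weight lie in \<open>straight w\<close> anyway.\<close>

lemma straight_top:
  assumes "F \<in> straight (Suc w)"
  shows "F - top_rep w F \<in> straight w \<and> wt_less (Suc w) F \<and>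
    (\<forall>a\<in>Poly_Mapping.keys F. wt a = w \<longrightarrow> divisible a)"
  using assms
proof (induction F rule: straight.induct)
  case zero
  show ?case by (simp add: top_rep_def straight.zero)
next
  case (step F u \<alpha> c)
  define a where "a = u + expo \<alpha>"
  define G where "G = Poly_Mapping.single u c * hminor \<alpha>"
  define H where "H = G - Poly_Mapping.single a c"
  have G: "G = Poly_Mapping.single a c + H" by (simp add: H_def)
  have H: "wt_less (wt a) H"
    unfolding H_def G_def a_def by (rule single_hminor_lead) (rule step)
  have aw: "wt a \<le> w" using step by (simp add: a_def)
  have a_div: "divisible a" using step by (auto simp: divisible_def a_def)
  have keys_G: "Poly_Mapping.keys G \<subseteq> insert a (Poly_Mapping.keys H)"
    unfolding G using keys_add[of "Poly_Mapping.single a c" H] by (auto split: if_splits)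
  have "top_rep w G = (if wt a = w then Poly_Mapping.single 0 c * rep a else 0)"
    using top_rep_small[OF wt_less_mono[OF H aw]] by (simp add: G top_rep_add top_rep_single)
  moreover have "G - (if wt a = w then Poly_Mapping.single 0 c * rep a else 0) \<in> straight w"
  proof (cases "wt a = w")
    case True
    obtain v \<beta> where v: "admissible (Suc e) \<beta>" "Poly_Mapping.keys v \<subseteq> {..m}" "a = v + expo \<beta>"
      "rep a = Poly_Mapping.single v 1 * hminor \<beta>"
      using a_div by (elim repE) auto
    have "Poly_Mapping.single u 1 * hminor \<alpha> - rep a \<in> straight w"
      using straight_equiv[OF step(3) v(1) step(2), of v] v True by (simp add: a_def)
    hence "Poly_Mapping.single 0 c * (Poly_Mapping.single u 1 * hminor \<alpha> - rep a) \<in> straight w"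
      by (rule straight_scale)
    thus ?thesis using True
      by (simp add: G_def right_diff_distrib mult.assoc[symmetric] mult_single)
  next
    case False
    thus ?thesis using aw step by (auto simp: G_def a_def intro!: straight_generator)
  qed
  ultimately have "G - top_rep w G \<in> straight w" by simp
  hence "(F - top_rep w F) + (G - top_rep w G) \<in> straight w"
    using step by (intro straight_add) auto
  hence "F + G - top_rep w (F + G) \<in> straight w"
    by (simp add: top_rep_add algebra_simps)
  moreover have "wt_less (Suc w) G"
    unfolding G using aw by (intro wt_less_add wt_less_mono[OF H]) (auto simp: wt_less_def)
  hence "wt_less (Suc w) (F + G)"
    using step by (intro wt_less_add) auto
  moreover have "\<forall>b\<in>Poly_Mapping.keys (F + G). wt b = w \<longrightarrow> divisible b"
  proof safe
    fix b assume b: "b \<in> Poly_Mapping.keys (F + G)" "w = wt b"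
    show "divisible b"
    proof (cases "b \<in> Poly_Mapping.keys F")
      case True
      thus ?thesis using step b by auto
    next
      case False
      hence "b \<in> insert a (Poly_Mapping.keys H)" using b keys_add[of F G] keys_G by auto
      moreover have "b \<notin> Poly_Mapping.keys H" using H aw b by (auto simp: wt_less_def)
      ultimately have "b = a" by simp
      thus ?thesis using a_div by simp
    qed
  qed
  ultimately show ?case unfolding G_def by blast
qed

text \<open>If the layer of weight \<open>w\<close> is empty, then \<open>top_rep w F\<close> is 0
  and \<open>F\<close> equals its remainder in \<open>straight w\<close>. This is the standard basis
  property of the minors with respect to the weight.\<close>

lemma straight_descend:
  assumes "F \<in> straight w" "wt_less v F"
  shows "F \<in> straight v"
  using assms
proof (induction w)
  case 0
  thus ?case using straight_mono[of F 0 v] by simp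
next
  case (Suc w)
  show ?case
  proof (cases "Suc w \<le> v")
    case False
    hence "wt_less w F" using Suc.prems(2) by (auto intro: wt_less_mono)
    hence "F \<in> straight w" using straight_top[OF Suc.prems(1)] by (simp add: top_rep_small)
    thus ?thesis using Suc by simp
  qed (use Suc.prems straight_mono in blast)
qed

section \<open>The pivot is not a zero divisor modulo the minors\<close>

definition toeplitz_pivot :: cpoly where
  "toeplitz_pivot = hminor (replicate_mset e nrows)"

lemma expo_replicate: "expo (replicate_mset n i) = Poly_Mapping.single (m - i) n"
  by (induction n) (auto simp: single_add[symmetric])

text \<open>\<open>nrows\<close> is the first index beyond the admissible range and belongs to c_d.
  As the \<open>hminor\<close> of \<open>e\<close> copies of it, the pivot gets its leading term
  from the same lemma as the maximal minors.\<close>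

lemma toeplitz_pivot_lead:
  "wt_less (wt (Poly_Mapping.single d e)) (toeplitz_pivot - Poly_Mapping.single (Poly_Mapping.single d e) 1)"
proof -
  have "m - nrows = d" using dem by (simp add: nrows_def)
  moreover have "wt_less (wt (expo (replicate_mset e nrows)))
     (toeplitz_pivot - Poly_Mapping.single (expo (replicate_mset e nrows)) 1)"
    unfolding toeplitz_pivot_def
    by (rule hminor_lead) (use nrows_le e_less_nrows in \<open>auto split: if_splits\<close>)
  ultimately show ?thesis by (simp add: expo_replicate)
qed

text \<open>The leading monomials of the minors do not involve \<open>c\<^sub>d\<close>, while that of the pivot is a power of it.\<close>

lemma divisible_cancel:
  assumes "divisible (Poly_Mapping.single d k + a)"
  shows "divisible a"
proof -
  obtain u \<alpha> where u: "admissible (Suc e) \<alpha>" "Poly_Mapping.keys u \<subseteq> {..m}"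
    "Poly_Mapping.single d k + a = u + expo \<alpha>"
    using assms by (auto simp: divisible_def)
  have d: "m - nrows = d" using dem by (simp add: nrows_def)
  have "nrows \<notin># \<alpha>" using u(1) by (auto simp: admissible_def)
  hence "Poly_Mapping.lookup (expo \<alpha>) (m - nrows) = 0"
    by (simp add: lookup_expo[OF admissible_D(2)[OF u(1)] nrows_le] not_in_iff)
  hence k: "k \<le> Poly_Mapping.lookup u d"
    using arg_cong[OF u(3), of "\<lambda>x. Poly_Mapping.lookup x d"] by (simp add: lookup_add d)
  define u' where "u' = u - Poly_Mapping.single d k"
  have "u = Poly_Mapping.single d k + u'"
    using k by (intro poly_mapping_eqI) (auto simp: u'_def lookup_add lookup_minus lookup_single when_def)
  hence "a = u' + expo \<alpha>" using u(3) by (simp add: add.assoc)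
  moreover have "Poly_Mapping.keys u' \<subseteq> {..m}"
    using u(2) by (auto simp: u'_def in_keys_iff lookup_minus subset_iff)
  ultimately show ?thesis using u(1) by (auto simp: divisible_def)
qed

lemma hvar_carrier [simp]: "hvar i \<in> carrier (cpoly_ring m)"
  by (simp add: hvar_def)

lemma hdet_carrier: "hdet hvar N r \<in> carrier (cpoly_ring m)"
  unfolding hdet_def by (rule carrier_det[OF mat_carrier]) simp

lemma toeplitz_pivot_carrier: "toeplitz_pivot \<in> carrier (cpoly_ring m)"
  unfolding toeplitz_pivot_def hminor_def by (rule hdet_carrier)

lemma straight_mult_carrier:
  assumes "F \<in> straight w" "q \<in> carrier (cpoly_ring m)"
  shows "\<exists>v. q * F \<in> straight v"
proof -
  let ?K = "Poly_Mapping.keys q"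
  have "(\<Sum>a\<in>?K. Poly_Mapping.single a (Poly_Mapping.lookup q a) * F) \<in> straight (w + (\<Sum>a\<in>?K. wt a))"
  proof (rule straight_sum)
    fix a assume a: "a \<in> ?K"
    have "Poly_Mapping.single a (Poly_Mapping.lookup q a) * F \<in> straight (w + wt a)"
      by (rule straight_mult_single[OF assms(1)]) (use a assms(2) in \<open>auto simp: carrier_cpoly_ring\<close>)
    moreover have "w + wt a \<le> w + (\<Sum>a\<in>?K. wt a)"
      using a by (intro add_left_mono member_le_sum) auto
    ultimately show "Poly_Mapping.single a (Poly_Mapping.lookup q a) * F \<in> straight (w + (\<Sum>a\<in>?K. wt a))"
      by (rule straight_mono)
  qed
  also have "(\<Sum>a\<in>?K. Poly_Mapping.single a (Poly_Mapping.lookup q a) * F) = q * F"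
    using cpoly_eq_sum_singles[of q] by (metis sum_distrib_right)
  finally show ?thesis by blast
qed

text \<open>Induction on a bound for the weights in \<open>f\<close>. The top layer of the product
  is c_d^e times that of \<open>f\<close>; its monomials are divisible, hence so are those of
  \<open>f\<close> in its top layer, by cancelling c_d^e. Subtracting their representatives, which
  lie in the ideal, lowers the weight.\<close>

lemma toeplitz_pivot_nonzerodivisor:
  assumes "toeplitz_pivot * f \<in> straight w"
  shows "\<exists>v. f \<in> straight v"
proof -
  define v where "v = Suc (\<Sum>a\<in>Poly_Mapping.keys f. wt a)"
  have "wt_less v f"
    unfolding wt_less_def v_def by (auto simp: less_Suc_eq_le intro!: member_le_sum)
  thus ?thesis using assms
  proof (induction v arbitrary: f w)
    case 0
    hence "Poly_Mapping.keys f = {}" by (auto simp: wt_less_def)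
    hence "f = 0" by (intro poly_mapping_eqI) (auto simp: in_keys_iff)
    thus ?case using straight.zero by blast
  next
    case (Suc v)
    define t where "t = Poly_Mapping.single d e"
    define s' where "s' = toeplitz_pivot - Poly_Mapping.single t 1"
    have s: "toeplitz_pivot = Poly_Mapping.single t 1 + s'" by (simp add: s'_def)
    have s': "wt_less (wt t) s'" unfolding s'_def t_def by (rule toeplitz_pivot_lead)
    have s'f: "wt_less (wt t + v) (s' * f)" by (rule wt_less_mult[OF s' Suc.prems(1)])
    have tf: "wt_less (Suc v + wt t) (f * Poly_Mapping.single t 1)"
      by (rule wt_less_mult[OF Suc.prems(1)]) (auto simp: wt_less_def)
    have sf: "toeplitz_pivot * f = Poly_Mapping.single t 1 * f + s' * f"
      by (simp add: s distrib_right)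
    have "wt_less (Suc (wt t + v)) (toeplitz_pivot * f)"
      unfolding sf using tf wt_less_mono[OF s'f, of "Suc (wt t + v)"]
      by (intro wt_less_add) (simp_all add: mult.commute add.commute)
    \<comment> \<open>\<open>straight_descend\<close> replaces the unrelated \<open>w\<close> by the
      actual weight of the product, so that \<open>straight_top\<close> speaks about its top
      layer.\<close>
    hence sf_str: "toeplitz_pivot * f \<in> straight (Suc (wt t + v))"
      using straight_descend Suc.prems(2) by blast
    define A where "A = {a \<in> Poly_Mapping.keys f. wt a = v}"
    have A_div: "divisible a" if "a \<in> A" for a
    proof -
      \<comment> \<open>The lower terms of the pivot cannot cancel the monomial
        \<open>t + a\<close>, whose weight they do not reach.\<close>
      have "Poly_Mapping.lookup (s' * f) (t + a) = 0"
    proof (rule ccontr)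
      assume "Poly_Mapping.lookup (s' * f) (t + a) \<noteq> 0"
      hence "wt (t + a) < wt t + v" using s'f by (simp add: wt_less_def in_keys_iff)
      thus False using that by (simp add: wt_add A_def)
    qed
      hence "Poly_Mapping.lookup (toeplitz_pivot * f) (t + a) = Poly_Mapping.lookup f a"
        by (simp add: sf lookup_add lookup_single_mult)
      hence "t + a \<in> Poly_Mapping.keys (toeplitz_pivot * f)"
        using that by (simp add: in_keys_iff A_def)
      moreover have "wt (t + a) = wt t + v" using that by (simp add: wt_add A_def)
      ultimately have "divisible (t + a)" using straight_top[OF sf_str] by blast
      thus ?thesis unfolding t_def by (rule divisible_cancel)
    qed
    define g where "g = (\<Sum>a\<in>A. Poly_Mapping.single 0 (Poly_Mapping.lookup f a) * rep a)"
    have g: "g \<in> straight (Suc v)"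
      unfolding g_def by (intro straight_sum straight_scale rep_straight A_div) (auto simp: A_def)
    have "f - g = (\<Sum>a\<in>Poly_Mapping.keys f - A. Poly_Mapping.single a (Poly_Mapping.lookup f a)) -
       (\<Sum>a\<in>A. Poly_Mapping.single 0 (Poly_Mapping.lookup f a) * (rep a - Poly_Mapping.single a 1))"
    proof -
      have "f = (\<Sum>a\<in>Poly_Mapping.keys f - A. Poly_Mapping.single a (Poly_Mapping.lookup f a)) +
          (\<Sum>a\<in>A. Poly_Mapping.single a (Poly_Mapping.lookup f a))"
        using cpoly_eq_sum_singles[of f] sum.subset_diff[of A "Poly_Mapping.keys f"
            "\<lambda>a. Poly_Mapping.single a (Poly_Mapping.lookup f a)"] by (simp add: A_def)
      thus ?thesis
        by (simp add: g_def right_diff_distrib sum_subtractf mult_single algebra_simps)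
    qed
    moreover have "wt_less v \<dots>"
    proof (intro wt_less_diff wt_less_sum)
      fix a assume "a \<in> Poly_Mapping.keys f - A"
      thus "wt_less v (Poly_Mapping.single a (Poly_Mapping.lookup f a))"
        using Suc.prems(1) by (fastforce simp: wt_less_def A_def)
    next
      fix a assume a: "a \<in> A"
      have "wt_less (wt a + 0) ((rep a - Poly_Mapping.single a 1) * Poly_Mapping.single 0 (Poly_Mapping.lookup f a))"
        by (rule wt_less_mult[OF rep_lead[OF A_div[OF a]]]) (auto simp: wt_less_def)
      thus "wt_less v (Poly_Mapping.single 0 (Poly_Mapping.lookup f a) * (rep a - Poly_Mapping.single a 1))"
        using a by (simp add: A_def mult.commute)
    qed
    ultimately have "wt_less v (f - g)" by simp
    moreover have "\<exists>w'. toeplitz_pivot * (f - g) \<in> straight w'"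
    proof -
      obtain w1 where "toeplitz_pivot * g \<in> straight w1"
        using straight_mult_carrier[OF g toeplitz_pivot_carrier] by blast
      hence "toeplitz_pivot * f - toeplitz_pivot * g \<in> straight (max w w1)"
        using Suc.prems(2) by (intro straight_diff) (auto intro: straight_mono)
      thus ?thesis by (auto simp: right_diff_distrib)
    qed
    ultimately obtain v' where "f - g \<in> straight v'" using Suc.IH by blast
    hence "f - g \<in> straight (max v' (Suc v))" "g \<in> straight (max v' (Suc v))"
      using g straight_mono by (meson max.cobounded1 max.cobounded2)+
    hence "f - g + g \<in> straight (max v' (Suc v))" by (rule straight_add)
    thus ?case by auto
  qed
qed

end


section \<open>The ideal of maximal minors\<close>

lemma minors_all_columns:
  assumes k: "dim_col A = k"
  shows "minors k A = {det (mat k k (\<lambda>(i, j). A $$ (r i, j))) | r.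
    (\<forall>i j. i < j \<longrightarrow> j < k \<longrightarrow> r i < r j) \<and> (\<forall>i<k. r i < dim_row A)}"
proof -
  have sub: "submatrix A I {..<k} = mat k k (\<lambda>(i, j). A $$ (pick I i, j))"
    if "I \<subseteq> {..<dim_row A}" "card I = k" for I
  proof -
    have "{i. i < dim_row A \<and> i \<in> I} = I" "{j. j < dim_col A \<and> j \<in> {..<k}} = {..<k}"
      using that k by auto
    moreover have "pick {..<k} j = j" if "j < k" for j
    proof -
      have "{a \<in> {..<k}. a < j} = {..<j}" using that by auto
      thus ?thesis using pick_card_in_set[of j "{..<k}"] that by simp
    qed
    ultimately show ?thesis
      unfolding submatrix_def using that by (intro eq_matI) auto
  qed
  show ?thesis
  proof (intro equalityI subsetI)
    fix x assume "x \<in> minors k A"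
    then obtain I J where IJ: "x = det (submatrix A I J)" "I \<subseteq> {..<dim_row A}" "J \<subseteq> {..<k}"
      "card I = k" "card J = k"
      by (auto simp: minors_def k)
    have "J = {..<k}" using IJ(3,5) by (intro card_subset_eq) auto
    hence "x = det (mat k k (\<lambda>(i, j). A $$ (pick I i, j)))" using IJ sub by simp
    moreover have "pick I i < pick I j" if "i < j" "j < k" for i j
      using pick_mono_le[of j I i] that IJ by simp
    moreover have "pick I i < dim_row A" if "i < k" for i
      using pick_in_set_le[of i I] that IJ by auto
    ultimately show "x \<in> {det (mat k k (\<lambda>(i, j). A $$ (r i, j))) | r.
      (\<forall>i j. i < j \<longrightarrow> j < k \<longrightarrow> r i < r j) \<and> (\<forall>i<k. r i < dim_row A)}"
      by blast
  next
    fix x assume "x \<in> {det (mat k k (\<lambda>(i, j). A $$ (r i, j))) | r.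
      (\<forall>i j. i < j \<longrightarrow> j < k \<longrightarrow> r i < r j) \<and> (\<forall>i<k. r i < dim_row A)}"
    then obtain r where r: "x = det (mat k k (\<lambda>(i, j). A $$ (r i, j)))"
      "\<And>i j. i < j \<Longrightarrow> j < k \<Longrightarrow> r i < r j" "\<And>i. i < k \<Longrightarrow> r i < dim_row A"
      by blast
    define I where "I = r ` {..<k}"
    have inj: "inj_on r {..<k}"
      by (rule linorder_inj_onI') (use r(2) in fastforce)
    have "pick I i = r i" if "i < k" for i
    proof -
      have "{a \<in> I. a < r i} = r ` {..<i}"
      proof (intro equalityI subsetI)
        fix a assume "a \<in> {a \<in> I. a < r i}"
        then obtain j where j: "j < k" "a = r j" "r j < r i" by (auto simp: I_def)
        hence "j < i" using r(2)[of i j] by (metis linorder_neqE_nat less_asym)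
        thus "a \<in> r ` {..<i}" using j by auto
      qed (use that r(2) in \<open>auto simp: I_def\<close>)
      hence "card {a \<in> I. a < r i} = i"
        using card_image[OF inj_on_subset[OF inj, of "{..<i}"]] that by auto
      thus ?thesis using pick_card_in_set[of "r i" I] that by (simp add: I_def)
    qed
    hence "mat k k (\<lambda>(i, j). A $$ (r i, j)) = mat k k (\<lambda>(i, j). A $$ (pick I i, j))"
      by (intro eq_matI) auto
    moreover have I: "I \<subseteq> {..<dim_row A}" "card I = k"
      using r(3) card_image[OF inj] by (auto simp: I_def)
    ultimately have "x = det (submatrix A I {..<k})" by (simp add: sub r(1))
    thus "x \<in> minors k A" unfolding minors_def k using I
      by (intro CollectI exI[of _ I] exI[of _ "{..<k}"]) auto
  qed
qed

definition hval :: "nat \<Rightarrow> (nat \<Rightarrow> 'a) \<Rightarrow> nat \<Rightarrow> 'a :: zero" where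
  "hval m c i = (if i \<le> m then c (m - i) else 0)"

text \<open>Links the column order of \<open>hankel_mat\<close> with that of \<open>hdet\<close>:
  reversing the columns, a permutation of the rows of the transpose, costs a sign and shifts the row
  indices by \<open>e\<close>.\<close>

lemma det_reverse_columns:
  "\<exists>p. det (mat (Suc e) (Suc e) (\<lambda>(i, j). h (r i + j))) = signof p * hdet h (Suc e) (\<lambda>i. r i + e)"
proof -
  let ?A = "mat (Suc e) (Suc e) (\<lambda>(i, j). h (r i + j))"
  let ?B = "mat (Suc e) (Suc e) (\<lambda>(i, j). h (r i + e - j))"
  define p where "p i = (if i \<le> e then e - i else i)" for i
  have p: "p permutes {0..<Suc e}"
    by (rule bij_imp_permutes, rule bij_betw_byWitness[of _ p]) (auto simp: p_def)
  have "det ?A = det (transpose_mat ?A)" by (rule det_transpose[symmetric, OF mat_carrier])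
  also have "transpose_mat ?A = mat (Suc e) (Suc e) (\<lambda>(i, j). transpose_mat ?B $$ (p i, j))"
    by (rule eq_matI) (auto simp: p_def)
  also have "det \<dots> = signof p * det (transpose_mat ?B)"
    by (rule det_permute_rows[OF _ p]) simp
  also have "det (transpose_mat ?B) = det ?B" by (rule det_transpose[OF mat_carrier])
  finally show ?thesis unfolding hdet_def by blast
qed

lemma minors_hankel_mat:
  "minors (Suc e) (hankel_mat d e m c) = {det (mat (Suc e) (Suc e) (\<lambda>(i, j). hval m c (r i + j))) | r.
    (\<forall>i j. i < j \<longrightarrow> j < Suc e \<longrightarrow> r i < r j) \<and> (\<forall>i<Suc e. r i < m - d)}"
proof -
  have dims: "dim_col (hankel_mat d e m c) = Suc e" "dim_row (hankel_mat d e m c) = m - d"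
    by (simp_all add: hankel_mat_def)
  have "mat (Suc e) (Suc e) (\<lambda>(i, j). hankel_mat d e m c $$ (r i, j)) =
      mat (Suc e) (Suc e) (\<lambda>(i, j). hval m c (r i + j))"
    if "\<forall>i<Suc e. r i < m - d" for r
    using that by (intro eq_matI) (auto simp: hankel_mat_def hval_def)
  thus ?thesis
    unfolding minors_all_columns[OF dims(1)] dims(2) by (intro Collect_cong) metis
qed

lemma carrier_induct [consumes 1, case_names const indet add mult]:
  assumes "f \<in> carrier (cpoly_ring m)"
    and const: "\<And>u. P (Poly_Mapping.single 0 u)" and indet: "\<And>i. i \<le> m \<Longrightarrow> P (indet i)"
    and add: "\<And>f g. f \<in> carrier (cpoly_ring m) \<Longrightarrow> g \<in> carrier (cpoly_ring m) \<Longrightarrow> P f \<Longrightarrow> P g \<Longrightarrow> P (f + g)"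
    and mult: "\<And>f g. f \<in> carrier (cpoly_ring m) \<Longrightarrow> g \<in> carrier (cpoly_ring m) \<Longrightarrow> P f \<Longrightarrow> P g \<Longrightarrow> P (f * g)"
  shows "P f"
proof -
  have mono: "P (Poly_Mapping.single a 1)" if "Poly_Mapping.keys a \<subseteq> {..m}" for a
    using that
  proof (induction "\<Sum>i\<in>Poly_Mapping.keys a. Poly_Mapping.lookup a i" arbitrary: a rule: less_induct)
    case less
    show ?case
    proof (cases "a = 0")
      case True
      thus ?thesis using const[of 1] by simp
    next
      case False
      then obtain i where i: "i \<in> Poly_Mapping.keys a"
        by (metis all_not_in_conv keys_eq_empty)
      hence "0 < Poly_Mapping.lookup a i" by (simp add: in_keys_iff)
      then obtain b where b: "a = b + Poly_Mapping.single i 1" "Poly_Mapping.keys b \<subseteq> Poly_Mapping.keys a"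
        by (rule single_split)
      have td: "total_degree a = total_degree b + total_degree (Poly_Mapping.single i 1)"
        unfolding b(1) by (rule total_degree_add)
      hence "P (Poly_Mapping.single b 1)"
        using b(2) less.prems by (intro less.hyps) (auto simp: total_degree_def)
      moreover have "i \<le> m" using i less.prems by auto
      ultimately have "P (Poly_Mapping.single b 1 * indet i)"
        using b(2) less.prems by (intro mult indet carrier_single) auto
      thus ?thesis by (simp add: b(1) indet_def mult_single)
    qed
  qed
  have "P (\<Sum>a\<in>A. Poly_Mapping.single a (Poly_Mapping.lookup f a))" if "A \<subseteq> Poly_Mapping.keys f" "finite A" for A
    using that(2,1)
  proof (induction A rule: finite_induct)
    case empty
    thus ?case using const[of 0] by simp
  next
    case (insert a A)
    have a: "Poly_Mapping.keys a \<subseteq> {..m}" using insert.prems assms(1) by (auto simp: carrier_cpoly_ring)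
    have "P (Poly_Mapping.single 0 (Poly_Mapping.lookup f a) * Poly_Mapping.single a 1)"
      by (intro mult mono const carrier_single) (use a in auto)
    hence "P (Poly_Mapping.single a (Poly_Mapping.lookup f a))" by (simp add: mult_single)
    thus ?case using insert assms(1)
      by (auto intro!: add carrier_sum carrier_single simp: carrier_cpoly_ring)
  qed
  from this[of "Poly_Mapping.keys f"] show ?thesis
    using cpoly_eq_sum_singles[of f] by simp
qed

lemma minors_indet_homog:
  assumes "f \<in> minors (Suc e) (hankel_mat d e m indet)"
  shows "homog m (Suc e) f"
proof -
  obtain r where f: "f = det (mat (Suc e) (Suc e) (\<lambda>(i, j). hval m indet (r i + j)))"
    using assms unfolding minors_hankel_mat by blast
  show ?thesis unfolding f
    by (rule homog_det[OF mat_carrier]) (auto simp: hval_def intro: homog_indet[unfolded One_nat_def])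
qed

section \<open>The ideal generated by the minors\<close>

lemma minor_ideal_ideal: "ideal (minor_ideal d e m) (cpoly_ring m)"
proof -
  interpret cring "cpoly_ring m" by (rule cring_cpoly_ring)
  show ?thesis unfolding minor_ideal_def
    by (rule genideal_ideal) (use minors_indet_homog homog_carrier in \<open>simp; blast\<close>)
qed

lemma minors_in_minor_ideal: "minors (Suc e) (hankel_mat d e m indet) \<subseteq> minor_ideal d e m"
proof -
  interpret cring "cpoly_ring m" by (rule cring_cpoly_ring)
  show ?thesis unfolding minor_ideal_def Suc_eq_plus1[symmetric]
    by (rule genideal_self) (use minors_indet_homog homog_carrier in blast)
qed

lemma ideal_cpoly_add: "ideal I (cpoly_ring m) \<Longrightarrow> f \<in> I \<Longrightarrow> g \<in> I \<Longrightarrow> f + g \<in> I"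
  using additive_subgroup.a_closed[OF ideal.axioms(1)] by fastforce

lemma ideal_cpoly_zero: "ideal I (cpoly_ring m) \<Longrightarrow> 0 \<in> I"
  using additive_subgroup.zero_closed[OF ideal.axioms(1)] by fastforce

lemma ideal_cpoly_mult: "ideal I (cpoly_ring m) \<Longrightarrow> f \<in> I \<Longrightarrow> g \<in> carrier (cpoly_ring m) \<Longrightarrow> g * f \<in> I"
  using ideal.I_l_closed by fastforce

lemma ideal_cpoly_uminus: "ideal I (cpoly_ring m) \<Longrightarrow> f \<in> I \<Longrightarrow> - f \<in> I"
  using ideal_cpoly_mult[of I m f "- 1"] carrier_uminus[OF carrier_one, of m] by simp

lemma idealI_cpoly:
  assumes "I \<subseteq> carrier (cpoly_ring m)" "0 \<in> I" "\<And>f g. f \<in> I \<Longrightarrow> g \<in> I \<Longrightarrow> f + g \<in> I"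
    and mult: "\<And>f g. f \<in> I \<Longrightarrow> g \<in> carrier (cpoly_ring m) \<Longrightarrow> g * f \<in> I"
  shows "ideal I (cpoly_ring m)"
proof -
  interpret cring "cpoly_ring m" by (rule cring_cpoly_ring)
  have "\<ominus>\<^bsub>cpoly_ring m\<^esub> f \<in> I" if "f \<in> I" for f
  proof -
    have "\<ominus>\<^bsub>cpoly_ring m\<^esub> f = - f"
      by (rule minus_equality) (use that assms(1) carrier_uminus in auto)
    thus ?thesis using mult[OF that carrier_uminus[OF carrier_one]] by simp
  qed
  hence "subgroup I (add_monoid (cpoly_ring m))"
    using assms by (intro add.subgroupI) auto
  thus ?thesis
    using mult by (intro idealI ring_axioms) (auto simp: mult.commute)
qed

context hankel begin

lemma hvar_eq_hval: "hvar = hval m indet"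
  by (simp add: fun_eq_iff hvar_def hval_def)

lemma signof_mult_mem:
  assumes "\<And>x. x \<in> S \<Longrightarrow> - x \<in> S" "x \<in> S"
  shows "(signof p * x :: cpoly) \<in> S"
  using signof_cases[of p, where 'a = cpoly] assms by auto

lemma minor_mem_straight:
  assumes "f \<in> minors (Suc e) (hankel_mat d e m indet)"
  shows "\<exists>w. f \<in> straight w"
proof -
  obtain r where r: "f = det (mat (Suc e) (Suc e) (\<lambda>(i, j). hvar (r i + j)))"
    "\<And>i j. i < j \<Longrightarrow> j < Suc e \<Longrightarrow> r i < r j" "\<And>i. i < Suc e \<Longrightarrow> r i < nrows"
    using assms unfolding minors_hankel_mat hvar_eq_hval nrows_def by blast
  have mono: "r i + (j - i) \<le> r j" if "i \<le> j" "j \<le> e" for i j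
    using that
  proof (induction j)
    case (Suc j)
    thus ?case using r(2)[of j "Suc j"] by (cases "i = Suc j") auto
  qed auto
  define \<alpha> where "\<alpha> = image_mset (\<lambda>k. r k + e - k) (mset_set {..<Suc e})"
  have "hdet hvar (Suc e) (\<lambda>k. r k + e) = hminor \<alpha>"
    unfolding \<alpha>_def by (rule hminor_mset[symmetric]) (use r(2) in auto)
  moreover have "admissible (Suc e) \<alpha>"
  proof -
    \<comment> \<open>Strict increase gives \<open>k \<le> r k\<close> and
      \<open>r k + (e - k) \<le> r e < nrows\<close>, the two ends of the admissible range.\<close>
    have "e \<le> r k + e - k \<and> r k + e - k < nrows" if "k < Suc e" for k
      using mono[of 0 k] mono[of k e] r(3)[of e] that by auto
    thus ?thesis by (auto simp: admissible_def \<alpha>_def)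
  qed
  hence "Poly_Mapping.single 0 1 * hminor \<alpha> \<in> straight (Suc (wt (0 + expo \<alpha>)))"
    by (intro straight_generator) auto
  ultimately have "hdet hvar (Suc e) (\<lambda>k. r k + e) \<in> straight (Suc (wt (expo \<alpha>)))" by simp
  moreover obtain p where "f = signof p * hdet hvar (Suc e) (\<lambda>k. r k + e)"
    using det_reverse_columns[of e hvar r] r(1) by auto
  ultimately show ?thesis
    using signof_mult_mem[of "straight (Suc (wt (expo \<alpha>)))"] straight_uminus by metis
qed

text \<open>Inverts the correspondence in \<open>minor_mem_straight\<close>: the sorted multiset
  \<open>L\<close> comes from the rows \<open>L ! k + k - e\<close>.\<close>

lemma hminor_mem_minor_ideal:
  assumes "admissible (Suc e) \<alpha>"
  shows "hminor \<alpha> \<in> minor_ideal d e m"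
proof -
  define L where "L = sorted_list_of_multiset \<alpha>"
  have L: "mset L = \<alpha>" "sorted L" by (auto simp: L_def)
  have len: "length L = Suc e" using L assms by (metis admissible_def size_mset)
  have range: "e \<le> L ! k" "L ! k < nrows" if "k \<le> e" for k
  proof -
    have "L ! k \<in># \<alpha>" using len that L(1) by (metis le_imp_less_Suc nth_mem set_mset_mset)
    thus "e \<le> L ! k" "L ! k < nrows" using assms by (auto simp: admissible_def)
  qed
  define r where "r k = L ! k + k - e" for k
  have r_less: "r i < r j" if "i < j" "j < Suc e" for i j
  proof -
    have "L ! i \<le> L ! j" using L(2) len that by (intro sorted_nth_mono) auto
    thus ?thesis using range[of i] that by (simp add: r_def)
  qed
  have r_rows: "r i < nrows" if "i < Suc e" for i
    using range[of i] that by (auto simp: r_def)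
  have "det (mat (Suc e) (Suc e) (\<lambda>(i, j). hvar (r i + j))) \<in> minors (Suc e) (hankel_mat d e m indet)"
    unfolding minors_hankel_mat hvar_eq_hval using r_less r_rows unfolding nrows_def by blast
  hence "det (mat (Suc e) (Suc e) (\<lambda>(i, j). hvar (r i + j))) \<in> minor_ideal d e m"
    using minors_in_minor_ideal by blast
  moreover obtain p where p: "det (mat (Suc e) (Suc e) (\<lambda>(i, j). hvar (r i + j))) =
      signof p * hdet hvar (Suc e) (\<lambda>i. r i + e)"
    using det_reverse_columns by blast
  moreover have "hdet hvar (Suc e) (\<lambda>i. r i + e) = hminor \<alpha>"
    unfolding hminor_def L_def[symmetric] admissible_D(1)[OF assms]
  proof (rule hdet_cong)
    fix k assume "k < Suc e"
    thus "r k + e = L ! k + k" using range(1)[of k] by (simp add: r_def)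
  qed
  moreover have "signof p * (signof p * hminor \<alpha>) = hminor \<alpha>"
    using signof_cases[of p, where 'a = cpoly] by auto
  ultimately show ?thesis
    using signof_mult_mem[of "minor_ideal d e m"] ideal_cpoly_uminus[OF minor_ideal_ideal] by metis
qed

lemma straight_subset_minor_ideal: "straight w \<subseteq> minor_ideal d e m"
proof
  fix F assume "F \<in> straight w"
  thus "F \<in> minor_ideal d e m"
    by (induction F rule: straight.induct)
       (auto intro!: ideal_cpoly_zero[OF minor_ideal_ideal] ideal_cpoly_add[OF minor_ideal_ideal]
          ideal_cpoly_mult[OF minor_ideal_ideal] hminor_mem_minor_ideal carrier_single)
qed

lemma minor_ideal_eq: "minor_ideal d e m = (\<Union>w. straight w)"
proof (intro equalityI)
  interpret cring "cpoly_ring m" by (rule cring_cpoly_ring)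
  have "ideal (\<Union>w. straight w) (cpoly_ring m)"
  proof (rule idealI_cpoly)
    show "(\<Union>w. straight w) \<subseteq> carrier (cpoly_ring m)"
      using straight_subset_minor_ideal ideal.Icarr[OF minor_ideal_ideal] by blast
  next
    fix f g assume "f \<in> (\<Union>w. straight w)" "g \<in> (\<Union>w. straight w)"
    then obtain w v where "f \<in> straight w" "g \<in> straight v" by auto
    hence "f + g \<in> straight (max w v)"
      by (intro straight_add) (auto intro: straight_mono)
    thus "f + g \<in> (\<Union>w. straight w)" by blast
  next
    fix f g assume f: "f \<in> (\<Union>w. straight w)" and g: "g \<in> carrier (cpoly_ring m)"
    then obtain w where "f \<in> straight w" by auto
    from straight_mult_carrier[OF this g] show "g * f \<in> (\<Union>w. straight w)" by simp
  qed (simp add: straight.zero)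
  thus "minor_ideal d e m \<subseteq> (\<Union>w. straight w)"
    unfolding minor_ideal_def Suc_eq_plus1[symmetric]
    by (rule genideal_minimal) (use minor_mem_straight in blast)
qed (use straight_subset_minor_ideal in blast)

section \<open>Elimination with powers of the pivot\<close>

lemma toeplitz_pivot_cancel:
  "toeplitz_pivot ^ n * f \<in> minor_ideal d e m \<Longrightarrow> f \<in> minor_ideal d e m"
proof (induction n)
  case (Suc n)
  hence "toeplitz_pivot * (toeplitz_pivot ^ n * f) \<in> minor_ideal d e m" by (simp add: mult.assoc)
  hence "toeplitz_pivot ^ n * f \<in> minor_ideal d e m"
    unfolding minor_ideal_eq using toeplitz_pivot_nonzerodivisor by blast
  thus ?case by (rule Suc.IH)
qed simp

lemma toeplitz_pivot_hdet: "toeplitz_pivot = hdet hvar e (\<lambda>k. nrows + k)"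
proof -
  have "sorted_list_of_multiset (replicate_mset e nrows) = replicate e nrows"
    by (metis mset_replicate sorted_list_of_multiset_mset sorted_replicate sorted_sort_id)
  thus ?thesis unfolding toeplitz_pivot_def hminor_def by (auto intro!: hdet_cong)
qed

lemma hvar_Toeplitz: "hvar (nrows + k - j) \<in> carrier (cpoly_ring (d + j))"
  using dem by (auto simp: hvar_def nrows_def)

lemma toeplitz_pivot_carrier_small: "toeplitz_pivot \<in> carrier (cpoly_ring (d + e))"
  unfolding toeplitz_pivot_hdet hdet_def
proof (rule carrier_det[OF mat_carrier])
  fix i j assume "i < e" "j < e"
  thus "mat e e (\<lambda>(k, j). hvar (nrows + k - j)) $$ (i, j) \<in> carrier (cpoly_ring (d + e))"
    using hvar_Toeplitz[of i j] carrier_mono[of "d + j" "d + e"] by auto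
qed

text \<open>Expanding, along its first row, the minor whose top right entry is \<open>c\<^sub>k\<close> and whose remaining rows
  are those of the pivot.\<close>

lemma toeplitz_pivot_eliminate:
  assumes "d + e < k" "k \<le> m"
  shows "\<exists>g \<in> carrier (cpoly_ring (k - 1)). toeplitz_pivot * indet k - g \<in> minor_ideal d e m"
proof -
  \<comment> \<open>Row 0 reads c_(k-e), ..., c_k; its index lies below those of the pivot rows
    because \<open>d + e < k\<close>.\<close>
  define r where "r i = (case i of 0 \<Rightarrow> m - k + e | Suc i' \<Rightarrow> nrows + i')" for i
  define A where "A = mat (Suc e) (Suc e) (\<lambda>(i, j). hvar (r i - j))"
  have A: "A \<in> carrier_mat (Suc e) (Suc e)" by (simp add: A_def)
  have r0: "m - k + e < nrows" using assms by (auto simp: nrows_def)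
  define \<alpha> where "\<alpha> = image_mset (\<lambda>k. r k - k) (mset_set {..<Suc e})"
  have "hminor \<alpha> = hdet hvar (Suc e) r"
    unfolding \<alpha>_def by (rule hminor_mset) (use r0 e_less_nrows in \<open>auto simp: r_def split: nat.splits\<close>)
  moreover have "admissible (Suc e) \<alpha>"
    using r0 e_less_nrows by (auto simp: admissible_def \<alpha>_def r_def split: nat.splits)
  ultimately have "det A \<in> minor_ideal d e m"
    using hminor_mem_minor_ideal[of \<alpha>] by (simp add: A_def hdet_def)
  moreover have "det A = (\<Sum>j<Suc e. A $$ (0, j) * cofactor A 0 j)"
    by (rule laplace_expansion_row[OF A]) simp
  moreover have "cofactor A 0 e = (-1) ^ e * toeplitz_pivot"
  proof -
    have "mat_delete A 0 e = mat e e (\<lambda>(k, j). hvar (nrows + k - j))"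
      unfolding mat_delete_def by (rule eq_matI) (auto simp: A_def r_def)
    thus ?thesis by (simp add: cofactor_def toeplitz_pivot_hdet hdet_def)
  qed
  moreover have "A $$ (0, e) = indet k" using assms by (simp add: A_def r_def hvar_def)
  ultimately have mem: "indet k * ((-1) ^ e * toeplitz_pivot) + (\<Sum>j<e. A $$ (0, j) * cofactor A 0 j) \<in> minor_ideal d e m"
    by (simp add: add.commute)
  define g where "g = (-1) ^ e * - (\<Sum>j<e. A $$ (0, j) * cofactor A 0 j)"
  have unit: "(-1) ^ n \<in> carrier (cpoly_ring l)" for n l
    by (intro carrier_power carrier_uminus carrier_one)
  have "(-1) ^ e * (indet k * ((-1) ^ e * toeplitz_pivot) + (\<Sum>j<e. A $$ (0, j) * cofactor A 0 j)) \<in> minor_ideal d e m"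
    by (rule ideal_cpoly_mult[OF minor_ideal_ideal mem unit])
  also have "(-1) ^ e * (indet k * ((-1) ^ e * toeplitz_pivot) + (\<Sum>j<e. A $$ (0, j) * cofactor A 0 j))
     = toeplitz_pivot * indet k - g"
    by (simp add: g_def distrib_left mult.left_commute[of _ "(-1) ^ e"] mult.assoc[symmetric] power_add[symmetric])
  finally have "toeplitz_pivot * indet k - g \<in> minor_ideal d e m" .
  moreover have "g \<in> carrier (cpoly_ring (k - 1))"
    unfolding g_def
  proof (intro carrier_mult carrier_uminus carrier_sum unit)
    fix j assume j: "j \<in> {..<e}"
    have "k - (e - j) \<le> k - 1" using j assms by auto
    moreover have "m - (m - k + e - j) = k - (e - j)" using j assms by auto
    ultimately show "A $$ (0, j) \<in> carrier (cpoly_ring (k - 1))"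
      using j by (simp add: A_def r_def hvar_def)
    have "mat_delete A 0 j \<in> carrier_mat e e" using A by (auto simp: mat_delete_def)
    hence "det (mat_delete A 0 j) \<in> carrier (cpoly_ring (k - 1))"
    proof (rule carrier_det)
      fix i l assume il: "i < e" "l < e"
      \<comment> \<open>Column indices stay at most \<open>e\<close> after the deletion, so the
        cofactors contain only c_0, ..., c_(d+e), all before c_k.\<close>
      define l' where "l' = (if l < j then l else Suc l)"
      have "mat_delete A 0 j $$ (i, l) = hvar (nrows + i - l')"
        using il j by (auto simp: mat_delete_def A_def r_def l'_def)
      moreover have "d + l' \<le> k - 1" using il j assms by (auto simp: l'_def)
      ultimately show "mat_delete A 0 j $$ (i, l) \<in> carrier (cpoly_ring (k - 1))"
        using hvar_Toeplitz[of i l'] carrier_mono[of "d + l'" "k - 1"] by auto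
    qed
    thus "cofactor A 0 j \<in> carrier (cpoly_ring (k - 1))"
      unfolding cofactor_def by (intro carrier_mult unit)
  qed
  ultimately show ?thesis by blast
qed

text \<open>Modulo the ideal, c_(k+1) is a fraction whose denominator is the pivot. The polynomials
  that some power of the pivot moves into the smaller ring are closed under sums and products, by
  passing to a common denominator.\<close>

lemma toeplitz_pivot_reduce_step:
  assumes "d + e \<le> k" "k < m" "f \<in> carrier (cpoly_ring (Suc k))"
  shows "\<exists>n. \<exists>g \<in> carrier (cpoly_ring k). toeplitz_pivot ^ n * f - g \<in> minor_ideal d e m"
  using assms(3)
proof (induction f rule: carrier_induct)
  case (const u)
  show ?case
    by (rule exI[of _ 0], rule bexI[of _ "Poly_Mapping.single 0 u"])
       (auto intro: ideal_cpoly_zero[OF minor_ideal_ideal] carrier_single)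
next
  case (indet i)
  show ?case
  proof (cases "i \<le> k")
    case True
    thus ?thesis
      by (intro exI[of _ 0] bexI[of _ "indet i"]) (auto intro: ideal_cpoly_zero[OF minor_ideal_ideal])
  next
    case False
    hence "i = Suc k" using indet by simp
    thus ?thesis using toeplitz_pivot_eliminate[of "Suc k"] assms
      by (intro exI[of _ 1]) auto
  qed
next
  case (add f f')
  then obtain n g n' g' where g: "g \<in> carrier (cpoly_ring k)" "toeplitz_pivot ^ n * f - g \<in> minor_ideal d e m"
    "g' \<in> carrier (cpoly_ring k)" "toeplitz_pivot ^ n' * f' - g' \<in> minor_ideal d e m" by blast
  have "toeplitz_pivot ^ n' * (toeplitz_pivot ^ n * f - g) + toeplitz_pivot ^ n * (toeplitz_pivot ^ n' * f' - g')
      \<in> minor_ideal d e m"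
    by (intro ideal_cpoly_add[OF minor_ideal_ideal] ideal_cpoly_mult[OF minor_ideal_ideal] g
        carrier_power toeplitz_pivot_carrier)
  also have "(toeplitz_pivot ^ n' * (toeplitz_pivot ^ n * f - g) + toeplitz_pivot ^ n * (toeplitz_pivot ^ n' * f' - g')) =
      toeplitz_pivot ^ (n + n') * (f + f') - (toeplitz_pivot ^ n' * g + toeplitz_pivot ^ n * g')"
    by (simp add: power_add algebra_simps)
  finally show ?case
    using g(1,3) carrier_mono[of "d + e" k] assms(1) toeplitz_pivot_carrier_small
    by (intro exI bexI[of _ "toeplitz_pivot ^ n' * g + toeplitz_pivot ^ n * g'"])
       (auto intro!: carrier_add carrier_mult carrier_power)
next
  case (mult f f')
  then obtain n g n' g' where g: "g \<in> carrier (cpoly_ring k)" "toeplitz_pivot ^ n * f - g \<in> minor_ideal d e m"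
    "g' \<in> carrier (cpoly_ring k)" "toeplitz_pivot ^ n' * f' - g' \<in> minor_ideal d e m" by blast
  have f: "f \<in> carrier (cpoly_ring m)" using mult carrier_mono[of "Suc k" m] assms by auto
  have g': "g' \<in> carrier (cpoly_ring m)" using g(3) carrier_mono[of k m] assms by auto
  have "(toeplitz_pivot ^ n * f) * (toeplitz_pivot ^ n' * f' - g') + g' * (toeplitz_pivot ^ n * f - g)
      \<in> minor_ideal d e m"
    by (intro ideal_cpoly_add[OF minor_ideal_ideal] ideal_cpoly_mult[OF minor_ideal_ideal] g
        carrier_mult f g' carrier_power toeplitz_pivot_carrier)
  also have "(toeplitz_pivot ^ n * f) * (toeplitz_pivot ^ n' * f' - g') + g' * (toeplitz_pivot ^ n * f - g) =
      toeplitz_pivot ^ (n + n') * (f * f') - g * g'"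
    by (simp add: power_add algebra_simps)
  finally show ?case using g(1,3) by (blast intro: carrier_mult)
qed

lemma toeplitz_pivot_reduce:
  assumes "d + e \<le> k" "k \<le> m" "f \<in> carrier (cpoly_ring k)"
  shows "\<exists>n. \<exists>g \<in> carrier (cpoly_ring (d + e)). toeplitz_pivot ^ n * f - g \<in> minor_ideal d e m"
  using assms
proof (induction k arbitrary: f rule: dec_induct)
  case base
  thus ?case
    by (intro exI[of _ 0] bexI[of _ f]) (auto intro: ideal_cpoly_zero[OF minor_ideal_ideal])
next
  case (step k)
  obtain n g where g: "g \<in> carrier (cpoly_ring k)" "toeplitz_pivot ^ n * f - g \<in> minor_ideal d e m"
    using toeplitz_pivot_reduce_step[of k f] step by auto
  obtain n' g' where g': "g' \<in> carrier (cpoly_ring (d + e))" "toeplitz_pivot ^ n' * g - g' \<in> minor_ideal d e m"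
    using step.IH[OF _ g(1)] step by auto
  have "toeplitz_pivot ^ n' * (toeplitz_pivot ^ n * f - g) + (toeplitz_pivot ^ n' * g - g') \<in> minor_ideal d e m"
    by (intro ideal_cpoly_add[OF minor_ideal_ideal] ideal_cpoly_mult[OF minor_ideal_ideal] g g'
        carrier_power toeplitz_pivot_carrier)
  also have "toeplitz_pivot ^ n' * (toeplitz_pivot ^ n * f - g) + (toeplitz_pivot ^ n' * g - g') =
      toeplitz_pivot ^ (n + n') * f - g'" by (simp add: power_add algebra_simps)
  finally show ?case using g'(1) by blast
qed

end


section \<open>Expansions of rational functions\<close>

text \<open>The identity Q F = P coefficient by coefficient, with \<open>c\<close> the full Taylor
  series. Truncation happens only in \<open>proj_series\<close>, so one set serves all
  \<open>m\<close>.\<close>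

definition rational_series :: "nat \<Rightarrow> nat \<Rightarrow> (nat \<Rightarrow> complex) set" where
  "rational_series d e = {c. \<exists>p q. p 0 = 1 \<and> q 0 = 1 \<and> (\<forall>i>d. p i = 0) \<and> (\<forall>i>e. q i = 0) \<and>
     (\<forall>k. (\<Sum>j\<le>k. q j * c (k - j)) = p k)}"

definition proj_series :: "nat \<Rightarrow> (nat \<Rightarrow> complex) \<Rightarrow> complex poly set" where
  "proj_series m c = proj_point (truncate_fps (Suc m) (Abs_fps c))"

lemma poly_has_fps_expansion: "poly P has_fps_expansion fps_of_poly (P :: complex poly)"
proof (induction P)
  case (pCons a P)
  have "(\<lambda>x. a + x * poly P x) has_fps_expansion (fps_const a + fps_X * fps_of_poly P)"
    by (intro fps_expansion_intros pCons.IH)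
  thus ?case by (simp add: fps_of_poly_pCons mult.commute)
qed simp

lemma fps_expansion_rational:
  fixes P Q :: "complex poly"
  assumes "poly Q 0 \<noteq> 0"
  shows "fps_of_poly Q * fps_expansion (\<lambda>x. poly P x / poly Q x) 0 = fps_of_poly P"
proof -
  have Q0: "fps_nth (fps_of_poly Q) 0 \<noteq> 0" using assms by (simp add: poly_0_coeff_0)
  have "fps_expansion (\<lambda>x. poly P x / poly Q x) 0 = fps_of_poly P / fps_of_poly Q"
    by (intro fps_expansion_eqI has_fps_expansion_divide' poly_has_fps_expansion Q0)
  thus ?thesis using Q0 by (simp add: fps_divide_unit mult.left_commute[of _ "fps_of_poly P"] inverse_mult_eq_1')
qed

lemma fps_nth_mult_atMost: "fps_nth (F * G) k = (\<Sum>j\<le>k. fps_nth F j * fps_nth G (k - j))"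
  by (simp add: fps_mult_nth atLeast0AtMost)

lemma taylor_generators:
  "{proj_point (taylor_poly m (\<lambda>x. poly P x / poly Q x)) | P Q.
      Polynomial.degree P \<le> d \<and> Polynomial.degree Q \<le> e \<and> poly P 0 = 1 \<and> poly Q 0 = 1} =
   proj_series m ` rational_series d e" (is "?L = ?R")
proof (intro equalityI subsetI)
  fix X assume "X \<in> ?L"
  then obtain P Q where PQ: "X = proj_point (taylor_poly m (\<lambda>x. poly P x / poly Q x))"
    "Polynomial.degree P \<le> d" "Polynomial.degree Q \<le> e" "poly P 0 = 1" "poly Q 0 = 1" by blast
  define F where "F = fps_expansion (\<lambda>x. poly P x / poly Q x) 0"
  have F: "fps_of_poly Q * F = fps_of_poly P"
    unfolding F_def by (rule fps_expansion_rational) (use PQ in simp)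
  have "(\<Sum>j\<le>k. Polynomial.coeff Q j * fps_nth F (k - j)) = Polynomial.coeff P k" for k
    using arg_cong[OF F, of "\<lambda>F. fps_nth F k"] by (simp add: fps_nth_mult_atMost)
  hence "fps_nth F \<in> rational_series d e"
    unfolding rational_series_def using PQ
    by (intro CollectI exI[of _ "Polynomial.coeff P"] exI[of _ "Polynomial.coeff Q"])
       (auto simp: poly_0_coeff_0 coeff_eq_0)
  moreover have "X = proj_series m (fps_nth F)"
    by (simp add: PQ(1) proj_series_def taylor_poly_def F_def fps_nth_inverse)
  ultimately show "X \<in> ?R" by blast
next
  fix X assume "X \<in> ?R"
  then obtain c p q where c: "X = proj_series m c" "p 0 = 1" "q 0 = 1" "\<And>i. i > d \<Longrightarrow> p i = 0"
    "\<And>i. i > e \<Longrightarrow> q i = 0" "\<And>k. (\<Sum>j\<le>k. q j * c (k - j)) = p k"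
    by (auto simp: rational_series_def)
  define P where "P = truncate_fps (Suc d) (Abs_fps p)"
  define Q where "Q = truncate_fps (Suc e) (Abs_fps q)"
  have coP: "Polynomial.coeff P i = p i" and coQ: "Polynomial.coeff Q i = q i" for i
    using c(4,5) by (auto simp: P_def Q_def coeff_truncate_fps)
  have Q0: "poly Q 0 = 1" and P0: "poly P 0 = 1" by (simp_all add: poly_0_coeff_0 coP coQ c)
  have "fps_of_poly Q * Abs_fps c = fps_of_poly P"
    by (rule fps_ext) (simp add: fps_nth_mult_atMost coP coQ c(6))
  moreover have "fps_of_poly Q * fps_expansion (\<lambda>x. poly P x / poly Q x) 0 = fps_of_poly P"
    by (rule fps_expansion_rational) (use Q0 in simp)
  moreover have "fps_of_poly Q \<noteq> 0" using Q0 by auto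
  ultimately have "fps_expansion (\<lambda>x. poly P x / poly Q x) 0 = Abs_fps c"
    by (metis mult_left_cancel)
  hence "X = proj_point (taylor_poly m (\<lambda>x. poly P x / poly Q x))"
    by (simp add: c(1) proj_series_def taylor_poly_def)
  moreover have "Polynomial.degree P \<le> d" "Polynomial.degree Q \<le> e"
    by (auto intro!: degree_le simp: coP coQ c)
  ultimately show "X \<in> ?L" using P0 Q0 by blast
qed

lemma rational_series_0:
  assumes "c \<in> rational_series d e"
  shows "c 0 = 1"
proof -
  obtain p q where "p 0 = 1" "q 0 = 1" "\<And>k. (\<Sum>j\<le>k. q j * c (k - j)) = (p k :: complex)"
    using assms by (auto simp: rational_series_def)
  from this(3)[of 0] this(1,2) show ?thesis by simp
qed

lemma rational_series_mono: "d \<le> d' \<Longrightarrow> e \<le> e' \<Longrightarrow> rational_series d e \<subseteq> rational_series d' e'"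
proof
  fix c assume le: "d \<le> d'" "e \<le> e'" and "c \<in> rational_series d e"
  then obtain p q where "p 0 = 1" "q 0 = 1" "\<And>i. i > d \<Longrightarrow> p i = 0" "\<And>i. i > e \<Longrightarrow> q i = 0"
    "\<And>k. (\<Sum>j\<le>k. q j * c (k - j)) = (p k :: complex)"
    by (auto simp: rational_series_def)
  thus "c \<in> rational_series d' e'"
    unfolding rational_series_def using le by (intro CollectI exI[of _ p] exI[of _ q]) auto
qed

text \<open>\<open>toeplitz d e\<close> is the determinant of \<open>toeplitz_pivot\<close>,
  available for all \<open>d\<close>, \<open>e\<close> and over any commutative ring. If
  \<open>d + e < m\<close>, then \<open>toeplitz (Suc d) (Suc e)\<close> is up to sign the minor of
  the last \<open>e + 1\<close> rows of the Hankel matrix.\<close>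

definition toeplitz :: "nat \<Rightarrow> nat \<Rightarrow> (nat \<Rightarrow> 'a) \<Rightarrow> 'a :: comm_ring_1" where
  "toeplitz d N c = det (mat N N (\<lambda>(k, j). if k \<le> d + j then c (d + j - k) else 0))"

lemma cpoly_eval_toeplitz: "cpoly_eval c (toeplitz d N indet) = toeplitz d N c"
  unfolding toeplitz_def cpoly_eval_det by (intro arg_cong[where f = det] eq_matI) auto

lemma homog_toeplitz: "d + N \<le> Suc m \<Longrightarrow> homog m N (toeplitz d N indet)"
  unfolding toeplitz_def
  by (rule homog_det[OF mat_carrier]) (auto intro: homog_indet[unfolded One_nat_def])

text \<open>At c_d = 1 with all other coordinates 0 the matrix is the identity.\<close>

lemma toeplitz_indet_nonzero: "toeplitz d N indet \<noteq> 0"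
proof
  assume "toeplitz d N indet = 0"
  hence "toeplitz d N (\<lambda>i. if i = d then 1 else 0 :: complex) = 0"
    using cpoly_eval_toeplitz[of "\<lambda>i. if i = d then 1 else 0" d N] by simp
  moreover have "toeplitz d N (\<lambda>i. if i = d then 1 else 0 :: complex) = det (1\<^sub>m N)"
    unfolding toeplitz_def by (intro arg_cong[where f = det] eq_matI) auto
  ultimately show False by simp
qed

lemma toeplitz_system:
  fixes c :: "nat \<Rightarrow> complex"
  assumes "toeplitz d N c \<noteq> 0"
  shows "\<exists>x. \<forall>j<N. (\<Sum>k<N. x k * (if k \<le> d + j then c (d + j - k) else 0)) = b j"
proof -
  define M where "M = mat N N (\<lambda>(k, j). if k \<le> d + j then c (d + j - k) else 0)"
  have M: "M \<in> carrier_mat N N" by (simp add: M_def)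
  have D: "det M \<noteq> 0" using assms by (simp add: toeplitz_def M_def)
  note adj = adj_mat[OF M]
  \<comment> \<open>Cramer's rule for a row vector: \<open>x\<close> is \<open>b\<close> times the
    adjugate, divided by the determinant.\<close>
  define x where "x k = inverse (det M) * (\<Sum>i<N. b i * adj_mat M $$ (i, k))" for k
  have "(\<Sum>k<N. x k * M $$ (k, j)) = b j" if j: "j < N" for j
  proof -
    have *: "(\<Sum>k<N. adj_mat M $$ (i, k) * M $$ (k, j)) = (if i = j then det M else 0)" if "i < N" for i
    proof -
      have "(adj_mat M * M) $$ (i, j) = (\<Sum>k<N. adj_mat M $$ (i, k) * M $$ (k, j))"
        using M adj(1) that j by (simp add: scalar_prod_def atLeast0LessThan)
      moreover have "(adj_mat M * M) $$ (i, j) = (if i = j then det M else 0)"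
        unfolding adj(3) using that j by simp
      ultimately show ?thesis by (rule trans[OF sym])
    qed
    have "(\<Sum>k<N. x k * M $$ (k, j)) =
        inverse (det M) * (\<Sum>k<N. \<Sum>i<N. b i * (adj_mat M $$ (i, k) * M $$ (k, j)))"
      by (simp add: x_def sum_distrib_left sum_distrib_right mult.assoc)
    also have "\<dots> = inverse (det M) * (\<Sum>i<N. b i * (\<Sum>k<N. adj_mat M $$ (i, k) * M $$ (k, j)))"
      by (subst sum.swap) (simp add: sum_distrib_left)
    also have "\<dots> = inverse (det M) * (\<Sum>i<N. if i = j then b i * det M else 0)"
      by (intro arg_cong2[where f = "(*)"] refl sum.cong) (auto simp: *)
    also have "\<dots> = b j" using j D by simp
    finally show ?thesis .
  qed
  hence "\<forall>j<N. (\<Sum>k<N. x k * (if k \<le> d + j then c (d + j - k) else 0)) = b j"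
    by (simp add: M_def)
  thus ?thesis by blast
qed

text \<open>The coefficients of the denominator solve the Toeplitz system expressing that the coefficients with
  indices \<open>d + 1, \<dots>, d + e\<close> of the numerator vanish.\<close>

lemma rational_series_interpolate:
  assumes "c 0 = 1" "toeplitz d e c \<noteq> 0"
  shows "\<exists>c'\<in>rational_series d e. \<forall>i\<le>d + e. c' i = c i"
proof -
  obtain x where x: "\<And>j. j < e \<Longrightarrow> (\<Sum>k<e. x k * (if k \<le> d + j then c (d + j - k) else 0)) = - c (d + Suc j)"
    using toeplitz_system[OF assms(2), of "\<lambda>j. - c (d + Suc j)"] by blast
  define q where "q i = (case i of 0 \<Rightarrow> 1 | Suc k \<Rightarrow> if k < e then x k else 0)" for i
  define p where "p k = (if k \<le> d then \<Sum>j\<le>k. q j * c (k - j) else 0)" for k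
  \<comment> \<open>The formal quotient continues the prescribed values beyond index
    \<open>d + e\<close>; up to there \<open>F\<close> and \<open>c\<close> obey the same recursion,
    which determines them because \<open>q 0 = 1\<close>.\<close>
  define F where "F = Abs_fps p * inverse (Abs_fps q)"
  have q0: "q 0 = 1" by (simp add: q_def)
  have qF: "Abs_fps q * F = Abs_fps p"
    using q0 by (simp add: F_def mult.left_commute[of _ "Abs_fps p"] inverse_mult_eq_1')
  have F: "(\<Sum>j\<le>k. q j * fps_nth F (k - j)) = p k" for k
    using arg_cong[OF qF, of "\<lambda>F. fps_nth F k"] by (simp add: fps_nth_mult_atMost)
  have c: "(\<Sum>j\<le>k. q j * c (k - j)) = p k" if "k \<le> d + e" for k
  proof (cases "k \<le> d")
    case False
    define j where "j = k - Suc d"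
    have k: "k = d + Suc j" "j < e" using False that by (auto simp: j_def)
    have "(\<Sum>i\<le>k. q i * c (k - i)) = c k + (\<Sum>i<k. q (Suc i) * c (k - Suc i))"
      by (simp add: q0 sum.atMost_shift)
    also have "(\<Sum>i<k. q (Suc i) * c (k - Suc i)) = (\<Sum>i<k + e. if i < k \<and> i < e then x i * c (k - Suc i) else 0)"
      by (rule sum.mono_neutral_cong_left) (auto simp: q_def)
    also have "\<dots> = (\<Sum>i<e. x i * (if i \<le> d + j then c (d + j - i) else 0))"
      by (rule sum.mono_neutral_cong_right) (auto simp: k)
    also have "\<dots> = - c k" using x[OF k(2)] k(1) by simp
    finally show ?thesis using False by (simp add: p_def)
  qed (simp add: p_def)
  have "fps_nth F k = c k" if "k \<le> d + e" for k
    using that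
  proof (induction k rule: less_induct)
    case (less k)
    have "(\<Sum>j\<le>k. q j * fps_nth F (k - j)) = (\<Sum>j\<le>k. q j * c (k - j))"
      using F c[OF less.prems] by simp
    hence "fps_nth F k + (\<Sum>j<k. q (Suc j) * fps_nth F (k - Suc j)) = c k + (\<Sum>j<k. q (Suc j) * c (k - Suc j))"
      by (simp add: sum.atMost_shift q0)
    moreover have "(\<Sum>j<k. q (Suc j) * fps_nth F (k - Suc j)) = (\<Sum>j<k. q (Suc j) * c (k - Suc j))"
      using less by (intro sum.cong) auto
    ultimately show ?case by simp
  qed
  moreover have "fps_nth F \<in> rational_series d e"
    unfolding rational_series_def
  proof (intro CollectI exI conjI allI impI)
    show "p 0 = 1" using assms(1) by (simp add: p_def q0)
    show "(\<Sum>j\<le>k. q j * fps_nth F (k - j)) = p k" for k by (rule F)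
  qed (auto simp: q_def p_def split: nat.splits)
  ultimately show ?thesis by blast
qed

text \<open>The factor \<open>u\<close> sweeps out the affine cone over the Taylor polynomials, so
  inhomogeneous polynomials are covered too and the set is a full vanishing ideal.\<close>

definition cone_ideal :: "nat \<Rightarrow> nat \<Rightarrow> nat \<Rightarrow> cpoly set" where
  "cone_ideal d e m = {f \<in> carrier (cpoly_ring m).
     \<forall>c\<in>rational_series d e. \<forall>u. cpoly_eval (\<lambda>i. u * c i) f = 0}"

lemma ideal_cone_ideal: "ideal (cone_ideal d e m) (cpoly_ring m)"
  by (rule idealI_cpoly) (auto simp: cone_ideal_def cpoly_eval_add cpoly_eval_mult carrier_add carrier_mult)

text \<open>The factor \<open>indet 0 * toeplitz d e indet\<close> makes the product vanish also at
  the points that cannot be interpolated; elsewhere, dividing by \<open>c 0\<close> reduces to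
  constant term 1. As the polynomial ring has no zero divisors, the factor can be removed.\<close>

lemma cone_ideal_dense:
  assumes "g \<in> cone_ideal d e m" "g \<in> carrier (cpoly_ring (d + e))"
  shows "g = 0"
proof -
  have "cpoly_eval c (indet 0 * toeplitz d e indet * g) = 0" for c
  proof (cases "c 0 = 0 \<or> toeplitz d e c = 0")
    case False
    define c1 where "c1 i = c i / c 0" for i
    have cc1: "c = (\<lambda>i. c 0 * c1 i)" using False by (simp add: c1_def fun_eq_iff)
    have "toeplitz d e c = c 0 ^ e * toeplitz d e c1"
      using homog_scale_eval[OF homog_toeplitz[of d e "d + e"], of "c 0" c1]
      unfolding cpoly_eval_toeplitz cc1[symmetric] by simp
    hence "toeplitz d e c1 \<noteq> 0" using False by auto
    moreover have "c1 0 = 1" using False by (simp add: c1_def)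
    ultimately obtain c' where c': "c' \<in> rational_series d e" "\<And>i. i \<le> d + e \<Longrightarrow> c' i = c1 i"
      using rational_series_interpolate[of c1 d e] by blast
    have "cpoly_eval c g = cpoly_eval (\<lambda>i. c 0 * c' i) g"
      by (rule cpoly_eval_cong[OF assms(2)]) (use False in \<open>simp add: c'(2) c1_def\<close>)
    also have "\<dots> = 0" using assms(1) c'(1) by (simp add: cone_ideal_def)
    finally show ?thesis by (simp add: cpoly_eval_mult)
  qed (auto simp: cpoly_eval_mult cpoly_eval_toeplitz)
  hence "indet 0 * toeplitz d e indet * g = 0" by (rule cpoly_eqI_eval)
  moreover have "indet 0 \<noteq> 0"
    using cpoly_eval_indet[of "\<lambda>_. 1" 0] by (metis cpoly_eval_zero zero_neq_one)
  ultimately show ?thesis using toeplitz_indet_nonzero[of d e] by simp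
qed

lemma cone_ideal_full: "d + e = m \<Longrightarrow> cone_ideal d e m = {0}"
  using cone_ideal_dense[of _ d e m] ideal_cpoly_zero[OF ideal_cone_ideal]
  by (auto simp: cone_ideal_def)

section \<open>Determinants that vanish on rational functions\<close>

lemma det_eq_0_kernel:
  fixes M :: "complex mat"
  assumes "M \<in> carrier_mat n n" "k < n" "x k \<noteq> 0" "\<And>i. i < n \<Longrightarrow> (\<Sum>j<n. M $$ (i, j) * x j) = 0"
  shows "det M = 0"
proof -
  have "vec n x \<noteq> 0\<^sub>v n" using assms(2,3) by (auto simp: vec_eq_iff)
  moreover have "M *\<^sub>v vec n x = 0\<^sub>v n"
    by (rule eq_vecI) (use assms(1,4) in \<open>auto simp: scalar_prod_def atLeast0LessThan\<close>)
  ultimately show ?thesis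
    unfolding det_0_iff_vec_prod_zero[OF assms(1)] using vec_carrier by blast
qed

text \<open>Provides the kernel vector of the Hankel matrix: the denominator coefficients annihilate
  c_k, ..., c_(k-e) for every \<open>k > d\<close>, and \<open>q 0 = 1\<close> keeps the vector
  nonzero.\<close>

lemma rational_series_relation:
  assumes "c \<in> rational_series d e"
  shows "\<exists>q. q 0 = 1 \<and> (\<forall>k>d. (\<Sum>j<Suc e. q j * (if j \<le> k then c (k - j) else 0)) = 0)"
proof -
  obtain p q where pq: "q 0 = 1" "\<And>i. i > d \<Longrightarrow> p i = 0"
    "\<And>i. i > e \<Longrightarrow> q i = 0" "\<And>k. (\<Sum>j\<le>k. q j * c (k - j)) = p k"
    using assms by (auto simp: rational_series_def)
  have "(\<Sum>j<Suc e. q j * (if j \<le> k then c (k - j) else 0)) = 0" if "d < k" for k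
  proof -
    have "(\<Sum>j<Suc e. q j * (if j \<le> k then c (k - j) else 0)) =
        (\<Sum>j<Suc e + k. q j * (if j \<le> k then c (k - j) else 0))"
      by (rule sum.mono_neutral_left) (auto simp: pq(3))
    also have "\<dots> = (\<Sum>j\<le>k. q j * c (k - j))"
      by (rule sum.mono_neutral_cong_right) auto
    finally show ?thesis using pq(2,4) that by simp
  qed
  thus ?thesis using pq(1) by blast
qed

lemma minors_vanish_rational_series:
  assumes "c \<in> rational_series d e" "f \<in> minors (Suc e) (hankel_mat d e m indet)"
  shows "cpoly_eval c f = 0"
proof -
  obtain q where q: "q 0 = 1" "\<And>k. d < k \<Longrightarrow> (\<Sum>j<Suc e. q j * (if j \<le> k then c (k - j) else 0)) = 0"
    using rational_series_relation[OF assms(1)] by blast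
  obtain r where r: "f = det (mat (Suc e) (Suc e) (\<lambda>(i, j). hval m indet (r i + j)))"
    "\<And>i. i < Suc e \<Longrightarrow> r i < m - d"
    using assms(2) unfolding minors_hankel_mat by blast
  define M where "M = mat (Suc e) (Suc e) (\<lambda>(i, j). hval m c (r i + j))"
  have "cpoly_eval c f = det M"
    unfolding r(1) cpoly_eval_det M_def by (intro arg_cong[where f = det] eq_matI) (auto simp: hval_def)
  also have "det M = 0"
  proof (rule det_eq_0_kernel[of _ _ 0 q])
    fix i assume i: "i < Suc e"
    have "(\<Sum>j<Suc e. M $$ (i, j) * q j) = (\<Sum>j<Suc e. q j * (if j \<le> m - r i then c (m - r i - j) else 0))"
      using r(2)[OF i] i by (intro sum.cong) (auto simp: M_def hval_def)
    also have "\<dots> = 0" by (rule q(2)) (use r(2)[OF i] in simp)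
    finally show "(\<Sum>j<Suc e. M $$ (i, j) * q j) = 0" .
  qed (use q(1) in \<open>auto simp: M_def\<close>)
  finally show ?thesis .
qed

lemma toeplitz_vanish_rational_series:
  assumes "c \<in> rational_series d e"
  shows "toeplitz (Suc d) (Suc e) c = 0"
proof -
  obtain q where q: "q 0 = 1" "\<And>k. d < k \<Longrightarrow> (\<Sum>j<Suc e. q j * (if j \<le> k then c (k - j) else 0)) = 0"
    using rational_series_relation[OF assms] by blast
  define M where "M = mat (Suc e) (Suc e) (\<lambda>(k, j). if k \<le> Suc d + j then c (Suc d + j - k) else 0)"
  have "det (transpose_mat M) = 0"
  proof (rule det_eq_0_kernel[of _ _ 0 q])
    fix i assume i: "i < Suc e"
    have "(\<Sum>j<Suc e. transpose_mat M $$ (i, j) * q j) =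
        (\<Sum>j<Suc e. q j * (if j \<le> Suc d + i then c (Suc d + i - j) else 0))"
      using i by (intro sum.cong) (auto simp: M_def)
    also have "\<dots> = 0" by (rule q(2)) simp
    finally show "(\<Sum>j<Suc e. transpose_mat M $$ (i, j) * q j) = 0" .
  qed (use q(1) in \<open>auto simp: M_def\<close>)
  thus ?thesis
    by (subst (asm) det_transpose[of _ "Suc e"]) (auto simp: M_def toeplitz_def)
qed

lemma cone_ideal_homog:
  assumes "homog m k f"
  shows "f \<in> cone_ideal d e m \<longleftrightarrow> (\<forall>c\<in>rational_series d e. cpoly_eval c f = 0)"
proof
  assume "f \<in> cone_ideal d e m"
  thus "\<forall>c\<in>rational_series d e. cpoly_eval c f = 0"
    unfolding cone_ideal_def by (auto dest!: bspec spec[of _ 1])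
qed (use assms homog_carrier in \<open>auto simp: cone_ideal_def homog_scale_eval[OF assms]\<close>)

lemma minors_subset_cone_ideal: "minors (Suc e) (hankel_mat d e m indet) \<subseteq> cone_ideal d e m"
  using minors_vanish_rational_series cone_ideal_homog[OF minors_indet_homog] by blast

lemma minor_ideal_subset: "minor_ideal d e m \<subseteq> cone_ideal d e m"
proof -
  interpret cring "cpoly_ring m" by (rule cring_cpoly_ring)
  show ?thesis
    unfolding minor_ideal_def Suc_eq_plus1[symmetric]
    by (rule genideal_minimal[OF ideal_cone_ideal minors_subset_cone_ideal])
qed

text \<open>The remainder \<open>g\<close> of the elimination lies in the cone ideal and involves
  only c_0, ..., c_(d+e), so it is zero; hence a power of the pivot times \<open>f\<close> lies in
  the ideal of minors, and the power can be cancelled.\<close>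

lemma (in hankel) cone_ideal_eq_minor_ideal: "cone_ideal d e m = minor_ideal d e m"
proof (intro equalityI subsetI)
  fix f assume f: "f \<in> cone_ideal d e m"
  hence "f \<in> carrier (cpoly_ring m)" by (simp add: cone_ideal_def)
  then obtain n g where g: "g \<in> carrier (cpoly_ring (d + e))"
    "toeplitz_pivot ^ n * f - g \<in> minor_ideal d e m"
    using toeplitz_pivot_reduce[of m f] dem by auto
  have "toeplitz_pivot ^ n * f + - (toeplitz_pivot ^ n * f - g) \<in> cone_ideal d e m"
    using g(2) minor_ideal_subset f
    by (intro ideal_cpoly_add[OF ideal_cone_ideal] ideal_cpoly_uminus[OF ideal_cone_ideal]
        ideal_cpoly_mult[OF ideal_cone_ideal] carrier_power toeplitz_pivot_carrier) auto
  hence "g = 0" using cone_ideal_dense[OF _ g(1)] by simp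
  thus "f \<in> minor_ideal d e m" using g(2) toeplitz_pivot_cancel by simp
qed (use minor_ideal_subset in blast)


section \<open>The ideal and irreducibility of the Taylor variety\<close>

definition cpoly_subst :: "(nat \<Rightarrow> cpoly) \<Rightarrow> cpoly \<Rightarrow> cpoly" where
  "cpoly_subst \<tau> f = (\<Sum>a\<in>Poly_Mapping.keys f. Poly_Mapping.single 0 (Poly_Mapping.lookup f a) *
     (\<Prod>i\<in>Poly_Mapping.keys a. \<tau> i ^ Poly_Mapping.lookup a i))"

lemma cpoly_eval_subst: "cpoly_eval y (cpoly_subst \<tau> f) = cpoly_eval (\<lambda>i. cpoly_eval y (\<tau> i)) f"
  by (simp add: cpoly_subst_def cpoly_eval_sum cpoly_eval_mult cpoly_eval_prod cpoly_eval_power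
      cpoly_eval_def[of "\<lambda>i. cpoly_eval y (\<tau> i)"])

text \<open>All parameters share one ring: indices 1 to \<open>d\<close> are for the numerator,
  \<open>d + 1\<close> to \<open>d + e\<close> for the denominator, and 0 is reserved for the
  scaling factor of the cone.\<close>

definition numer :: "nat \<Rightarrow> nat \<Rightarrow> cpoly" where
  "numer d i = (if i = 0 then 1 else if i \<le> d then indet i else 0)"

definition denom :: "nat \<Rightarrow> nat \<Rightarrow> nat \<Rightarrow> cpoly" where
  "denom d e i = (if i = 0 then 1 else if i \<le> e then indet (d + i) else 0)"

text \<open>The recursion that solves Q F = P for the coefficients of F. As Q(0) = 1, no division
  occurs and they are polynomials in the parameters.\<close>

fun taylor_coeff :: "nat \<Rightarrow> nat \<Rightarrow> nat \<Rightarrow> cpoly" where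
  "taylor_coeff d e k = numer d k - (\<Sum>j<k. denom d e (k - j) * taylor_coeff d e j)"

declare taylor_coeff.simps [simp del]

lemma sum_atMost_convolution:
  fixes q c :: "nat \<Rightarrow> 'a :: comm_ring_1"
  shows "(\<Sum>j\<le>k. q j * c (k - j)) = q 0 * c k + (\<Sum>j<k. q (k - j) * c j)"
proof -
  have "(\<Sum>j\<le>k. q j * c (k - j)) = (\<Sum>j\<le>k. q (k - j) * c j)"
    by (rule sum.reindex_bij_witness[of _ "\<lambda>j. k - j" "\<lambda>j. k - j"]) auto
  also have "\<dots> = q 0 * c k + (\<Sum>j<k. q (k - j) * c j)"
    by (simp add: lessThan_Suc_atMost[symmetric] add.commute)
  finally show ?thesis .
qed

lemma taylor_coeff_rational: "(\<lambda>k. cpoly_eval y (taylor_coeff d e k)) \<in> rational_series d e"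
  unfolding rational_series_def
proof (intro CollectI exI conjI allI impI)
  fix k
  show "(\<Sum>j\<le>k. cpoly_eval y (denom d e j) * cpoly_eval y (taylor_coeff d e (k - j))) = cpoly_eval y (numer d k)"
  proof -
    have "cpoly_eval y (taylor_coeff d e k) = cpoly_eval y (numer d k) -
        (\<Sum>j<k. cpoly_eval y (denom d e (k - j)) * cpoly_eval y (taylor_coeff d e j))"
      by (subst taylor_coeff.simps) (simp add: cpoly_eval_diff cpoly_eval_sum cpoly_eval_mult)
    moreover have "denom d e 0 = 1" by (simp add: denom_def)
    ultimately show ?thesis
      using sum_atMost_convolution[of "\<lambda>j. cpoly_eval y (denom d e j)"
          "\<lambda>j. cpoly_eval y (taylor_coeff d e j)" k] by simp
  qed
qed (auto simp: numer_def denom_def)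

lemma rational_series_taylor_coeff:
  assumes "c \<in> rational_series d e"
  shows "\<exists>y. y 0 = u \<and> c = (\<lambda>k. cpoly_eval y (taylor_coeff d e k))"
proof -
  obtain p q where pq: "p 0 = 1" "q 0 = 1" "\<And>i. i > d \<Longrightarrow> p i = 0" "\<And>i. i > e \<Longrightarrow> q i = 0"
    "\<And>k. (\<Sum>j\<le>k. q j * c (k - j)) = p k"
    using assms by (auto simp: rational_series_def)
  define y where "y i = (if i = 0 then u else if i \<le> d then p i else q (i - d))" for i
  have p: "cpoly_eval y (numer d i) = p i" and q: "cpoly_eval y (denom d e i) = q i" for i
    using pq(1-4) by (auto simp: numer_def denom_def y_def)
  have "c k = cpoly_eval y (taylor_coeff d e k)" for k
  proof (induction k rule: less_induct)
    case (less k)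
    have "c k + (\<Sum>j<k. q (k - j) * c j) = p k"
      using pq(5)[of k] unfolding sum_atMost_convolution by (simp add: pq)
    moreover have "(\<Sum>j<k. q (k - j) * c j) = (\<Sum>j<k. q (k - j) * cpoly_eval y (taylor_coeff d e j))"
      using less by (intro sum.cong) auto
    ultimately show ?case
      by (subst taylor_coeff.simps) (simp add: cpoly_eval_diff cpoly_eval_sum cpoly_eval_mult p q eq_diff_eq)
  qed
  thus ?thesis by (intro exI[of _ y]) (auto simp: y_def)
qed

text \<open>Presents the ideal as the kernel of a substitution into a ring without zero divisors,
  which makes it prime; \<open>indet 0\<close> plays the role of \<open>u\<close>.\<close>

lemma cone_ideal_iff_subst:
  "f \<in> cone_ideal d e m \<longleftrightarrow> f \<in> carrier (cpoly_ring m) \<and>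
     cpoly_subst (\<lambda>k. indet 0 * taylor_coeff d e k) f = 0"
proof -
  have "(\<forall>c\<in>rational_series d e. \<forall>u. cpoly_eval (\<lambda>i. u * c i) f = 0) \<longleftrightarrow>
      (\<forall>y. cpoly_eval y (cpoly_subst (\<lambda>k. indet 0 * taylor_coeff d e k) f) = 0)"
    unfolding cpoly_eval_subst cpoly_eval_mult cpoly_eval_indet
  proof (intro iffI allI ballI)
    fix c u assume *: "\<forall>y. cpoly_eval (\<lambda>i. y 0 * cpoly_eval y (taylor_coeff d e i)) f = 0"
      and "c \<in> rational_series d e"
    then obtain y where "y 0 = u" "c = (\<lambda>k. cpoly_eval y (taylor_coeff d e k))"
      using rational_series_taylor_coeff by blast
    thus "cpoly_eval (\<lambda>i. u * c i) f = 0" using * by auto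
  next
    fix y assume *: "\<forall>c\<in>rational_series d e. \<forall>u. cpoly_eval (\<lambda>i. u * c i) f = 0"
    from bspec[OF * taylor_coeff_rational[of y d e]]
    show "cpoly_eval (\<lambda>i. y 0 * cpoly_eval y (taylor_coeff d e i)) f = 0" by (rule spec)
  qed
  also have "\<dots> \<longleftrightarrow> cpoly_subst (\<lambda>k. indet 0 * taylor_coeff d e k) f = 0"
    using cpoly_eqI_eval by auto
  finally show ?thesis by (simp add: cone_ideal_def)
qed

lemma cpoly_subst_mult: "cpoly_subst \<tau> (f * g) = cpoly_subst \<tau> f * cpoly_subst \<tau> g"
proof -
  have "cpoly_subst \<tau> (f * g) - cpoly_subst \<tau> f * cpoly_subst \<tau> g = 0"
    by (rule cpoly_eqI_eval) (simp add: cpoly_eval_diff cpoly_eval_mult cpoly_eval_subst)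
  thus ?thesis by simp
qed

lemma cone_ideal_prime:
  assumes "f \<in> carrier (cpoly_ring m)" "g \<in> carrier (cpoly_ring m)" "f * g \<in> cone_ideal d e m"
  shows "f \<in> cone_ideal d e m \<or> g \<in> cone_ideal d e m"
  using assms by (auto simp: cone_ideal_iff_subst cpoly_subst_mult)

lemma one_notin_cone_ideal: "1 \<notin> cone_ideal d e m"
  using taylor_coeff_rational[of "\<lambda>_. 0" d e] by (auto simp: cone_ideal_def)

lemma primeideal_cone_ideal: "primeideal (cone_ideal d e m) (cpoly_ring m)"
proof (rule primeidealI)
  show "carrier (cpoly_ring m) \<noteq> cone_ideal d e m"
    using one_notin_cone_ideal carrier_one by blast
qed (use ideal_cone_ideal cring_cpoly_ring cone_ideal_prime in auto)


section \<open>From sequences to projective points\<close>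

lemma proj_series_in_proj_space:
  assumes "c \<in> rational_series d e"
  shows "proj_series m c \<in> proj_space m"
proof -
  let ?T = "truncate_fps (Suc m) (Abs_fps c)"
  have "Polynomial.coeff ?T 0 = 1" using rational_series_0[OF assms] by simp
  hence "?T \<noteq> 0" by (metis coeff_0 zero_neq_one)
  moreover have "Polynomial.degree ?T \<le> m" using degree_truncate_fps[of "Suc m"] by (simp add: less_Suc_eq_le)
  ultimately show ?thesis unfolding proj_series_def proj_space_def by blast
qed

lemma vanishes_at_proj_series:
  assumes "f \<in> homogeneous_polys m"
  shows "vanishes_at f (proj_series m c) \<longleftrightarrow> cpoly_eval c f = 0"
proof -
  have "f \<in> carrier (cpoly_ring m)" using assms by (simp add: homogeneous_polys_def)
  hence "cpoly_eval (Polynomial.coeff (truncate_fps (Suc m) (Abs_fps c))) f = cpoly_eval c f"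
    by (rule cpoly_eval_cong) (simp add: coeff_truncate_fps)
  thus ?thesis by (simp add: proj_series_def vanishes_at_proj_point[OF assms])
qed

lemma vanishes_at_mult:
  assumes "f \<in> homogeneous_polys m" "g \<in> homogeneous_polys m" "X \<in> proj_space m"
  shows "vanishes_at (f * g) X \<longleftrightarrow> vanishes_at f X \<or> vanishes_at g X"
  using assms homogeneous_mult[OF assms(1,2)]
  by (auto simp: proj_space_def vanishes_at_proj_point cpoly_eval_mult)

lemma vanishes_on_generators:
  assumes "f \<in> homogeneous_polys m"
  shows "(\<forall>X\<in>proj_series m ` rational_series d e. vanishes_at f X) \<longleftrightarrow> f \<in> cone_ideal d e m"
proof -
  obtain k where "homog m k f" using assms by (auto simp: homogeneous_polys_iff)
  thus ?thesis by (simp add: vanishes_at_proj_series[OF assms] cone_ideal_homog)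
qed

lemma taylor_variety_closure: "taylor_variety d e m = zariski m closure_of (proj_series m ` rational_series d e)"
  unfolding taylor_variety_def taylor_generators ..

lemma generators_subset_variety: "proj_series m ` rational_series d e \<subseteq> taylor_variety d e m"
  unfolding taylor_variety_closure
  by (rule closure_of_subset) (auto simp: topspace_zariski proj_series_in_proj_space)

lemma taylor_variety_eq:
  "taylor_variety d e m = zero_locus m (homogeneous_polys m \<inter> cone_ideal d e m)"
proof (intro equalityI subsetI)
  have "proj_series m ` rational_series d e \<subseteq> zero_locus m (homogeneous_polys m \<inter> cone_ideal d e m)"
    unfolding zero_locus_def
    using vanishes_on_generators[of _ m d e] by (auto simp: proj_series_in_proj_space)
  moreover have "closedin (zariski m) (zero_locus m (homogeneous_polys m \<inter> cone_ideal d e m))"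
    unfolding closedin_zariski by blast
  ultimately have "taylor_variety d e m \<subseteq> zero_locus m (homogeneous_polys m \<inter> cone_ideal d e m)"
    unfolding taylor_variety_closure by (rule closure_of_minimal)
  thus "X \<in> zero_locus m (homogeneous_polys m \<inter> cone_ideal d e m)" if "X \<in> taylor_variety d e m" for X
    using that by blast
next
  fix X assume X: "X \<in> zero_locus m (homogeneous_polys m \<inter> cone_ideal d e m)"
  have "closedin (zariski m) (taylor_variety d e m)"
    unfolding taylor_variety_def by (rule closedin_closure_of)
  then obtain S where S: "S \<subseteq> homogeneous_polys m" "taylor_variety d e m = zero_locus m S"
    unfolding closedin_zariski by blast
  have "S \<subseteq> cone_ideal d e m"
  proof
    fix f assume "f \<in> S"
    hence "\<forall>X\<in>proj_series m ` rational_series d e. vanishes_at f X" "f \<in> homogeneous_polys m"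
      using generators_subset_variety[of m d e] S by (auto simp: zero_locus_def)
    thus "f \<in> cone_ideal d e m" using vanishes_on_generators by blast
  qed
  thus "X \<in> taylor_variety d e m" using X S by (auto simp: zero_locus_def)
qed

lemma closedin_taylor_variety: "closedin (zariski m) (taylor_variety d e m)"
  unfolding taylor_variety_def by (rule closedin_closure_of)

lemma vanishes_on_taylor_variety:
  assumes "f \<in> homogeneous_polys m"
  shows "(\<forall>X\<in>taylor_variety d e m. vanishes_at f X) \<longleftrightarrow> f \<in> cone_ideal d e m"
proof
  assume "\<forall>X\<in>taylor_variety d e m. vanishes_at f X"
  hence "\<forall>X\<in>proj_series m ` rational_series d e. vanishes_at f X"
    using generators_subset_variety by blast
  thus "f \<in> cone_ideal d e m" using vanishes_on_generators[OF assms] by blast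
qed (use assms in \<open>auto simp: taylor_variety_eq zero_locus_def\<close>)

lemma taylor_variety_nonempty: "taylor_variety d e m \<noteq> {}"
  using generators_subset_variety[of m d e] taylor_coeff_rational by blast

section \<open>Irreducibility in terms of products of forms\<close>

lemma irreducible_spaceI:
  assumes V: "closedin (zariski m) V" "V \<noteq> {}"
    and prime: "\<And>f g. f \<in> homogeneous_polys m \<Longrightarrow> g \<in> homogeneous_polys m \<Longrightarrow>
      \<forall>X\<in>V. vanishes_at (f * g) X \<Longrightarrow> (\<forall>X\<in>V. vanishes_at f X) \<or> (\<forall>X\<in>V. vanishes_at g X)"
  shows "irreducible_space (subtopology (zariski m) V)"
proof -
  have Vsub: "V \<subseteq> proj_space m" using closedin_subset[OF V(1)] by (simp add: topspace_zariski)
  hence top: "topspace (subtopology (zariski m) V) = V" by (auto simp: topspace_zariski)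
  have "A = V \<or> B = V" if A: "closedin (zariski m) A" "A \<subseteq> V" and B: "closedin (zariski m) B" "B \<subseteq> V"
    and AB: "A \<union> B = V" for A B
  proof (rule ccontr)
    assume "\<not> (A = V \<or> B = V)"
    then obtain X Y where XY: "X \<in> V" "X \<notin> A" "Y \<in> V" "Y \<notin> B" using A B by blast
    obtain S where S: "S \<subseteq> homogeneous_polys m" "A = zero_locus m S" using A(1) closedin_zariski by blast
    obtain R where R: "R \<subseteq> homogeneous_polys m" "B = zero_locus m R" using B(1) closedin_zariski by blast
    obtain f where f: "f \<in> S" "\<not> vanishes_at f X" using XY S Vsub by (auto simp: zero_locus_def)
    obtain g where g: "g \<in> R" "\<not> vanishes_at g Y" using XY R Vsub by (auto simp: zero_locus_def)
    have "vanishes_at (f * g) Z" if "Z \<in> V" for Z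
    proof -
      have "vanishes_at f Z \<or> vanishes_at g Z" using that f g S R AB by (auto simp: zero_locus_def)
      thus ?thesis using vanishes_at_mult[of f m g Z] f g S R Vsub that by blast
    qed
    hence "(\<forall>X\<in>V. vanishes_at f X) \<or> (\<forall>X\<in>V. vanishes_at g X)"
      using prime[of f g] f g S R by blast
    thus False using f g XY by blast
  qed
  thus ?thesis
    unfolding irreducible_space_def top closedin_closed_subtopology[OF V(1)] using V(2) by blast
qed

lemma irreducible_spaceD:
  assumes V: "closedin (zariski m) V" "irreducible_space (subtopology (zariski m) V)"
    and fg: "f \<in> homogeneous_polys m" "g \<in> homogeneous_polys m" "\<forall>X\<in>V. vanishes_at (f * g) X"
  shows "(\<forall>X\<in>V. vanishes_at f X) \<or> (\<forall>X\<in>V. vanishes_at g X)"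
proof -
  have Vsub: "V \<subseteq> proj_space m" using closedin_subset[OF V(1)] by (simp add: topspace_zariski)
  hence top: "topspace (subtopology (zariski m) V) = V" by (auto simp: topspace_zariski)
  define Z where "Z h = V \<inter> zero_locus m {h}" for h
  have closed: "closedin (zariski m) (Z h)" if "h \<in> homogeneous_polys m" for h
    unfolding Z_def using that by (intro closedin_Int V(1)) (auto simp: closedin_zariski)
  have "Z f \<union> Z g = V"
    using fg(3) vanishes_at_mult[OF fg(1,2)] Vsub by (auto simp: Z_def zero_locus_def)
  hence "Z f = V \<or> Z g = V"
    using V(2) closed fg(1,2)
    unfolding irreducible_space_def top closedin_closed_subtopology[OF V(1)] by (simp add: Z_def)
  thus ?thesis by (auto simp: Z_def zero_locus_def)
qed

lemma irreducible_taylor_variety: "irreducible_space (subtopology (zariski m) (taylor_variety d e m))"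
proof (rule irreducible_spaceI[OF closedin_taylor_variety taylor_variety_nonempty])
  fix f g assume fg: "f \<in> homogeneous_polys m" "g \<in> homogeneous_polys m"
    "\<forall>X\<in>taylor_variety d e m. vanishes_at (f * g) X"
  hence "f * g \<in> cone_ideal d e m"
    using vanishes_on_taylor_variety[OF homogeneous_mult[OF fg(1,2)]] by blast
  hence "f \<in> cone_ideal d e m \<or> g \<in> cone_ideal d e m"
    using fg(1,2) by (intro cone_ideal_prime) (auto simp: homogeneous_polys_def)
  thus "(\<forall>X\<in>taylor_variety d e m. vanishes_at f X) \<or> (\<forall>X\<in>taylor_variety d e m. vanishes_at g X)"
    using vanishes_on_taylor_variety fg by blast
qed

lemma vanishing_ideal_taylor_variety:
  assumes "d + e < m"
  shows "vanishing_ideal m (taylor_variety d e m) = minor_ideal d e m"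
proof -
  interpret hankel d e m by unfold_locales (rule assms)
  interpret cring "cpoly_ring m" by (rule cring_cpoly_ring)
  have eq: "{f \<in> homogeneous_polys m. \<forall>X\<in>taylor_variety d e m. vanishes_at f X} =
      homogeneous_polys m \<inter> cone_ideal d e m"
    using vanishes_on_taylor_variety by blast
  have sub: "homogeneous_polys m \<inter> cone_ideal d e m \<subseteq> carrier (cpoly_ring m)"
    by (auto simp: homogeneous_polys_def)
  show ?thesis
  proof (intro equalityI)
    show "vanishing_ideal m (taylor_variety d e m) \<subseteq> minor_ideal d e m"
      unfolding vanishing_ideal_def eq cone_ideal_eq_minor_ideal[symmetric]
      by (rule genideal_minimal[OF ideal_cone_ideal]) blast
    have "minors (Suc e) (hankel_mat d e m indet) \<subseteq> homogeneous_polys m \<inter> cone_ideal d e m"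
      using minors_subset_cone_ideal[of e d m] minors_indet_homog homogeneous_polys_iff by blast
    also have "\<dots> \<subseteq> vanishing_ideal m (taylor_variety d e m)"
      unfolding vanishing_ideal_def eq by (rule genideal_self[OF sub])
    finally have "minors (Suc e) (hankel_mat d e m indet) \<subseteq> vanishing_ideal m (taylor_variety d e m)" .
    moreover have "ideal (vanishing_ideal m (taylor_variety d e m)) (cpoly_ring m)"
      unfolding vanishing_ideal_def eq by (rule genideal_ideal[OF sub])
    ultimately show "minor_ideal d e m \<subseteq> vanishing_ideal m (taylor_variety d e m)"
      unfolding minor_ideal_def Suc_eq_plus1[symmetric] by (intro genideal_minimal)
  qed
qed


section \<open>Dimension\<close>

text \<open>A box instead of a bound on the total degree makes the count a plain power, whose order
  of growth \<open>N\<close> is all that matters. Indices start at 1 because 0 denotes the scaling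
  parameter.\<close>

definition box_exponents :: "nat \<Rightarrow> nat \<Rightarrow> (nat \<Rightarrow>\<^sub>0 nat) set" where
  "box_exponents N D = {a. Poly_Mapping.keys a \<subseteq> {1..N} \<and> (\<forall>i. Poly_Mapping.lookup a i \<le> D)}"

definition boxed :: "nat \<Rightarrow> nat \<Rightarrow> cpoly \<Rightarrow> bool" where
  "boxed N D f \<longleftrightarrow> Poly_Mapping.keys f \<subseteq> box_exponents N D"

lemma card_box_exponents: "finite (box_exponents N D)" "card (box_exponents N D) \<le> Suc D ^ N"
proof -
  define \<phi> where "\<phi> a = restrict (Poly_Mapping.lookup a) {1..N}" for a :: "nat \<Rightarrow>\<^sub>0 nat"
  have inj: "inj_on \<phi> (box_exponents N D)"
  proof (rule inj_onI, rule poly_mapping_eqI)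
    fix a b i assume ab: "a \<in> box_exponents N D" "b \<in> box_exponents N D" "\<phi> a = \<phi> b"
    show "Poly_Mapping.lookup a i = Poly_Mapping.lookup b i"
    proof (cases "i \<in> {1..N}")
      case True
      thus ?thesis using fun_cong[OF ab(3), of i] by (simp add: \<phi>_def)
    next
      case False
      hence "i \<notin> Poly_Mapping.keys a" "i \<notin> Poly_Mapping.keys b"
        using ab by (auto simp: box_exponents_def)
      thus ?thesis by (simp add: in_keys_iff)
    qed
  qed
  have sub: "\<phi> ` box_exponents N D \<subseteq> PiE {1..N} (\<lambda>_. {..D})"
    by (auto simp: \<phi>_def box_exponents_def)
  have fin: "finite (PiE {1..N} (\<lambda>_. {..D}))" by (intro finite_PiE) auto
  show "finite (box_exponents N D)" by (rule inj_on_finite[OF inj sub fin])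
  show "card (box_exponents N D) \<le> Suc D ^ N"
    using card_inj_on_le[OF inj sub fin] by (simp add: card_PiE)
qed

lemma box_exponents_mono: "D \<le> D' \<Longrightarrow> box_exponents N D \<subseteq> box_exponents N D'"
  by (auto simp: box_exponents_def intro: order.trans)

lemma boxed_mono: "boxed N D f \<Longrightarrow> D \<le> D' \<Longrightarrow> boxed N D' f"
  unfolding boxed_def using box_exponents_mono by blast

lemma boxed_add: "boxed N D f \<Longrightarrow> boxed N D g \<Longrightarrow> boxed N D (f + g)"
  using keys_add[of f g] by (auto simp: boxed_def)

lemma boxed_uminus: "boxed N D f \<Longrightarrow> boxed N D (- f)"
  by (auto simp: boxed_def)

lemma boxed_diff: "boxed N D f \<Longrightarrow> boxed N D g \<Longrightarrow> boxed N D (f - g)"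
  using boxed_add[of N D f "- g"] boxed_uminus by simp

lemma boxed_zero [simp]: "boxed N D 0"
  by (simp add: boxed_def)

lemma boxed_const [simp]: "boxed N D (Poly_Mapping.single 0 u)"
  by (auto simp: boxed_def box_exponents_def)

lemma boxed_one [simp]: "boxed N D 1"
  using boxed_const[of N D 1] by simp

lemma boxed_sum: "(\<And>i. i \<in> A \<Longrightarrow> boxed N D (F i)) \<Longrightarrow> boxed N D (sum F A)"
  by (induction A rule: infinite_finite_induct) (auto intro: boxed_add)

lemma box_exponents_add:
  assumes "a \<in> box_exponents N D" "b \<in> box_exponents N D'"
  shows "a + b \<in> box_exponents N (D + D')"
  using assms keys_add[of a b] by (fastforce simp: box_exponents_def lookup_add intro: add_mono)

lemma boxed_mult: "boxed N D f \<Longrightarrow> boxed N D' g \<Longrightarrow> boxed N (D + D') (f * g)"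
  using keys_mult[of f g] box_exponents_add by (fastforce simp: boxed_def)

lemma boxed_power: "boxed N D f \<Longrightarrow> boxed N (n * D) (f ^ n)"
  by (induction n) (auto intro: boxed_mult)

lemma boxed_prod: "finite A \<Longrightarrow> (\<And>i. i \<in> A \<Longrightarrow> boxed N (D i) (F i)) \<Longrightarrow> boxed N (sum D A) (prod F A)"
  by (induction A rule: finite_induct) (auto intro: boxed_mult)

lemma boxed_indet: "1 \<le> i \<Longrightarrow> i \<le> N \<Longrightarrow> boxed N 1 (indet i)"
  by (auto simp: boxed_def box_exponents_def indet_def lookup_single when_def)

lemma boxed_taylor_coeff: "boxed (d + e) k (taylor_coeff d e k)"
proof (induction k rule: less_induct)
  case (less k)
  have "boxed (d + e) k (numer d k)"
    using boxed_mono[OF boxed_indet[of k "d + e"], of k] by (auto simp: numer_def)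
  moreover have "boxed (d + e) k (denom d e (k - j) * taylor_coeff d e j)" if "j < k" for j
  proof -
    have "boxed (d + e) 1 (denom d e (k - j))"
      using boxed_indet[of "d + (k - j)" "d + e"] that by (auto simp: denom_def)
    hence "boxed (d + e) (1 + j) (denom d e (k - j) * taylor_coeff d e j)"
      by (intro boxed_mult less that)
    thus ?thesis by (rule boxed_mono) (use that in simp)
  qed
  ultimately show ?case
    by (subst taylor_coeff.simps) (auto intro!: boxed_diff boxed_sum)
qed

text \<open>The variable c_i contributes exponents of at most \<open>i \<le> m\<close>, so
  \<open>K\<close> factors stay within \<open>m * K\<close>; the bound is linear in
  \<open>K\<close>.\<close>

lemma boxed_subst_taylor_coeff:
  assumes "homog m K f"
  shows "boxed (d + e) (m * K) (cpoly_subst (taylor_coeff d e) f)"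
  unfolding cpoly_subst_def
proof (rule boxed_sum)
  fix a assume a: "a \<in> Poly_Mapping.keys f"
  have "boxed (d + e) (0 + (\<Sum>i\<in>Poly_Mapping.keys a. Poly_Mapping.lookup a i * i))
     (Poly_Mapping.single 0 (Poly_Mapping.lookup f a) *
      (\<Prod>i\<in>Poly_Mapping.keys a. taylor_coeff d e i ^ Poly_Mapping.lookup a i))"
    by (intro boxed_mult boxed_const boxed_prod boxed_power boxed_taylor_coeff) simp
  moreover have "(\<Sum>i\<in>Poly_Mapping.keys a. Poly_Mapping.lookup a i * i) \<le>
      (\<Sum>i\<in>Poly_Mapping.keys a. Poly_Mapping.lookup a i * m)"
    using assms a by (intro sum_mono mult_left_mono) (auto simp: homog_def carrier_cpoly_ring)
  moreover have "(\<Sum>i\<in>Poly_Mapping.keys a. Poly_Mapping.lookup a i * m) = m * K"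
  proof -
    have "(\<Sum>i\<in>Poly_Mapping.keys a. Poly_Mapping.lookup a i * m) = total_degree a * m"
      by (simp add: total_degree_def sum_distrib_right)
    thus ?thesis using assms a by (simp add: homog_def)
  qed
  ultimately show "boxed (d + e) (m * K) (Poly_Mapping.single 0 (Poly_Mapping.lookup f a) *
      (\<Prod>i\<in>Poly_Mapping.keys a. taylor_coeff d e i ^ Poly_Mapping.lookup a i))"
    by (elim boxed_mono) simp
qed

text \<open>More vectors than coordinates: the square matrix padded by zero rows is singular.\<close>

lemma linear_dependence:
  fixes M :: "'b \<Rightarrow> nat \<Rightarrow> complex"
  assumes "finite B" "card B < r"
  shows "\<exists>\<alpha>. (\<exists>i<r. \<alpha> i \<noteq> 0) \<and> (\<forall>b\<in>B. (\<Sum>i<r. \<alpha> i * M b i) = 0)"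
proof -
  obtain h where h: "bij_betw h {0..<card B} B" using ex_bij_betw_nat_finite[OF assms(1)] by blast
  define A where "A = mat r r (\<lambda>(k, i). if k < card B then M (h k) i else 0)"
  have A: "A \<in> carrier_mat r r" by (simp add: A_def)
  have "det A = (\<Sum>j<r. A $$ (card B, j) * cofactor A (card B) j)"
    by (rule laplace_expansion_row[OF A assms(2)])
  also have "\<dots> = 0" using assms(2) by (intro sum.neutral) (auto simp: A_def)
  finally obtain v where v: "v \<in> carrier_vec r" "v \<noteq> 0\<^sub>v r" "A *\<^sub>v v = 0\<^sub>v r"
    unfolding det_0_iff_vec_prod_zero[OF A] by blast
  have "\<exists>i<r. vec_index v i \<noteq> 0"
    using v(1,2) by (metis carrier_vecD eq_vecI index_zero_vec(1) index_zero_vec(2))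
  moreover have "(\<Sum>i<r. vec_index v i * M b i) = 0" if b: "b \<in> B" for b
  proof -
    have "b \<in> h ` {0..<card B}" using b h by (simp add: bij_betw_def)
    then obtain k where k: "k < card B" "b = h k" by auto
    have "vec_index (A *\<^sub>v v) k = (\<Sum>i<r. vec_index v i * M b i)"
      using k assms(2) v(1) by (auto simp: A_def scalar_prod_def atLeast0LessThan mult.commute intro!: sum.cong)
    thus ?thesis using v(3) k assms(2) by simp
  qed
  ultimately show ?thesis by blast
qed

section \<open>Hilbert function estimates\<close>

lemma cpoly_linear_dependence:
  assumes "\<And>i. i < r \<Longrightarrow> boxed N D (G i)" "Suc D ^ N < r"
  shows "\<exists>\<alpha>. (\<exists>i<r. \<alpha> i \<noteq> 0) \<and> (\<Sum>i<r. Poly_Mapping.single 0 (\<alpha> i) * G i) = 0"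
proof -
  have "card (box_exponents N D) < r" using card_box_exponents(2)[of N D] assms(2) by simp
  from linear_dependence[OF card_box_exponents(1) this, of "\<lambda>b i. Poly_Mapping.lookup (G i) b"]
  obtain \<alpha> where \<alpha>: "\<exists>i<r. \<alpha> i \<noteq> 0"
    "\<And>b. b \<in> box_exponents N D \<Longrightarrow> (\<Sum>i<r. \<alpha> i * Poly_Mapping.lookup (G i) b) = 0" by blast
  have lk: "Poly_Mapping.lookup (Poly_Mapping.single 0 u * f) b = u * Poly_Mapping.lookup f b" for u b and f :: cpoly
    by (simp add: mult_map_scale_conv_mult[symmetric] map.rep_eq when_def)
  have "Poly_Mapping.lookup (\<Sum>i<r. Poly_Mapping.single 0 (\<alpha> i) * G i) b = 0" for b
  proof (cases "b \<in> box_exponents N D")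
    case False
    hence "Poly_Mapping.lookup (G i) b = 0" if "i < r" for i
      using assms(1)[OF that] by (auto simp: boxed_def in_keys_iff)
    thus ?thesis by (simp add: lookup_sum lk)
  qed (simp add: lookup_sum lk \<alpha>(2))
  thus ?thesis using \<alpha>(1) by (intro exI[of _ \<alpha>]) (auto intro: poly_mapping_eqI)
qed

text \<open>Certifies that the Hilbert function of \<open>V\<close> in degree \<open>K\<close> is at
  least \<open>r\<close>: the forms are independent modulo those that vanish on
  \<open>V\<close>.\<close>

definition indep_on :: "nat \<Rightarrow> complex poly set set \<Rightarrow> nat \<Rightarrow> nat \<Rightarrow> (nat \<Rightarrow> cpoly) \<Rightarrow> bool" where
  "indep_on m V K r G \<longleftrightarrow> (\<forall>i<r. homog m K (G i)) \<and>
     (\<forall>\<alpha>. (\<forall>X\<in>V. vanishes_at (\<Sum>i<r. Poly_Mapping.single 0 (\<alpha> i) * G i) X) \<longrightarrow> (\<forall>i<r. \<alpha> i = 0))"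

lemma homog_combination:
  "(\<And>i. i < r \<Longrightarrow> homog m K (G i)) \<Longrightarrow> homog m K (\<Sum>i<r. Poly_Mapping.single 0 (\<alpha> i) * G i)"
  using homog_mult[OF homog_const] by (intro homog_sum) fastforce

lemma indep_on_mono: "indep_on m V K r G \<Longrightarrow> V \<subseteq> W \<Longrightarrow> indep_on m W K r G"
  unfolding indep_on_def by blast

text \<open>Pulled back along the parametrization, the forms live in a space of dimension at most
  \<open>Suc (m * K) ^ (d + e)\<close>; a dependence there is a combination that vanishes on the
  cone, hence on the variety.\<close>

lemma indep_on_taylor_variety_bound:
  assumes "indep_on m (taylor_variety d e m) K r G"
  shows "r \<le> Suc (m * K) ^ (d + e)"
proof (rule ccontr)
  assume "\<not> r \<le> Suc (m * K) ^ (d + e)"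
  hence r: "Suc (m * K) ^ (d + e) < r" by simp
  have hom: "homog m K (G i)" if "i < r" for i using assms that by (simp add: indep_on_def)
  obtain \<alpha> where \<alpha>: "\<exists>i<r. \<alpha> i \<noteq> 0"
    "(\<Sum>i<r. Poly_Mapping.single 0 (\<alpha> i) * cpoly_subst (taylor_coeff d e) (G i)) = 0"
    using cpoly_linear_dependence[of r "d + e" "m * K" "\<lambda>i. cpoly_subst (taylor_coeff d e) (G i)"]
      boxed_subst_taylor_coeff[OF hom] r by auto
  define F where "F = (\<Sum>i<r. Poly_Mapping.single 0 (\<alpha> i) * G i)"
  have F: "homog m K F" unfolding F_def by (rule homog_combination[OF hom])
  have "cpoly_eval c F = 0" if "c \<in> rational_series d e" for c
  proof -
    obtain y where y: "c = (\<lambda>k. cpoly_eval y (taylor_coeff d e k))"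
      using rational_series_taylor_coeff \<open>c \<in> rational_series d e\<close> by blast
    have "cpoly_eval c F = cpoly_eval y (\<Sum>i<r. Poly_Mapping.single 0 (\<alpha> i) * cpoly_subst (taylor_coeff d e) (G i))"
      by (simp add: F_def cpoly_eval_sum cpoly_eval_mult cpoly_eval_subst y)
    thus ?thesis by (simp add: \<alpha>(2))
  qed
  hence "F \<in> cone_ideal d e m" using cone_ideal_homog[OF F] by blast
  hence "\<forall>X\<in>taylor_variety d e m. vanishes_at F X"
    using vanishes_on_taylor_variety F homogeneous_polys_iff by blast
  thus False using assms \<alpha>(1) unfolding indep_on_def F_def by blast
qed

lemma vanishes_at_diff: "vanishes_at f X \<Longrightarrow> vanishes_at g X \<Longrightarrow> vanishes_at (f - g) X"
  by (simp add: vanishes_at_def cpoly_eval_diff)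

lemma vanishes_at_mult_right: "vanishes_at f X \<Longrightarrow> vanishes_at (f * g) X"
  by (simp add: vanishes_at_def cpoly_eval_mult)

lemma vanishes_at_const: "X \<noteq> {} \<Longrightarrow> vanishes_at (Poly_Mapping.single 0 u) X \<longleftrightarrow> u = 0"
  by (auto simp: vanishes_at_def)

lemma proj_space_nonempty: "X \<in> proj_space m \<Longrightarrow> X \<noteq> {}"
  by (auto simp: proj_space_def proj_point_def intro: exI[of _ 1])

text \<open>The inequality of Hilbert functions behind multiplication by \<open>f\<close>. On
  \<open>V\<close> the summands with \<open>f\<close> vanish, which forces the coefficients of
  \<open>G\<close> to be 0; the rest is \<open>f\<close> times a combination of \<open>H\<close>,
  and irreducibility of \<open>W\<close> allows \<open>f\<close> to be cancelled.\<close>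

lemma indep_on_join:
  assumes Z: "closedin (zariski m) W" "irreducible_space (subtopology (zariski m) W)" "V \<subseteq> W"
    and f: "homog m L f" "\<forall>X\<in>V. vanishes_at f X" "\<exists>X\<in>W. \<not> vanishes_at f X"
    and G: "indep_on m V (L + K) r G" and H: "indep_on m W K s H"
  shows "indep_on m W (L + K) (r + s) (\<lambda>i. if i < r then G i else f * H (i - r))"
  unfolding indep_on_def
proof (intro conjI allI impI)
  fix i assume "i < r + s"
  thus "homog m (L + K) (if i < r then G i else f * H (i - r))"
    using G H homog_mult[OF f(1)] by (auto simp: indep_on_def)
next
  fix \<alpha> :: "nat \<Rightarrow> complex" and i :: nat
  define P where "P = (\<Sum>i<r. Poly_Mapping.single 0 (\<alpha> i) * G i)"
  define Q where "Q = (\<Sum>i<s. Poly_Mapping.single 0 (\<alpha> (r + i)) * H i)"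
  have split: "(\<Sum>i<r + s. Poly_Mapping.single 0 (\<alpha> i) * (if i < r then G i else f * H (i - r))) = P + f * Q"
  proof -
    have "(\<Sum>i<r + s. g i) = (\<Sum>i<r. g i) + (\<Sum>i<s. g (r + i))" for g :: "nat \<Rightarrow> cpoly"
      by (induction s) (auto simp: add.assoc)
    thus ?thesis by (simp add: P_def Q_def sum_distrib_left mult.left_commute)
  qed
  assume "\<forall>X\<in>W. vanishes_at (\<Sum>i<r + s. Poly_Mapping.single 0 (\<alpha> i) * (if i < r then G i else f * H (i - r))) X"
  hence van: "vanishes_at (P + f * Q) X" if "X \<in> W" for X using that unfolding split by blast
  have "vanishes_at P X" if "X \<in> V" for X
    using vanishes_at_diff[OF van[of X] vanishes_at_mult_right[of f X Q]] f(2) Z(3) that by auto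
  hence a1: "\<forall>i<r. \<alpha> i = 0" using G unfolding indep_on_def P_def by blast
  hence "P = 0" by (simp add: P_def)
  hence "\<forall>X\<in>W. vanishes_at (f * Q) X" using van by simp
  moreover have "homog m K Q" unfolding Q_def by (rule homog_combination) (use H in \<open>auto simp: indep_on_def\<close>)
  ultimately have "(\<forall>X\<in>W. vanishes_at f X) \<or> (\<forall>X\<in>W. vanishes_at Q X)"
    using f(1) homogeneous_polys_iff by (intro irreducible_spaceD[OF Z(1,2)]) blast+
  hence "\<forall>X\<in>W. vanishes_at Q X" using f(3) by blast
  hence a2: "\<forall>i<s. \<alpha> (r + i) = 0" using H[unfolded indep_on_def, THEN conjunct2, rule_format, of "\<lambda>i. \<alpha> (r + i)"]
    unfolding Q_def by blast
  assume "i < r + s"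
  thus "\<alpha> i = 0" using a1 a2[rule_format, of "i - r"] by (cases "i < r") auto
qed

text \<open>Induction on \<open>n\<close>, with an inner induction on \<open>k\<close> that follows
  Pascal's rule: forms independent on \<open>Z n\<close> are joined with multiples of a form that
  vanishes on \<open>Z n\<close> but not on \<open>Z (Suc n)\<close>.\<close>

lemma indep_on_chain:
  fixes Z :: "nat \<Rightarrow> complex poly set set"
  assumes "\<And>i. i \<le> n \<Longrightarrow> closedin (zariski m) (Z i) \<and> irreducible_space (subtopology (zariski m) (Z i))"
    and "\<And>i. i < n \<Longrightarrow> Z i \<subset> Z (Suc i)"
  shows "\<exists>a>0. \<forall>k. \<exists>r G. (k + n) choose n \<le> r \<and> indep_on m (Z n) (a * k) r G"
  using assms
proof (induction n)
  case 0
  have "Z 0 \<noteq> {}" "Z 0 \<subseteq> proj_space m"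
    using 0 closedin_subset by (fastforce simp: irreducible_space_def topspace_zariski)+
  then obtain T where T: "proj_point T \<in> Z 0" "T \<noteq> 0" "Polynomial.degree T \<le> m"
    by (auto simp: proj_space_def)
  \<comment> \<open>The leading coefficient of \<open>T\<close> is a coordinate that does not vanish
    at the point, so its powers serve as the one form required.\<close>
  define j where "j = Polynomial.degree T"
  have "indep_on m (Z 0) k 1 (\<lambda>_. indet j ^ k)" for k
    unfolding indep_on_def
  proof (intro conjI allI impI)
    show hom: "homog m k (indet j ^ k)"
      using homog_power[OF homog_indet[of j m], of k] T by (simp add: j_def)
    fix \<alpha> :: "nat \<Rightarrow> complex" and i :: nat
    assume *: "\<forall>X\<in>Z 0. vanishes_at (\<Sum>i<1. Poly_Mapping.single 0 (\<alpha> i) * indet j ^ k) X" and "i < 1"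
    have "homog m k (Poly_Mapping.single 0 (\<alpha> 0) * indet j ^ k)"
      using homog_mult[OF homog_const hom] by simp
    hence "cpoly_eval (Polynomial.coeff T) (Poly_Mapping.single 0 (\<alpha> 0) * indet j ^ k) = 0"
      using * T(1) vanishes_at_proj_point homogeneous_polys_iff by fastforce
    thus "\<alpha> i = 0" using \<open>i < 1\<close> T(2) by (simp add: cpoly_eval_mult cpoly_eval_power j_def)
  qed
  hence "\<exists>r G. (k + 0) choose 0 \<le> r \<and> indep_on m (Z 0) (1 * k) r G" for k
    by (intro exI[of _ 1]) auto
  thus ?case by blast
next
  case (Suc n)
  then obtain a where a: "a > 0" "\<And>k. \<exists>r G. (k + n) choose n \<le> r \<and> indep_on m (Z n) (a * k) r G"
    by (metis le_Suc_eq less_Suc_eq)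
  have Zn: "closedin (zariski m) (Z n)" "Z n \<noteq> {}" "Z n \<subseteq> proj_space m"
    and Zs: "closedin (zariski m) (Z (Suc n))" "irreducible_space (subtopology (zariski m) (Z (Suc n)))"
      "Z n \<subset> Z (Suc n)" "Z (Suc n) \<subseteq> proj_space m"
    using Suc.prems(1)[of n] Suc.prems(1)[of "Suc n"] Suc.prems(2)[of n] closedin_subset[of "zariski m"]
    by (auto simp: irreducible_space_def topspace_zariski)
  obtain S where S: "S \<subseteq> homogeneous_polys m" "Z n = zero_locus m S"
    using Zn(1) closedin_zariski by blast
  obtain X where X: "X \<in> Z (Suc n)" "X \<notin> Z n" using Zs(3) by blast
  obtain f where f: "f \<in> S" "\<not> vanishes_at f X" using X S Zs(4) by (auto simp: zero_locus_def)
  obtain b where b: "homog m b f" using f(1) S(1) homogeneous_polys_iff by blast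
  have fZ: "\<forall>Y\<in>Z n. vanishes_at f Y" using f(1) S(2) by (auto simp: zero_locus_def)
  \<comment> \<open>A form of degree 0 is constant, while \<open>f\<close> vanishes on the nonempty
    \<open>Z n\<close> but not at \<open>X\<close>. Positivity of \<open>b\<close> keeps the new
    step \<open>a * b\<close> positive and enters the comparison of binomials.\<close>
  have "b \<noteq> 0"
  proof
    assume "b = 0"
    hence const: "cpoly_eval c f = cpoly_eval (\<lambda>_. 0) f" for c
      using homog_scale_eval[of m 0 f 0 c] b by simp
    obtain Y T where Y: "Y \<in> Z n" "T \<in> Y" using Zn proj_space_nonempty by blast
    hence "cpoly_eval (\<lambda>_. 0) f = 0" using fZ const[of "Polynomial.coeff T"] by (auto simp: vanishes_at_def)
    thus False using f(2) const by (simp add: vanishes_at_def)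
  qed
  \<comment> \<open>The power \<open>a\<close> has degree \<open>a * b\<close>, so multiplication by
    it leads from degree \<open>a * b * k\<close> to \<open>a * (b * Suc k)\<close>, a degree in
    which the outer induction hypothesis supplies forms on \<open>Z n\<close>.\<close>
  have fa: "homog m (a * b) (f ^ a)" by (rule homog_power[OF b])
  have faZ: "\<forall>Y\<in>Z n. vanishes_at (f ^ a) Y"
    using fZ a(1) by (auto simp: vanishes_at_def cpoly_eval_power)
  have faX: "\<exists>X\<in>Z (Suc n). \<not> vanishes_at (f ^ a) X"
    using X(1) f(2) by (auto simp: vanishes_at_def cpoly_eval_power)
  have "\<exists>r G. (k + Suc n) choose Suc n \<le> r \<and> indep_on m (Z (Suc n)) (a * b * k) r G" for k
  proof (induction k)
    case 0
    have "X \<noteq> {}" using X(1) Zs(4) proj_space_nonempty by blast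
    note const = vanishes_at_const[OF this]
    have "indep_on m (Z (Suc n)) 0 1 (\<lambda>_. 1)"
      by (auto simp: indep_on_def const dest!: bspec[OF _ X(1)])
    thus ?case by (intro exI[of _ 1]) auto
  next
    case (Suc k)
    obtain r G where G: "(b * Suc k + n) choose n \<le> r" "indep_on m (Z n) (a * (b * Suc k)) r G"
      using a(2) by blast
    obtain s H where H: "(k + Suc n) choose Suc n \<le> s" "indep_on m (Z (Suc n)) (a * b * k) s H"
      using Suc by blast
    have "indep_on m (Z (Suc n)) (a * b + a * b * k) (r + s) (\<lambda>i. if i < r then G i else f ^ a * H (i - r))"
      using Zs(3) G(2) H(2)
      by (intro indep_on_join[OF Zs(1,2) _ fa faZ faX]) (auto simp: algebra_simps)
    moreover have "(Suc k + Suc n) choose Suc n \<le> r + s"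
    proof -
      have "(Suc k + n) choose n \<le> (b * Suc k + n) choose n"
        using mult_le_mono1[of 1 b "Suc k"] \<open>b \<noteq> 0\<close> by (intro binomial_right_mono) simp
      thus ?thesis using G(1) H(1) by simp
    qed
    ultimately show ?case by (auto simp: algebra_simps)
  qed
  thus ?case using a(1) \<open>b \<noteq> 0\<close> by (intro exI[of _ "a * b"]) auto
qed

text \<open>The binomial is at least \<open>(k / (N + 1)) ^ (N + 1)\<close>, and the power is at
  most \<open>((A + 1) * k) ^ N\<close> for positive \<open>k\<close>; hence \<open>k\<close> just
  above \<open>(N + 1) ^ (N + 1) * (A + 1) ^ N\<close> is large enough.\<close>

lemma binomial_exceeds_power: "\<exists>k. Suc (A * k) ^ N < (k + Suc N) choose Suc N"
proof -
  define B where "B = Suc A"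
  define k where "k = Suc (Suc N ^ Suc N * B ^ N)"
  have "(real k) ^ Suc N / real (Suc N) ^ Suc N \<le> (real (k + Suc N) / real (Suc N)) ^ Suc N"
    unfolding power_divide[symmetric] by (intro power_mono divide_right_mono) auto
  also have "\<dots> \<le> real ((k + Suc N) choose Suc N)"
    using binomial_ge_n_over_k_pow_k[of "Suc N" "k + Suc N", where 'a = real] by simp
  finally have "real k ^ Suc N / real (Suc N) ^ Suc N \<le> real ((k + Suc N) choose Suc N)" .
  moreover have "real (Suc (A * k) ^ N) < real k ^ Suc N / real (Suc N) ^ Suc N"
  proof -
    have "Suc (A * k) \<le> B * k" by (simp add: B_def k_def)
    hence "Suc (A * k) ^ N \<le> (B * k) ^ N" by (rule power_mono) simp
    hence "Suc N ^ Suc N * Suc (A * k) ^ N \<le> Suc N ^ Suc N * B ^ N * k ^ N"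
      by (simp add: power_mult_distrib mult.assoc del: power_Suc)
    also have "\<dots> < k * k ^ N"
      by (intro mult_strict_right_mono) (auto simp: k_def simp del: power_Suc)
    finally have "Suc N ^ Suc N * Suc (A * k) ^ N < k ^ Suc N" by simp
    hence "real (Suc N) ^ Suc N * real (Suc (A * k) ^ N) < real k ^ Suc N"
      by (metis of_nat_less_iff of_nat_mult of_nat_power)
    thus ?thesis by (simp add: pos_less_divide_eq mult.commute del: power_Suc)
  qed
  ultimately have "real (Suc (A * k) ^ N) < real ((k + Suc N) choose Suc N)" by linarith
  thus ?thesis using of_nat_less_iff by blast
qed

section \<open>Bounds for the dimension\<close>

lemma subtopology_taylor_variety:
  assumes "closedin (subtopology (zariski m) (taylor_variety d e m)) Z"
  shows "closedin (zariski m) Z" "Z \<subseteq> taylor_variety d e m"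
    "subtopology (subtopology (zariski m) (taylor_variety d e m)) Z = subtopology (zariski m) Z"
  using assms by (auto simp: closedin_closed_subtopology[OF closedin_taylor_variety] subtopology_subtopology
      Int_absorb1)

lemma krull_dim_le: "krull_dim (subtopology (zariski m) (taylor_variety d e m)) \<le> enat (d + e)"
  unfolding krull_dim_def
proof (rule Sup_least, clarify)
  fix n and Z :: "nat \<Rightarrow> complex poly set set"
  let ?Y = "subtopology (zariski m) (taylor_variety d e m)"
  assume Z: "\<forall>i\<le>n. closedin ?Y (Z i) \<and> irreducible_space (subtopology ?Y (Z i))" "\<forall>i<n. Z i \<subset> Z (Suc i)"
  show "enat n \<le> enat (d + e)"
  proof (rule ccontr)
    assume "\<not> enat n \<le> enat (d + e)"
    hence n: "Suc (d + e) \<le> n" by simp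
    \<comment> \<open>Only the members up to \<open>Z (Suc (d + e))\<close> are used: one step too
      many already contradicts the growth bound.\<close>
    have "\<exists>a>0. \<forall>k. \<exists>r G. (k + Suc (d + e)) choose Suc (d + e) \<le> r \<and> indep_on m (Z (Suc (d + e))) (a * k) r G"
    proof (rule indep_on_chain)
      fix i assume "i \<le> Suc (d + e)"
      hence "i \<le> n" using n by simp
      thus "closedin (zariski m) (Z i) \<and> irreducible_space (subtopology (zariski m) (Z i))"
        using Z(1) subtopology_taylor_variety by metis
    qed (use Z(2) n in auto)
    then obtain a where a: "\<And>k. \<exists>r G. (k + Suc (d + e)) choose Suc (d + e) \<le> r \<and>
        indep_on m (Z (Suc (d + e))) (a * k) r G" by blast
    obtain k where k: "Suc (m * a * k) ^ (d + e) < (k + Suc (d + e)) choose Suc (d + e)"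
      using binomial_exceeds_power[of "m * a" "d + e"] by blast
    obtain r G where r: "(k + Suc (d + e)) choose Suc (d + e) \<le> r" "indep_on m (Z (Suc (d + e))) (a * k) r G"
      using a by blast
    have "Z (Suc (d + e)) \<subseteq> taylor_variety d e m" using Z(1) n subtopology_taylor_variety(2) by blast
    hence "r \<le> Suc (m * (a * k)) ^ (d + e)"
      using indep_on_taylor_variety_bound indep_on_mono[OF r(2)] by blast
    thus False using k r(1) by (simp add: mult.assoc)
  qed
qed

lemma cone_ideal_antimono: "d \<le> d' \<Longrightarrow> e \<le> e' \<Longrightarrow> cone_ideal d' e' m \<subseteq> cone_ideal d e m"
  unfolding cone_ideal_def using rational_series_mono[of d d' e e'] by blast

lemma taylor_variety_mono: "d \<le> d' \<Longrightarrow> e \<le> e' \<Longrightarrow> taylor_variety d e m \<subseteq> taylor_variety d' e' m"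
  unfolding taylor_variety_eq zero_locus_def using cone_ideal_antimono[of d d' e e' m] by blast

text \<open>The determinant \<open>toeplitz (Suc d) (Suc e)\<close> vanishes on the smaller variety
  because of the kernel vector, but it involves only the coordinates up to index
  \<open>d' + e'\<close>, which are algebraically independent on the larger cone.\<close>

lemma taylor_variety_strict:
  assumes "d \<le> d'" "e \<le> e'" "d' + e' = Suc (d + e)" "d + e < m"
  shows "taylor_variety d e m \<subset> taylor_variety d' e' m"
proof -
  define h where "h = toeplitz (Suc d) (Suc e) indet"
  have h: "homog m (Suc e) h" "homog (d' + e') (Suc e) h"
    unfolding h_def using assms by (auto intro!: homog_toeplitz)
  have "\<forall>c\<in>rational_series d e. cpoly_eval c h = 0"
    by (simp add: h_def cpoly_eval_toeplitz toeplitz_vanish_rational_series)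
  hence "h \<in> cone_ideal d e m" using cone_ideal_homog[OF h(1)] by blast
  moreover have "h \<notin> cone_ideal d' e' m"
    using cone_ideal_dense[OF _ homog_carrier[OF h(2)]] toeplitz_indet_nonzero[of "Suc d" "Suc e"]
    by (auto simp: h_def)
  ultimately have "taylor_variety d e m \<noteq> taylor_variety d' e' m"
    using vanishes_on_taylor_variety[of h m] h(1) homogeneous_polys_iff by blast
  thus ?thesis using taylor_variety_mono[OF assms(1,2)] by blast
qed

lemma krull_dim_ge:
  assumes "d + e \<le> m"
  shows "enat (d + e) \<le> krull_dim (subtopology (zariski m) (taylor_variety d e m))"
  unfolding krull_dim_def
proof (rule Sup_upper, intro CollectI exI conjI allI impI refl)
  let ?Y = "subtopology (zariski m) (taylor_variety d e m)"
  \<comment> \<open>The numerator degree grows from 0 to \<open>d\<close>, and after that the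
    denominator degree from 0 to \<open>e\<close>; the index is always the sum of both.\<close>
  define Z where "Z i = taylor_variety (min i d) (i - d) m" for i
  fix i
  show "Z i \<subset> Z (Suc i)" if "i < d + e"
    unfolding Z_def by (rule taylor_variety_strict) (use that assms in auto)
  assume i: "i \<le> d + e"
  have "Z i \<subseteq> taylor_variety d e m" unfolding Z_def by (rule taylor_variety_mono) (use i in auto)
  thus closed: "closedin ?Y (Z i)"
    unfolding closedin_closed_subtopology[OF closedin_taylor_variety] Z_def
    using closedin_taylor_variety by blast
  show "irreducible_space (subtopology ?Y (Z i))"
    unfolding subtopology_taylor_variety(3)[OF closed] unfolding Z_def by (rule irreducible_taylor_variety)
qed simp

lemma krull_dim_taylor_variety:
  "krull_dim (subtopology (zariski m) (taylor_variety d e m)) = enat (min (d + e) m)"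
proof (cases "d + e \<le> m")
  case True
  thus ?thesis using krull_dim_le[of m d e] krull_dim_ge[of d e m] by (simp add: min_def)
next
  case False
  \<comment> \<open>Shrink the degrees to \<open>d' + e' = m\<close>. There the cone ideal is
    already zero, and it contains the ideal for \<open>d\<close> and \<open>e\<close>, so both
    varieties coincide.\<close>
  define d' where "d' = min d m"
  define e' where "e' = m - d'"
  have le: "d' \<le> d" "e' \<le> e" and sum: "d' + e' = m" using False by (auto simp: d'_def e'_def)
  have "cone_ideal d e m = cone_ideal d' e' m"
    using cone_ideal_antimono[OF le, of m] cone_ideal_full[OF sum] ideal_cpoly_zero[OF ideal_cone_ideal, of d e m]
    by auto
  hence "taylor_variety d e m = taylor_variety d' e' m" by (simp add: taylor_variety_eq)
  thus ?thesis using krull_dim_le[of m d' e'] krull_dim_ge[of d' e' m] sum False by simp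
qed


section \<open>Rank and minors\<close>

text \<open>A nonzero maximal minor of the first \<open>n\<close> columns yields the kernel vector: its entries are the
  cofactors of an arbitrary additional row.\<close>

lemma kernel_if_minors_vanish:
  fixes A :: "nat \<Rightarrow> nat \<Rightarrow> complex"
  assumes "\<And>r. (\<And>i. i < n \<Longrightarrow> r i < k) \<Longrightarrow> det (mat n n (\<lambda>(i, j). A (r i) j)) = 0"
  shows "\<exists>v. (\<exists>j<n. v j \<noteq> 0) \<and> (\<forall>i<k. (\<Sum>j<n. A i j * v j) = 0)"
  using assms
proof (induction n)
  case 0
  have "det (mat 0 0 (\<lambda>(i, j). A i j)) = 1" by (rule det_dim_zero) simp
  thus ?case using "0"[of "\<lambda>i. i"] by simp
next
  case (Suc n)
  show ?case
  proof (cases "\<exists>r. (\<forall>i<n. r i < k) \<and> det (mat n n (\<lambda>(i, j). A (r i) j)) \<noteq> 0")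
    case False
    hence "\<exists>v. (\<exists>j<n. v j \<noteq> 0) \<and> (\<forall>i<k. (\<Sum>j<n. A i j * v j) = 0)"
      by (intro Suc.IH) auto
    then obtain v l where v: "l < n" "v l \<noteq> 0" "\<And>i. i < k \<Longrightarrow> (\<Sum>j<n. A i j * v j) = 0" by blast
    thus ?thesis
      by (intro exI[of _ "v(n := 0)"] conjI exI[of _ l]) auto
  next
    case True
    then obtain r where r: "\<And>i. i < n \<Longrightarrow> r i < k" "det (mat n n (\<lambda>(i, j). A (r i) j)) \<noteq> 0" by blast
    define M where "M i = mat (Suc n) (Suc n) (\<lambda>(l, j). A (if l = n then i else r l) j)" for i
    have M: "M i \<in> carrier_mat (Suc n) (Suc n)" for i by (simp add: M_def)
    define v where "v j = cofactor (M 0) n j" for j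
    have cof: "cofactor (M i) n j = v j" for i j
    proof -
      have "mat_delete (M i) n j = mat_delete (M 0) n j"
        by (rule eq_matI) (auto simp: mat_delete_def M_def)
      thus ?thesis by (simp add: v_def cofactor_def)
    qed
    have "mat_delete (M 0) n n = mat n n (\<lambda>(i, j). A (r i) j)"
      by (rule eq_matI) (auto simp: mat_delete_def M_def)
    hence "v n \<noteq> 0" using r(2) by (simp add: v_def cofactor_def)
    moreover have "(\<Sum>j<Suc n. A i j * v j) = 0" if "i < k" for i
    proof -
      have "0 = det (M i)"
        unfolding M_def by (rule Suc.prems[symmetric]) (use r(1) that in auto)
      also have "\<dots> = (\<Sum>j<Suc n. M i $$ (n, j) * cofactor (M i) n j)"
        by (rule laplace_expansion_row[OF M]) simp
      also have "\<dots> = (\<Sum>j<Suc n. A i j * v j)"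
        unfolding cof by (intro sum.cong) (auto simp: M_def)
      finally show ?thesis by simp
    qed
    ultimately show ?thesis by (intro exI[of _ v]) auto
  qed
qed

text \<open>Bridges the arbitrary row choices of the kernel lemma and the increasing ones of
  \<open>minors\<close>: a nonzero determinant has distinct rows, and sorting them changes at most
  the sign.\<close>

lemma det_rows_sort:
  fixes A :: "nat \<Rightarrow> nat \<Rightarrow> complex"
  assumes "det (mat n n (\<lambda>(i, j). A (r i) j)) \<noteq> 0" "\<And>i. i < n \<Longrightarrow> r i < k"
  shows "\<exists>s. (\<forall>i j. i < j \<longrightarrow> j < n \<longrightarrow> s i < s j) \<and> (\<forall>i<n. s i < k) \<and>
    det (mat n n (\<lambda>(i, j). A (s i) j)) \<noteq> 0"
proof -
  let ?M = "mat n n (\<lambda>(i, j). A (r i) j)"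
  have inj: "inj_on r {0..<n}"
  proof (rule inj_onI, rule ccontr)
    fix i j assume ij: "i \<in> {0..<n}" "j \<in> {0..<n}" "r i = r j" "i \<noteq> j"
    have "det ?M = 0"
      by (rule det_identical_rows[of _ n i j]) (use ij in \<open>auto intro!: eq_vecI\<close>)
    thus False using assms(1) by simp
  qed
  define L where "L = sorted_list_of_set (r ` {0..<n})"
  have L: "set L = r ` {0..<n}" "sorted_wrt (<) L" "length L = n"
    using card_image[OF inj] by (auto simp: L_def)
  define p where "p i = (if i < n then the_inv_into {0..<n} r (L ! i) else i)" for i
  have Lr: "L ! i \<in> r ` {0..<n}" if "i < n" for i using L that nth_mem by metis
  have p_less: "p i < n" and rp: "r (p i) = L ! i" if "i < n" for i
    using the_inv_into_into[OF inj Lr[OF that], of "{0..<n}"] f_the_inv_into_f[OF inj Lr[OF that]] that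
    by (auto simp: p_def)
  have "inj_on p {0..<n}"
  proof (rule inj_onI)
    fix i j assume ij: "i \<in> {0..<n}" "j \<in> {0..<n}" "p i = p j"
    hence "L ! i = L ! j" using rp by (metis atLeastLessThan_iff)
    thus "i = j" using L(2,3) ij by (auto simp: nth_eq_iff_index_eq strict_sorted_iff)
  qed
  hence "bij_betw p {0..<n} {0..<n}"
    using p_less by (intro bij_betw_imageI endo_inj_surj) auto
  hence p: "p permutes {0..<n}" by (rule bij_imp_permutes) (simp add: p_def)
  have "mat n n (\<lambda>(i, j). A (L ! i) j) = mat n n (\<lambda>(i, j). ?M $$ (p i, j))"
    by (rule eq_matI) (auto simp: rp p_less)
  hence "det (mat n n (\<lambda>(i, j). A (L ! i) j)) = signof p * det ?M"
    using det_permute_rows[OF _ p, of ?M] by simp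
  moreover have "(signof p :: complex) \<noteq> 0" using signof_cases[of p, where 'a = complex] by auto
  ultimately have "det (mat n n (\<lambda>(i, j). A (L ! i) j)) \<noteq> 0" using assms(1) by simp
  moreover have "L ! i < L ! j" if "i < j" "j < n" for i j
    using L(2,3) that by (simp add: sorted_wrt_nth_less)
  moreover have "L ! i < k" if "i < n" for i using Lr[OF that] assms(2) by auto
  ultimately show ?thesis by (intro exI[of _ "(!) L"]) auto
qed

lemma mat_rank_le_iff_minors:
  assumes "dim_col A = Suc e"
  shows "mat_rank A \<le> e \<longleftrightarrow> (\<forall>x\<in>minors (Suc e) A. x = 0)"
proof
  assume rank: "mat_rank A \<le> e"
  show "\<forall>x\<in>minors (Suc e) A. x = 0"
  proof (rule ballI, rule ccontr)
    fix x assume "x \<in> minors (Suc e) A" "x \<noteq> 0"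
    then obtain I J where IJ: "det (submatrix A I J) \<noteq> 0" "J \<subseteq> {..<Suc e}" "card J = Suc e"
      by (auto simp: minors_def assms)
    have "card {j. j < Suc e \<and> j \<in> J} \<le> vec_space.rank (dim_row A) A"
      by (rule vec_space.rank_gt_minor[OF _ IJ(1)]) (use assms in auto)
    moreover have "{j. j < Suc e \<and> j \<in> J} = J" using IJ(2) by auto
    ultimately show False using rank IJ(3) by (simp add: mat_rank_def)
  qed
next
  assume minors: "\<forall>x\<in>minors (Suc e) A. x = 0"
  define n where "n = dim_row A"
  have A: "A \<in> carrier_mat n (Suc e)" using assms by (intro carrier_matI) (simp_all add: n_def)
  have "det (mat (Suc e) (Suc e) (\<lambda>(i, j). A $$ (r i, j))) = 0" if "\<And>i. i < Suc e \<Longrightarrow> r i < n" for r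
  proof (rule ccontr)
    assume "det (mat (Suc e) (Suc e) (\<lambda>(i, j). A $$ (r i, j))) \<noteq> 0"
    from det_rows_sort[of "Suc e" "\<lambda>i j. A $$ (i, j)", OF this that] obtain s where "\<forall>i j. i < j \<longrightarrow> j < Suc e \<longrightarrow> s i < s j" "\<forall>i<Suc e. s i < n"
      "det (mat (Suc e) (Suc e) (\<lambda>(i, j). A $$ (s i, j))) \<noteq> 0" by blast
    thus False using minors unfolding minors_all_columns[OF assms] n_def by blast
  qed
  from kernel_if_minors_vanish[of "Suc e" n "\<lambda>i j. A $$ (i, j)", OF this]
  obtain v where v: "\<exists>j<Suc e. v j \<noteq> 0" "\<And>i. i < n \<Longrightarrow> (\<Sum>j<Suc e. A $$ (i, j) * v j) = 0" by blast
  have v0: "vec (Suc e) v \<noteq> 0\<^sub>v (Suc e)" using v(1) by (auto simp: vec_eq_iff)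
  have Av: "A *\<^sub>v vec (Suc e) v = 0\<^sub>v n"
    by (rule eq_vecI) (use A v(2) in \<open>auto simp: scalar_prod_def atLeast0LessThan simp del: sum.lessThan_Suc\<close>)
  have "vec_space.rank n A \<noteq> Suc e"
  proof
    assume full: "vec_space.rank n A = Suc e"
    interpret vec_space "TYPE(complex)" n .
    \<comment> \<open>Full rank yields \<open>e + 1\<close> independent elements in the set of
      columns, so no column is repeated; only for distinct columns does the kernel vector express
      dependence of this set.\<close>
    obtain S where S: "maximal S (\<lambda>T. T \<subseteq> set (cols A) \<and> lin_indpt T)"
      using maximal_exists[of "\<lambda>T. T \<subseteq> set (cols A) \<and> lin_indpt T" "card (set (cols A))" "{}"]
      by (meson List.finite_set card_mono empty_iff empty_subsetI finite_lin_indpt2 rev_finite_subset)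
    hence "Suc e = card S" using rank_card_indpt[OF A S] full by simp
    also have "\<dots> \<le> card (set (cols A))" using S by (simp add: card_mono maximal_def)
    finally have dist: "distinct (cols A)"
      using A by (intro card_distinct antisym card_length) simp
    show False
      using vec_space.lin_depI[OF A vec_carrier v0 Av dist]
        vec_space.full_rank_lin_indpt[OF A full dist] by blast
  qed
  moreover have "vec_space.rank n A \<le> Suc e" by (rule vec_space.rank_le_nc[OF A])
  ultimately show "mat_rank A \<le> e" by (simp add: mat_rank_def n_def)
qed

section \<open>The variety as a rank locus\<close>

lemma minors_hankel_eval:
  "minors (Suc e) (hankel_mat d e m c) = cpoly_eval c ` minors (Suc e) (hankel_mat d e m indet)"
proof -
  have "det (mat (Suc e) (Suc e) (\<lambda>(i, j). hval m c (r i + j))) =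
      cpoly_eval c (det (mat (Suc e) (Suc e) (\<lambda>(i, j). hval m indet (r i + j))))" for r
    unfolding cpoly_eval_det by (intro arg_cong[where f = det] eq_matI) (auto simp: hval_def)
  thus ?thesis unfolding minors_hankel_mat by (auto simp: image_iff)
qed

lemma minor_ideal_vanishes:
  assumes "f \<in> minor_ideal d e m" "\<And>g. g \<in> minors (Suc e) (hankel_mat d e m indet) \<Longrightarrow> cpoly_eval c g = 0"
  shows "cpoly_eval c f = 0"
proof -
  interpret cring "cpoly_ring m" by (rule cring_cpoly_ring)
  have "ideal {f \<in> carrier (cpoly_ring m). cpoly_eval c f = 0} (cpoly_ring m)"
    by (rule idealI_cpoly) (auto simp: cpoly_eval_add cpoly_eval_mult carrier_add carrier_mult)
  hence "minor_ideal d e m \<subseteq> {f \<in> carrier (cpoly_ring m). cpoly_eval c f = 0}"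
    unfolding minor_ideal_def Suc_eq_plus1[symmetric]
    by (rule genideal_minimal) (use assms(2) minors_indet_homog homog_carrier in blast)
  thus ?thesis using assms(1) by blast
qed

lemma taylor_variety_rank:
  assumes "d + e < m"
  shows "taylor_variety d e m =
    {X \<in> proj_space m. \<forall>T\<in>X. mat_rank (hankel_mat d e m (Polynomial.coeff T)) \<le> e}"
proof -
  interpret hankel d e m by unfold_locales (rule assms)
  let ?G = "minors (Suc e) (hankel_mat d e m indet)"
  have "(\<forall>f\<in>homogeneous_polys m \<inter> cone_ideal d e m. vanishes_at f X) \<longleftrightarrow> (\<forall>f\<in>?G. vanishes_at f X)" for X
  proof
    assume "\<forall>f\<in>homogeneous_polys m \<inter> cone_ideal d e m. vanishes_at f X"
    thus "\<forall>f\<in>?G. vanishes_at f X"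
      using minors_subset_cone_ideal minors_indet_homog homogeneous_polys_iff by blast
  next
    assume "\<forall>f\<in>?G. vanishes_at f X"
    thus "\<forall>f\<in>homogeneous_polys m \<inter> cone_ideal d e m. vanishes_at f X"
      unfolding cone_ideal_eq_minor_ideal vanishes_at_def using minor_ideal_vanishes by blast
  qed
  moreover have "(\<forall>f\<in>?G. vanishes_at f X) \<longleftrightarrow>
      (\<forall>T\<in>X. mat_rank (hankel_mat d e m (Polynomial.coeff T)) \<le> e)" for X
  proof -
    have "dim_col (hankel_mat d e m c) = Suc e" for c :: "nat \<Rightarrow> complex" by (simp add: hankel_mat_def)
    thus ?thesis
      by (auto simp: mat_rank_le_iff_minors minors_hankel_eval vanishes_at_def)
  qed
  ultimately show ?thesis unfolding taylor_variety_eq zero_locus_def by simp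
qed

theorem corollary2p4:
  fixes d e m :: nat
  shows "irreducible_space (subtopology (zariski m) (taylor_variety d e m)) \<and>
    krull_dim (subtopology (zariski m) (taylor_variety d e m)) = enat (min (d + e) m) \<and>
    (d + e < m \<longrightarrow>
       taylor_variety d e m =
         {X \<in> proj_space m. \<forall>T\<in>X. mat_rank (hankel_mat d e m (Polynomial.coeff T)) \<le> e} \<and>
       primeideal (vanishing_ideal m (taylor_variety d e m)) (cpoly_ring m) \<and>
       vanishing_ideal m (taylor_variety d e m) = minor_ideal d e m)"
proof (intro conjI impI irreducible_taylor_variety krull_dim_taylor_variety)
  assume dem: "d + e < m"
  then interpret hankel d e m by unfold_locales
  show "taylor_variety d e m =
      {X \<in> proj_space m. \<forall>T\<in>X. mat_rank (hankel_mat d e m (Polynomial.coeff T)) \<le> e}"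
    by (rule taylor_variety_rank[OF dem])
  show eq: "vanishing_ideal m (taylor_variety d e m) = minor_ideal d e m"
    by (rule vanishing_ideal_taylor_variety[OF dem])
  show "primeideal (vanishing_ideal m (taylor_variety d e m)) (cpoly_ring m)"
    unfolding eq cone_ideal_eq_minor_ideal[symmetric] by (rule primeideal_cone_ideal)
qed

end
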